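(* Let $X$ be a Banach space, let $U,Y$ be Fréchet spaces, let $A$ be a sectorial operator on $X$ with compact resolvent, and let $B:U\to X$, $C:X\to Y$, $D:U\to Y$ be continuous linear operators. Let $\mathcal{P}$ be the $(U,Y)$-relation consisting of all pairs $(u,y)\in C^\infty_{\mathrm{loc}}(\mathbb{R}_{\ge0},U)\times C^\infty_{\mathrm{loc}}(\mathbb{R}_{\ge0},Y)$ for which there exists $x\in C^\infty_{\mathrm{loc}}(\mathbb{R}_{\ge0},X)$ with $x(t)\in\mathrm{Dom}(A)$ and $$\dot x(t)=Ax(t)+Bu(t),\qquad y(t)=Cx(t)+Du(t)\qquad\text{for all }t\ge0.$$ Then $e^A$ is compact and the following are equivalent: (a) $\mathcal{P}$ is stable. (b) Every $v_0\in X$ satisfying $$(\mu_m-A)\cdots(\mu_1-A)v_0=0$$ for some $\lambda \in \mathbb{C}$ with $|\lambda|\ge1$, some $m\in\mathbb{N}$, and some $\mu_1,\dots,\mu_m\in\log\lambda$, belongs to the unobservable subspace of $(e^{At},C)$. (c) $\mathcal{P}$ is VIVO. (d) $\mathcal{P}$ is smoothly VIVO.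
   Context: All vector spaces are over $\mathbb{C}$. For $\theta\in(0,\pi]$, $\mathbb{S}_{<\theta}=\{te^{i\alpha}\mid t>0,\ \alpha\in(-\theta,\theta)\}$. An operator $A$ on a Banach space $X$ is sectorial if it is densely defined, its resolvent set contains $\omega+\mathbb{S}_{<\theta}$ for some $\theta>\pi/2$ and $\omega\in\mathbb{R}$, and there is a constant $c>0$ with $\|(\lambda-A)^{-1}\|\le c/|\lambda-\omega|$ for all $\lambda\in\omega+\mathbb{S}_{<\theta}$. A sectorial operator generates a strongly continuous semigroup on $X$, denoted $e^{At}$, $t\ge 0$; $e^A$ denotes its value at $t=1$. $A$ has compact resolvent if $(\lambda-A)^{-1}$ is compact for $\lambda$ in the resolvent set. $\log\lambda=\{\mu\in\mathbb{C}\mid e^\mu=\lambda\}$. The condition $(\mu_m-A)\cdots(\mu_1-A)v_0=0$ includes that $v_0$ lies in the domain of the product. The unobservable subspace of $(e^{At},C)$ is the largest subspace of $\ker C$ invariant under $e^{At}$ for every $t\ge0$. $C^\infty_{\mathrm{loc}}(\mathbb{R}_{\ge0},Z)$ is the space of smooth functions $\mathbb{R}_{\ge0}\to Z$. A $(U,Y)$-relation is a linear, translation-in-time invariant subspace of $C^\infty_{\mathrm{loc}}(\mathbb{R}_{\ge0},U)\times C^\infty_{\mathrm{loc}}(\mathbb{R}_{\ge0},Y)$ (pairs (input, output)). A function $f$ is vanishing if $\lim_{t\to\infty}f(t)=0$, and smoothly vanishing if $\lim_{t\to\infty}\partial_t^kf(t)=0$ for all $k\ge0$. $\mathcal{P}$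 is stable if $y$ is vanishing whenever $(0,y)\in\mathcal{P}$; it is VIVO [smoothly VIVO] if for every $(u,y)\in\mathcal{P}$ with $u$ vanishing [smoothly vanishing], $y$ is vanishing [smoothly vanishing]. *)

theory Defs
  imports "HOL-Analysis.Analysis"
begin

section \<open>Complex vector spaces, Banach spaces and Frechet spaces\<close>

class complex_vector = real_vector +
  fixes scaleC :: "complex \<Rightarrow> 'a \<Rightarrow> 'a"  (infixr \<open>*\<^sub>C\<close> 75)
  assumes scaleC_add_right: "a *\<^sub>C (x + y) = a *\<^sub>C x + a *\<^sub>C y"
    and scaleC_add_left: "(a + b) *\<^sub>C x = a *\<^sub>C x + b *\<^sub>C x"
    and scaleC_scaleC: "a *\<^sub>C (b *\<^sub>C x) = (a * b) *\<^sub>C x"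
    and scaleC_one: "1 *\<^sub>C x = x"
    and scaleR_scaleC: "r *\<^sub>R x = complex_of_real r *\<^sub>C x"

interpretation complex_vector: vector_space "scaleC :: complex \<Rightarrow> 'a \<Rightarrow> 'a::complex_vector"
  by unfold_locales (simp_all add: scaleC_add_right scaleC_add_left scaleC_scaleC scaleC_one)

abbreviation csubspace :: "'a::complex_vector set \<Rightarrow> bool"
  where "csubspace \<equiv> module.subspace scaleC"

abbreviation clinear :: "('a::complex_vector \<Rightarrow> 'b::complex_vector) \<Rightarrow> bool"
  where "clinear \<equiv> Vector_Spaces.linear scaleC scaleC"

class complex_banach = complex_vector + real_normed_vector + complete_space +
  assumes norm_scaleC: "norm (a *\<^sub>C x) = cmod a * norm x"

definition (in complex_vector) cseminorm :: "('a \<Rightarrow> real) \<Rightarrow> bool"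
  where "cseminorm p \<longleftrightarrow>
    (\<forall>x. 0 \<le> p x) \<and> (\<forall>x y. p (x + y) \<le> p x + p y) \<and> (\<forall>a x. p (a *\<^sub>C x) = cmod a * p x)"

text \<open>A Hausdorff space whose topology is given by a countable family of seminorms, and which is
  complete. By metrizability, sequential completeness is completeness.\<close>

class frechet_space = complex_vector + t2_space +
  assumes ex_frechet_seminorms: "\<exists>p::nat \<Rightarrow> 'a \<Rightarrow> real.
    (\<forall>n. cseminorm (p n)) \<and>
    (\<forall>S. open S \<longleftrightarrow> (\<forall>x\<in>S. \<exists>N. \<exists>e>0. {y. \<forall>n\<le>N. p n (y - x) < e} \<subseteq> S)) \<and>
    (\<forall>X::nat \<Rightarrow> 'a. (\<forall>n. \<forall>e>0. \<exists>M. \<forall>i\<ge>M. \<forall>j\<ge>M. p n (X i - X j) < e) \<longrightarrow> convergent X)"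

instance complex_banach \<subseteq> frechet_space
proof
  have sn: "cseminorm (norm :: 'a \<Rightarrow> real)"
    by (simp add: cseminorm_def norm_triangle_ineq norm_scaleC)
  have op: "open S \<longleftrightarrow> (\<forall>x\<in>S. \<exists>N::nat. \<exists>e>0. {y. \<forall>n\<le>N. norm (y - x) < e} \<subseteq> S)" for S :: "'a set"
  proof -
    have "{y. \<forall>n\<le>N. norm (y - x) < e} = {y. norm (y - x) < e}" for N :: nat and x :: 'a and e
      by auto
    then show ?thesis
      unfolding open_dist dist_norm by (simp add: subset_eq)
  qed
  have "convergent X" if "\<forall>e>0. \<exists>M. \<forall>i\<ge>M. \<forall>j\<ge>M. norm (X i - X j) < e" for X :: "nat \<Rightarrow> 'a"
    using that by (auto intro!: Cauchy_convergent simp: Cauchy_def dist_norm)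
  with sn op show "\<exists>p::nat \<Rightarrow> 'a \<Rightarrow> real. (\<forall>n. cseminorm (p n)) \<and>
    (\<forall>S. open S \<longleftrightarrow> (\<forall>x\<in>S. \<exists>N. \<exists>e>0. {y. \<forall>n\<le>N. p n (y - x) < e} \<subseteq> S)) \<and>
    (\<forall>X::nat \<Rightarrow> 'a. (\<forall>n. \<forall>e>0. \<exists>M. \<forall>i\<ge>M. \<forall>j\<ge>M. p n (X i - X j) < e) \<longrightarrow> convergent X)"
    by (intro exI[of _ "\<lambda>_. norm"] conjI allI) simp_all
qed

lemma frechet_space_tendsto:
  obtains p :: "nat \<Rightarrow> 'a::frechet_space \<Rightarrow> real" where "\<And>n. cseminorm (p n)"
    and "\<And>(f :: 'b \<Rightarrow> 'a) L F. (f \<longlongrightarrow> L) F \<longleftrightarrow> (\<forall>n. ((\<lambda>x. p n (f x - L)) \<longlongrightarrow> 0) F)"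
proof -
  obtain p :: "nat \<Rightarrow> 'a \<Rightarrow> real" where sn: "\<And>n. cseminorm (p n)"
    and op: "\<And>S. open S \<longleftrightarrow> (\<forall>x\<in>S. \<exists>N. \<exists>e>0. {y. \<forall>n\<le>N. p n (y - x) < e} \<subseteq> S)"
    using ex_frechet_seminorms by blast
  have p0: "p n 0 = 0" for n
  proof -
    have "p n ((0::complex) *\<^sub>C 0) = cmod 0 * p n 0"
      using sn[of n] unfolding cseminorm_def by blast
    then show ?thesis by simp
  qed
  have nonneg: "0 \<le> p n x" and tri: "p n (x + y) \<le> p n x + p n y" for n x y
    using sn[of n] by (auto simp: cseminorm_def)
  have ball: "open {y. \<forall>n\<le>N. p n (y - L) < e}" (is "open ?S") for N e L
    unfolding op
  proof
    fix x assume x: "x \<in> ?S"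
    define d where "d = Min ((\<lambda>n. e - p n (x - L)) ` {..N})"
    have "d > 0" using x by (auto simp: d_def)
    have d: "d \<le> e - p n (x - L)" if "n \<le> N" for n
      using that by (auto simp: d_def)
    have "p n (y - L) < e" if "\<forall>n\<le>N. p n (y - x) < d" "n \<le> N" for y n
      using that(1)[rule_format, OF that(2)] tri[of n "y - x" "x - L"] d[OF that(2)] by simp
    then have "{y. \<forall>n\<le>N. p n (y - x) < d} \<subseteq> ?S" by blast
    with \<open>d > 0\<close> show "\<exists>N'. \<exists>d>0. {y. \<forall>n\<le>N'. p n (y - x) < d} \<subseteq> ?S" by blast
  qed
  have "(f \<longlongrightarrow> L) F \<longleftrightarrow> (\<forall>n. ((\<lambda>x. p n (f x - L)) \<longlongrightarrow> 0) F)" (is "?l \<longleftrightarrow> ?r")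
    for f :: "'b \<Rightarrow> 'a" and L F
  proof
    assume ?l
    show ?r
    proof (intro allI tendstoI)
      fix n and e :: real assume "e > 0"
      have "\<forall>\<^sub>F x in F. f x \<in> {y. \<forall>m\<le>n. p m (y - L) < e}"
        by (rule topological_tendstoD[OF \<open>?l\<close> ball]) (simp add: p0 \<open>e > 0\<close>)
      then show "\<forall>\<^sub>F x in F. dist (p n (f x - L)) 0 < e"
        by eventually_elim (simp add: dist_real_def nonneg)
    qed
  next
    assume ?r
    show ?l
    proof (rule topological_tendstoI)
      fix S assume "open S" "L \<in> S"
      then obtain N e where "e > 0" and sub: "{y. \<forall>n\<le>N. p n (y - L) < e} \<subseteq> S"
        using op by blast
      have "\<forall>\<^sub>F x in F. \<forall>n\<in>{..N}. p n (f x - L) < e"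
        using \<open>?r\<close> \<open>e > 0\<close> by (intro eventually_ball_finite) (auto intro: order_tendstoD)
      then show "\<forall>\<^sub>F x in F. f x \<in> S"
        by eventually_elim (use sub in auto)
    qed
  qed
  with sn that show thesis by blast
qed

lemma frechet_tendsto_add:
  fixes f g :: "'b \<Rightarrow> 'a::frechet_space"
  assumes f: "(f \<longlongrightarrow> a) F" and g: "(g \<longlongrightarrow> b) F"
  shows "((\<lambda>x. f x + g x) \<longlongrightarrow> a + b) F"
proof -
  obtain p :: "nat \<Rightarrow> 'a \<Rightarrow> real" where sn: "\<And>n. cseminorm (p n)"
    and lim: "\<And>(f :: 'b \<Rightarrow> 'a) L F. (f \<longlongrightarrow> L) F \<longleftrightarrow> (\<forall>n. ((\<lambda>x. p n (f x - L)) \<longlongrightarrow> 0) F)"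
    by (fact frechet_space_tendsto)
  have nonneg: "0 \<le> p n x" and tri: "p n (x + y) \<le> p n x + p n y" for n x y
    using sn[of n] by (auto simp: cseminorm_def)
  have "((\<lambda>x. p n (f x + g x - (a + b))) \<longlongrightarrow> 0) F" for n
  proof (rule tendsto_sandwich[OF _ _ tendsto_const])
    show "\<forall>\<^sub>F x in F. p n (f x + g x - (a + b)) \<le> p n (f x - a) + p n (g x - b)"
      using tri[of n "f _ - a" "g _ - b"] by (simp add: algebra_simps)
    show "((\<lambda>x. p n (f x - a) + p n (g x - b)) \<longlongrightarrow> 0) F"
      using f g unfolding lim by (auto intro: tendsto_add_zero)
  qed (auto simp: nonneg)
  then show ?thesis unfolding lim by blast
qed

lemma frechet_tendsto_scaleC:
  fixes f :: "'b \<Rightarrow> 'a::frechet_space"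
  assumes f: "(f \<longlongrightarrow> l) F"
  shows "((\<lambda>x. c *\<^sub>C f x) \<longlongrightarrow> c *\<^sub>C l) F"
proof -
  obtain p :: "nat \<Rightarrow> 'a \<Rightarrow> real" where sn: "\<And>n. cseminorm (p n)"
    and lim: "\<And>(f :: 'b \<Rightarrow> 'a) L F. (f \<longlongrightarrow> L) F \<longleftrightarrow> (\<forall>n. ((\<lambda>x. p n (f x - L)) \<longlongrightarrow> 0) F)"
    by (fact frechet_space_tendsto)
  have "p n (c *\<^sub>C f x - c *\<^sub>C l) = cmod c * p n (f x - l)" for n x
    using sn[of n] by (simp add: cseminorm_def flip: complex_vector.scale_right_diff_distrib)
  with f show ?thesis
    unfolding lim by (auto intro: tendsto_mult_right_zero)
qed

definition continuous_clinear ::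
    "('a::{complex_vector, topological_space} \<Rightarrow> 'b::{complex_vector, topological_space}) \<Rightarrow> bool"
  where "continuous_clinear f \<longleftrightarrow> clinear f \<and> continuous_on UNIV f"

definition compact_operator :: "('a::complex_banach \<Rightarrow> 'a) \<Rightarrow> bool"
  where "compact_operator T \<longleftrightarrow> continuous_clinear T \<and> compact (closure (T ` cball 0 1))"


section \<open>Unbounded operators\<close>

text \<open>An unbounded operator is given by its domain \<open>domA\<close> and a function \<open>A\<close> whose values outside
  \<open>domA\<close> are irrelevant.\<close>

definition linear_operator_on :: "'x::complex_vector set \<Rightarrow> ('x \<Rightarrow> 'x) \<Rightarrow> bool"
  where "linear_operator_on domA A \<longleftrightarrow> csubspace domA \<and>
    (\<forall>x\<in>domA. \<forall>y\<in>domA. A (x + y) = A x + A y) \<and> (\<forall>a. \<forall>x\<in>domA. A (a *\<^sub>C x) = a *\<^sub>C A x)"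

definition resolvent :: "'x::complex_vector set \<Rightarrow> ('x \<Rightarrow> 'x) \<Rightarrow> complex \<Rightarrow> 'x \<Rightarrow> 'x"
  where "resolvent domA A \<mu> = inv_into domA (\<lambda>x. \<mu> *\<^sub>C x - A x)"

definition resolvent_set :: "'x::complex_banach set \<Rightarrow> ('x \<Rightarrow> 'x) \<Rightarrow> complex set"
  where "resolvent_set domA A =
    {\<mu>. bij_betw (\<lambda>x. \<mu> *\<^sub>C x - A x) domA UNIV \<and> continuous_clinear (resolvent domA A \<mu>)}"

definition sector :: "real \<Rightarrow> complex set"
  where "sector \<theta> = {of_real t * cis \<alpha> | t \<alpha>. 0 < t \<and> - \<theta> < \<alpha> \<and> \<alpha> < \<theta>}"

definition sectorial :: "'x::complex_banach set \<Rightarrow> ('x \<Rightarrow> 'x) \<Rightarrow> bool"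
  where "sectorial domA A \<longleftrightarrow> linear_operator_on domA A \<and> closure domA = UNIV \<and>
    (\<exists>\<theta> \<omega> c. pi / 2 < \<theta> \<and> \<theta> \<le> pi \<and> 0 < c \<and>
      (\<forall>\<mu>. \<mu> - complex_of_real \<omega> \<in> sector \<theta> \<longrightarrow>
         \<mu> \<in> resolvent_set domA A \<and> onorm (resolvent domA A \<mu>) \<le> c / cmod (\<mu> - of_real \<omega>)))"

definition compact_resolvent :: "'x::complex_banach set \<Rightarrow> ('x \<Rightarrow> 'x) \<Rightarrow> bool"
  where "compact_resolvent domA A \<longleftrightarrow>
    (\<forall>\<mu>\<in>resolvent_set domA A. compact_operator (resolvent domA A \<mu>))"

text \<open>For \<open>ms = [\<mu>\<^sub>1, \<dots>, \<mu>\<^sub>m]\<close>, the domain and the values of the product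
  \<open>(\<mu>\<^sub>m - A) \<cdots> (\<mu>\<^sub>1 - A)\<close>; the head of the list is applied first.\<close>

primrec in_prod_dom :: "'x::complex_vector set \<Rightarrow> ('x \<Rightarrow> 'x) \<Rightarrow> complex list \<Rightarrow> 'x \<Rightarrow> bool"
  where
    "in_prod_dom domA A [] v \<longleftrightarrow> True"
  | "in_prod_dom domA A (\<mu> # ms) v \<longleftrightarrow> v \<in> domA \<and> in_prod_dom domA A ms (\<mu> *\<^sub>C v - A v)"

primrec prod_apply :: "('x::complex_vector \<Rightarrow> 'x) \<Rightarrow> complex list \<Rightarrow> 'x \<Rightarrow> 'x"
  where
    "prod_apply A [] v = v"
  | "prod_apply A (\<mu> # ms) v = prod_apply A ms (\<mu> *\<^sub>C v - A v)"

definition log_set :: "complex \<Rightarrow> complex set"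
  where "log_set z = {\<mu>. exp \<mu> = z}"


section \<open>Semigroups\<close>

definition C0_semigroup :: "(real \<Rightarrow> 'x::complex_banach \<Rightarrow> 'x) \<Rightarrow> bool"
  where "C0_semigroup T \<longleftrightarrow>
    (\<forall>t\<ge>0. continuous_clinear (T t)) \<and> T 0 = id \<and>
    (\<forall>s\<ge>0. \<forall>t\<ge>0. T (s + t) = T s \<circ> T t) \<and>
    (\<forall>x. continuous_on {0..} (\<lambda>t. T t x))"

definition has_generator ::
    "(real \<Rightarrow> 'x::complex_banach \<Rightarrow> 'x) \<Rightarrow> 'x set \<Rightarrow> ('x \<Rightarrow> 'x) \<Rightarrow> bool"
  where "has_generator T domA A \<longleftrightarrow>
    domA = {x. \<exists>l. ((\<lambda>h. (T h x - x) /\<^sub>R h) \<longlongrightarrow> l) (at_right 0)} \<and>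
    (\<forall>x\<in>domA. ((\<lambda>h. (T h x - x) /\<^sub>R h) \<longlongrightarrow> A x) (at_right 0))"

text \<open>A strongly continuous semigroup is determined for \<open>t \<ge> 0\<close> by its generator, so only the
  irrelevant values at \<open>t < 0\<close> depend on the choice.\<close>

definition exp_semigroup :: "'x::complex_banach set \<Rightarrow> ('x \<Rightarrow> 'x) \<Rightarrow> real \<Rightarrow> 'x \<Rightarrow> 'x"
  where "exp_semigroup domA A = (SOME T. C0_semigroup T \<and> has_generator T domA A)"

definition unobservable_subspace ::
    "(real \<Rightarrow> 'x::complex_vector \<Rightarrow> 'x) \<Rightarrow> ('x \<Rightarrow> 'y::complex_vector) \<Rightarrow> 'x set"
  where "unobservable_subspace T C =
    (GREATEST V. csubspace V \<and> V \<subseteq> {x. C x = 0} \<and> (\<forall>t\<ge>0. T t ` V \<subseteq> V))"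

lemma unobservable_subspace_eq:
  assumes T: "C0_semigroup T" and C: "clinear C"
  shows "unobservable_subspace T C = {v. \<forall>t\<ge>0. C (T t v) = 0}" (is "_ = ?V")
  unfolding unobservable_subspace_def
proof (rule Greatest_equality)
  interpret C: Vector_Spaces.linear scaleC scaleC C by (fact C)
  have lin: "Vector_Spaces.linear scaleC scaleC (T t)" if "t \<ge> 0" for t
    using T that by (auto simp: C0_semigroup_def continuous_clinear_def)
  have "csubspace ?V"
    unfolding complex_vector.subspace_def
  proof (intro conjI ballI allI)
    show "0 \<in> ?V"
      using lin[THEN Vector_Spaces.linear.axioms(3), THEN module_hom.zero] by (simp add: C.zero)
  next
    fix v w assume "v \<in> ?V" "w \<in> ?V"
    then show "v + w \<in> ?V"
      using lin[THEN Vector_Spaces.linear.axioms(3), THEN module_hom.add] by (simp add: C.add)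
  next
    fix a v assume "v \<in> ?V"
    then show "a *\<^sub>C v \<in> ?V"
      using lin[THEN Vector_Spaces.linear.axioms(3), THEN module_hom.scale] by (simp add: C.scale)
  qed
  moreover have "?V \<subseteq> {x. C x = 0}"
    using T by (force simp: C0_semigroup_def dest: spec[of _ 0])
  moreover have "T t ` ?V \<subseteq> ?V" if "t \<ge> 0" for t
  proof -
    have "T s (T t v) = T (s + t) v" if "s \<ge> 0" for s v
      using T that \<open>t \<ge> 0\<close> by (simp add: C0_semigroup_def)
    with that show ?thesis by auto
  qed
  ultimately show "csubspace ?V \<and> ?V \<subseteq> {x. C x = 0} \<and> (\<forall>t\<ge>0. T t ` ?V \<subseteq> ?V)"
    by blast
next
  fix V assume "csubspace V \<and> V \<subseteq> {x. C x = 0} \<and> (\<forall>t\<ge>0. T t ` V \<subseteq> V)"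
  then show "V \<subseteq> ?V" by blast
qed


section \<open>Smooth functions on the half-line\<close>

text \<open>The library derivatives require a normed target. At \<open>t = 0\<close> the derivative is one-sided.\<close>

definition has_halfline_derivative ::
    "(real \<Rightarrow> 'a::{real_vector, t2_space}) \<Rightarrow> 'a \<Rightarrow> real \<Rightarrow> bool"
  where "has_halfline_derivative f d t \<longleftrightarrow>
    ((\<lambda>s. (f s - f t) /\<^sub>R (s - t)) \<longlongrightarrow> d) (at t within {0..})"

lemma has_halfline_derivative_normed:
  fixes f :: "real \<Rightarrow> 'a::real_normed_vector"
  shows "has_halfline_derivative f d t \<longleftrightarrow> (f has_vector_derivative d) (at t within {0..})"
proof -
  have "norm ((f s - f t) /\<^sub>R (s - t) - d) = norm ((f s - f t - (s - t) *\<^sub>R d) /\<^sub>R norm (s - t))"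
    if "s \<noteq> t" for s
  proof -
    have "(f s - f t) /\<^sub>R (s - t) - d = (f s - f t - (s - t) *\<^sub>R d) /\<^sub>R (s - t)"
      using that by (simp add: scaleR_right_diff_distrib)
    then show ?thesis by simp
  qed
  then have "has_halfline_derivative f d t \<longleftrightarrow>
      ((\<lambda>s. norm ((f s - f t - (s - t) *\<^sub>R d) /\<^sub>R norm (s - t))) \<longlongrightarrow> 0) (at t within {0..})"
    unfolding has_halfline_derivative_def
    by (subst LIM_zero_iff[symmetric], subst tendsto_norm_zero_iff[symmetric], intro tendsto_cong)
      (auto simp: eventually_at_filter)
  also have "\<dots> \<longleftrightarrow> (f has_vector_derivative d) (at t within {0..})"
    unfolding has_vector_derivative_def has_derivative_within tendsto_norm_zero_iff
    by (simp add: bounded_linear_scaleR_left divide_inverse_commute diff_diff_eq)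
  finally show ?thesis .
qed

definition halfline_deriv :: "(real \<Rightarrow> 'a::{real_vector, t2_space}) \<Rightarrow> real \<Rightarrow> 'a"
  where "halfline_deriv f t = (if 0 \<le> t then THE d. has_halfline_derivative f d t else 0)"

text \<open>A function on \<open>\<real>\<^sub>\<ge>\<^sub>0\<close> is represented by its extension by 0 to the real line.\<close>

definition smooth_halfline :: "(real \<Rightarrow> 'a::{real_vector, t2_space}) set"
  where "smooth_halfline = {f. (\<forall>t<0. f t = 0) \<and>
    (\<forall>k. \<forall>t\<ge>0. \<exists>d. has_halfline_derivative ((halfline_deriv ^^ k) f) d t)}"

lemma halfline_deriv_eq:
  assumes "has_halfline_derivative f d t" "0 \<le> t"
  shows "halfline_deriv f t = d"
proof -
  have "at t within {0..} \<noteq> bot"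
    using assms(2) at_within_Icc_at_right[of t "t + 1"] at_le[of "{t..t + 1}" "{0..}" t]
    by (auto simp: bot_unique)
  then show ?thesis
    using assms unfolding halfline_deriv_def has_halfline_derivative_def
    by (auto intro: tendsto_unique)
qed

lemma halfline_deriv_ext:
  assumes "\<And>t. 0 \<le> t \<Longrightarrow> has_halfline_derivative f (g t) t" and "\<And>t. t < 0 \<Longrightarrow> g t = 0"
  shows "halfline_deriv f = g"
proof
  fix t show "halfline_deriv f t = g t"
  proof (cases "0 \<le> t")
    case True
    then show ?thesis by (intro halfline_deriv_eq assms)
  next
    case False
    then show ?thesis by (simp add: halfline_deriv_def assms(2))
  qed
qed

definition vanishing :: "(real \<Rightarrow> 'a::{real_vector, t2_space}) \<Rightarrow> bool"
  where "vanishing f \<longleftrightarrow> (f \<longlongrightarrow> 0) at_top"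

definition smoothly_vanishing :: "(real \<Rightarrow> 'a::{real_vector, t2_space}) \<Rightarrow> bool"
  where "smoothly_vanishing f \<longleftrightarrow> (\<forall>k. vanishing ((halfline_deriv ^^ k) f))"


section \<open>Relations\<close>

definition shift :: "real \<Rightarrow> (real \<Rightarrow> 'a::zero) \<Rightarrow> real \<Rightarrow> 'a"
  where "shift s f t = (if 0 \<le> t then f (t + s) else 0)"

definition is_relation ::
    "((real \<Rightarrow> 'u::frechet_space) \<times> (real \<Rightarrow> 'y::frechet_space)) set \<Rightarrow> bool"
  where "is_relation P \<longleftrightarrow>
    P \<subseteq> smooth_halfline \<times> smooth_halfline \<and>
    ((\<lambda>_. 0), (\<lambda>_. 0)) \<in> P \<and>
    (\<forall>u y u' y'. (u, y) \<in> P \<and> (u', y') \<in> P \<longrightarrow> ((\<lambda>t. u t + u' t), (\<lambda>t. y t + y' t)) \<in> P) \<and>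
    (\<forall>a u y. (u, y) \<in> P \<longrightarrow> ((\<lambda>t. a *\<^sub>C u t), (\<lambda>t. a *\<^sub>C y t)) \<in> P) \<and>
    (\<forall>s\<ge>0. \<forall>u y. (u, y) \<in> P \<longrightarrow> (shift s u, shift s y) \<in> P)"

definition stable ::
    "((real \<Rightarrow> 'u::frechet_space) \<times> (real \<Rightarrow> 'y::frechet_space)) set \<Rightarrow> bool"
  where "stable P \<longleftrightarrow> (\<forall>y. ((\<lambda>_. 0), y) \<in> P \<longrightarrow> vanishing y)"

text \<open>VIVO: vanishing input, vanishing output.\<close>

definition VIVO ::
    "((real \<Rightarrow> 'u::frechet_space) \<times> (real \<Rightarrow> 'y::frechet_space)) set \<Rightarrow> bool"
  where "VIVO P \<longleftrightarrow> (\<forall>(u, y)\<in>P. vanishing u \<longrightarrow> vanishing y)"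

definition smoothly_VIVO ::
    "((real \<Rightarrow> 'u::frechet_space) \<times> (real \<Rightarrow> 'y::frechet_space)) set \<Rightarrow> bool"
  where "smoothly_VIVO P \<longleftrightarrow> (\<forall>(u, y)\<in>P. smoothly_vanishing u \<longrightarrow> smoothly_vanishing y)"

definition state_space_relation ::
    "'x::complex_banach set \<Rightarrow> ('x \<Rightarrow> 'x) \<Rightarrow> ('u::frechet_space \<Rightarrow> 'x) \<Rightarrow>
      ('x \<Rightarrow> 'y::frechet_space) \<Rightarrow> ('u \<Rightarrow> 'y) \<Rightarrow> ((real \<Rightarrow> 'u) \<times> (real \<Rightarrow> 'y)) set"
  where "state_space_relation domA A B C D =
    {(u, y). u \<in> smooth_halfline \<and> y \<in> smooth_halfline \<and>
      (\<exists>x\<in>smooth_halfline. \<forall>t\<ge>0. x t \<in> domA \<and>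
        has_halfline_derivative x (A (x t) + B (u t)) t \<and> y t = C (x t) + D (u t))}"

lemma smooth_halfline_coinduct:
  assumes "Q f"
    and step: "\<And>f. Q f \<Longrightarrow> (\<forall>t<0. f t = 0) \<and> (\<forall>t\<ge>0. \<exists>d. has_halfline_derivative f d t) \<and>
      Q (halfline_deriv f)"
  shows "f \<in> smooth_halfline"
proof -
  have "Q ((halfline_deriv ^^ k) f)" for k
    by (induction k) (use assms in auto)
  with step have "\<forall>k. \<forall>t\<ge>0. \<exists>d. has_halfline_derivative ((halfline_deriv ^^ k) f) d t" by blast
  with step[OF \<open>Q f\<close>] show ?thesis
    unfolding smooth_halfline_def by blast
qed

lemma smooth_halfline_step:
  assumes "f \<in> smooth_halfline"
  shows "\<And>t. t < 0 \<Longrightarrow> f t = 0"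
    and "\<And>t. 0 \<le> t \<Longrightarrow> has_halfline_derivative f (halfline_deriv f t) t"
    and "halfline_deriv f \<in> smooth_halfline"
proof -
  have d: "\<exists>d. has_halfline_derivative ((halfline_deriv ^^ k) f) d t" if "0 \<le> t" for k t
    using assms that unfolding smooth_halfline_def by blast
  show "has_halfline_derivative f (halfline_deriv f t) t" if "0 \<le> t" for t
    using d[OF that, of 0] halfline_deriv_eq[of f _ t] that by auto
  have "\<exists>d. has_halfline_derivative ((halfline_deriv ^^ k) (halfline_deriv f)) d t" if "0 \<le> t" for k t
    using d[OF that, of "Suc k"] by (simp only: funpow_Suc_right o_apply)
  then show "halfline_deriv f \<in> smooth_halfline"
    unfolding smooth_halfline_def by (simp add: halfline_deriv_def)
qed (use assms in \<open>auto simp: smooth_halfline_def\<close>)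

lemma has_halfline_derivative_add:
  fixes f g :: "real \<Rightarrow> 'a::frechet_space"
  assumes "has_halfline_derivative f d t" "has_halfline_derivative g e t"
  shows "has_halfline_derivative (\<lambda>t. f t + g t) (d + e) t"
  using frechet_tendsto_add[OF assms[unfolded has_halfline_derivative_def]]
  unfolding has_halfline_derivative_def by (simp add: algebra_simps)

lemma has_halfline_derivative_scaleC:
  fixes f :: "real \<Rightarrow> 'a::frechet_space"
  assumes "has_halfline_derivative f d t"
  shows "has_halfline_derivative (\<lambda>t. a *\<^sub>C f t) (a *\<^sub>C d) t"
proof -
  have "a *\<^sub>C (x /\<^sub>R r) = (a *\<^sub>C x) /\<^sub>R r" for x :: 'a and r
    by (simp add: scaleR_scaleC scaleC_scaleC mult.commute)
  with frechet_tendsto_scaleC[OF assms[unfolded has_halfline_derivative_def], of a]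
  show ?thesis
    unfolding has_halfline_derivative_def
    by (simp flip: complex_vector.scale_right_diff_distrib)
qed

lemma has_halfline_derivative_shift:
  assumes f: "has_halfline_derivative f d (t + s)" and "0 \<le> s" "0 \<le> t"
  shows "has_halfline_derivative (shift s f) d t"
proof -
  have "filterlim (\<lambda>r. r + s) (at (t + s) within {0..}) (at t within {0..})"
    using \<open>0 \<le> s\<close> by (auto simp: filterlim_at eventually_at_filter intro!: tendsto_intros)
  from filterlim_compose[OF f[unfolded has_halfline_derivative_def] this]
  have "((\<lambda>r. (f (r + s) - f (t + s)) /\<^sub>R (r - t)) \<longlongrightarrow> d) (at t within {0..})"
    by simp
  moreover have "\<forall>\<^sub>F r in at t within {0..}.
      (f (r + s) - f (t + s)) /\<^sub>R (r - t) = (shift s f r - shift s f t) /\<^sub>R (r - t)"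
    using \<open>0 \<le> t\<close> by (auto simp: eventually_at_filter shift_def)
  ultimately show ?thesis
    unfolding has_halfline_derivative_def by (simp cong: tendsto_cong)
qed

lemma smooth_halfline_zero: "(\<lambda>_. 0) \<in> (smooth_halfline :: (real \<Rightarrow> 'a::{real_vector, t2_space}) set)"
proof (rule smooth_halfline_coinduct[where Q = "\<lambda>f. f = (\<lambda>_. 0)"])
  have d: "has_halfline_derivative (\<lambda>_. 0::'a) 0 t" for t
    by (simp add: has_halfline_derivative_def)
  show "(\<lambda>_. 0::'a) = (\<lambda>_. 0)" ..
  fix f :: "real \<Rightarrow> 'a" assume "f = (\<lambda>_. 0)"
  moreover have "halfline_deriv (\<lambda>_. 0::'a) = (\<lambda>_. 0)"
    by (rule halfline_deriv_ext) (simp_all add: d)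
  ultimately show "(\<forall>t<0. f t = 0) \<and> (\<forall>t\<ge>0. \<exists>d. has_halfline_derivative f d t) \<and>
      halfline_deriv f = (\<lambda>_. 0)"
    using d by blast
qed

lemma smooth_halfline_add:
  fixes f g :: "real \<Rightarrow> 'a::frechet_space"
  assumes "f \<in> smooth_halfline" "g \<in> smooth_halfline"
  shows "(\<lambda>t. f t + g t) \<in> smooth_halfline"
proof (rule smooth_halfline_coinduct
    [where Q = "\<lambda>h. \<exists>f\<in>smooth_halfline. \<exists>g\<in>smooth_halfline. h = (\<lambda>t. f t + g t)"])
  fix h :: "real \<Rightarrow> 'a"
  assume "\<exists>f\<in>smooth_halfline. \<exists>g\<in>smooth_halfline. h = (\<lambda>t. f t + g t)"
  then obtain f g where fg: "f \<in> smooth_halfline" "g \<in> smooth_halfline"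
    and h: "h = (\<lambda>t. f t + g t)" by blast
  have d: "has_halfline_derivative h (halfline_deriv f t + halfline_deriv g t) t" if "0 \<le> t" for t
    unfolding h using fg that by (intro has_halfline_derivative_add smooth_halfline_step)
  then have "halfline_deriv h = (\<lambda>t. halfline_deriv f t + halfline_deriv g t)"
    by (rule halfline_deriv_ext) (simp_all add: halfline_deriv_def)
  with d fg h show "(\<forall>t<0. h t = 0) \<and> (\<forall>t\<ge>0. \<exists>d. has_halfline_derivative h d t) \<and>
      (\<exists>f\<in>smooth_halfline. \<exists>g\<in>smooth_halfline. halfline_deriv h = (\<lambda>t. f t + g t))"
    using smooth_halfline_step(1,3)[OF fg(1)] smooth_halfline_step(1,3)[OF fg(2)] by auto
qed (use assms in blast)

lemma smooth_halfline_scaleC: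
  fixes f :: "real \<Rightarrow> 'a::frechet_space"
  assumes "f \<in> smooth_halfline"
  shows "(\<lambda>t. a *\<^sub>C f t) \<in> smooth_halfline"
proof (rule smooth_halfline_coinduct[where Q = "\<lambda>h. \<exists>f\<in>smooth_halfline. h = (\<lambda>t. a *\<^sub>C f t)"])
  fix h :: "real \<Rightarrow> 'a"
  assume "\<exists>f\<in>smooth_halfline. h = (\<lambda>t. a *\<^sub>C f t)"
  then obtain f where f: "f \<in> smooth_halfline" and h: "h = (\<lambda>t. a *\<^sub>C f t)" by blast
  have d: "has_halfline_derivative h (a *\<^sub>C halfline_deriv f t) t" if "0 \<le> t" for t
    unfolding h using f that by (intro has_halfline_derivative_scaleC smooth_halfline_step)
  then have "halfline_deriv h = (\<lambda>t. a *\<^sub>C halfline_deriv f t)"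
    by (rule halfline_deriv_ext) (simp_all add: halfline_deriv_def)
  with d f h show "(\<forall>t<0. h t = 0) \<and> (\<forall>t\<ge>0. \<exists>d. has_halfline_derivative h d t) \<and>
      (\<exists>f\<in>smooth_halfline. halfline_deriv h = (\<lambda>t. a *\<^sub>C f t))"
    using smooth_halfline_step(1,3)[OF f] by auto
qed (use assms in blast)

lemma smooth_halfline_shift:
  fixes f :: "real \<Rightarrow> 'a::frechet_space"
  assumes "f \<in> smooth_halfline" "0 \<le> s"
  shows "shift s f \<in> smooth_halfline"
proof (rule smooth_halfline_coinduct[where Q = "\<lambda>h. \<exists>f\<in>smooth_halfline. h = shift s f"])
  fix h :: "real \<Rightarrow> 'a"
  assume "\<exists>f\<in>smooth_halfline. h = shift s f"
  then obtain f where f: "f \<in> smooth_halfline" and h: "h = shift s f" by blast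
  have d: "has_halfline_derivative h (halfline_deriv f (t + s)) t" if "0 \<le> t" for t
    unfolding h using f that \<open>0 \<le> s\<close>
    by (intro has_halfline_derivative_shift smooth_halfline_step) auto
  then have "halfline_deriv h = shift s (halfline_deriv f)"
    by (intro halfline_deriv_ext) (simp_all add: shift_def)
  with d f h show "(\<forall>t<0. h t = 0) \<and> (\<forall>t\<ge>0. \<exists>d. has_halfline_derivative h d t) \<and>
      (\<exists>f\<in>smooth_halfline. halfline_deriv h = shift s f)"
    using smooth_halfline_step(3)[OF f] by (auto simp: shift_def)
qed (use assms in blast)

lemma is_relation_state_space_relation:
  fixes A :: "'x::complex_banach \<Rightarrow> 'x" and B :: "'u::frechet_space \<Rightarrow> 'x"
    and C :: "'x \<Rightarrow> 'y::frechet_space" and D :: "'u \<Rightarrow> 'y"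
  assumes A: "linear_operator_on domA A"
    and lin: "continuous_clinear B" "continuous_clinear C" "continuous_clinear D"
  shows "is_relation (state_space_relation domA A B C D)" (is "is_relation ?P")
proof -
  interpret B: Vector_Spaces.linear scaleC scaleC B
    using lin by (simp add: continuous_clinear_def)
  interpret C: Vector_Spaces.linear scaleC scaleC C
    using lin by (simp add: continuous_clinear_def)
  interpret D: Vector_Spaces.linear scaleC scaleC D
    using lin by (simp add: continuous_clinear_def)
  have dom0: "0 \<in> domA" and dom_add: "\<And>v w. v \<in> domA \<Longrightarrow> w \<in> domA \<Longrightarrow> v + w \<in> domA"
    and dom_scale: "\<And>a v. v \<in> domA \<Longrightarrow> a *\<^sub>C v \<in> domA"
    and A_add: "\<And>v w. v \<in> domA \<Longrightarrow> w \<in> domA \<Longrightarrow> A (v + w) = A v + A w"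
    and A_scale: "\<And>a v. v \<in> domA \<Longrightarrow> A (a *\<^sub>C v) = a *\<^sub>C A v"
    using A by (auto simp: linear_operator_on_def complex_vector.subspace_def)
  have A0: "A 0 = 0"
    using A_scale[OF dom0, of 0] by simp
  have mem: "(u, y) \<in> ?P \<longleftrightarrow> u \<in> smooth_halfline \<and> y \<in> smooth_halfline \<and>
      (\<exists>x\<in>smooth_halfline. \<forall>t\<ge>0. x t \<in> domA \<and>
        has_halfline_derivative x (A (x t) + B (u t)) t \<and> y t = C (x t) + D (u t))" for u y
    by (simp add: state_space_relation_def)
  have "((\<lambda>_. 0), (\<lambda>_. 0)) \<in> ?P"
    unfolding mem
    by (intro conjI bexI[of _ "\<lambda>_. 0"] smooth_halfline_zero)
      (auto simp: dom0 A0 B.zero C.zero D.zero has_halfline_derivative_def)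
  moreover have "((\<lambda>t. u t + u' t), (\<lambda>t. y t + y' t)) \<in> ?P"
    if "(u, y) \<in> ?P" "(u', y') \<in> ?P" for u y u' y'
  proof -
    from that obtain x x' where x: "x \<in> smooth_halfline" "x' \<in> smooth_halfline"
      and eq: "\<forall>t\<ge>0. x t \<in> domA \<and>
          has_halfline_derivative x (A (x t) + B (u t)) t \<and> y t = C (x t) + D (u t)"
        "\<forall>t\<ge>0. x' t \<in> domA \<and>
          has_halfline_derivative x' (A (x' t) + B (u' t)) t \<and> y' t = C (x' t) + D (u' t)"
      unfolding mem by blast
    have "has_halfline_derivative (\<lambda>t. x t + x' t) (A (x t + x' t) + B (u t + u' t)) t"
      if "0 \<le> t" for t
      using has_halfline_derivative_add[of x _ t x'] eq that
      by (fastforce simp: A_add B.add algebra_simps)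
    with that x eq show ?thesis
      unfolding mem
      by (intro conjI bexI[of _ "\<lambda>t. x t + x' t"] smooth_halfline_add)
        (auto simp: dom_add C.add D.add)
  qed
  moreover have "((\<lambda>t. a *\<^sub>C u t), (\<lambda>t. a *\<^sub>C y t)) \<in> ?P" if "(u, y) \<in> ?P" for a u y
  proof -
    from that obtain x where x: "x \<in> smooth_halfline"
      and eq: "\<forall>t\<ge>0. x t \<in> domA \<and>
          has_halfline_derivative x (A (x t) + B (u t)) t \<and> y t = C (x t) + D (u t)"
      unfolding mem by blast
    have "has_halfline_derivative (\<lambda>t. a *\<^sub>C x t) (A (a *\<^sub>C x t) + B (a *\<^sub>C u t)) t"
      if "0 \<le> t" for t
      using has_halfline_derivative_scaleC[of x _ t a] eq that
      by (fastforce simp: A_scale B.scale scaleC_add_right)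
    with that x eq show ?thesis
      unfolding mem
      by (intro conjI bexI[of _ "\<lambda>t. a *\<^sub>C x t"] smooth_halfline_scaleC)
        (auto simp: dom_scale C.scale D.scale scaleC_add_right)
  qed
  moreover have "(shift s u, shift s y) \<in> ?P" if "(u, y) \<in> ?P" "0 \<le> s" for s u y
  proof -
    from that obtain x where x: "x \<in> smooth_halfline"
      and eq: "\<forall>t\<ge>0. x t \<in> domA \<and>
          has_halfline_derivative x (A (x t) + B (u t)) t \<and> y t = C (x t) + D (u t)"
      unfolding mem by blast
    have "has_halfline_derivative (shift s x) (A (x (t + s)) + B (u (t + s))) t"
      if "0 \<le> t" for t
      using eq that \<open>0 \<le> s\<close> by (intro has_halfline_derivative_shift) auto
    with that x eq show ?thesis
      unfolding mem
      by (intro conjI bexI[of _ "shift s x"] smooth_halfline_shift) (auto simp: shift_def)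
  qed
  moreover have "?P \<subseteq> smooth_halfline \<times> smooth_halfline"
    by (auto simp: state_space_relation_def)
  ultimately show ?thesis
    unfolding is_relation_def by blast
qed

end

theory Submission
  imports Defs "HOL-Complex_Analysis.Complex_Analysis" "HOL-Real_Asymp.Real_Asymp"
begin

text \<open>The semigroup is obtained from a contour integral of the resolvent; it maps \<open>X\<close> into the domain
  of \<open>A\<close>, so \<open>T 1\<close> factors through a compact resolvent. Let \<open>N\<close> be the unobservable subspace.
  If \<open>T 1\<close> had an eigenvalue \<open>c\<close> with \<open>|c| \<ge> 1\<close> modulo \<open>N\<close>, Riesz theory would lift the eigenvector
  to a generalized eigenvector of \<open>T 1\<close> outside \<open>N\<close>. It lies in a finite-dimensional \<open>A\<close>-invariant
  space, hence is annihilated by a product of factors \<open>\<mu> - A\<close>, and those with \<open>exp \<mu> \<noteq> c\<close> can be dropped;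
  this contradicts (b). So \<open>T 1\<close> has spectral radius less than 1 modulo \<open>N\<close>, the distance of a trajectory to \<open>N\<close>
  tends to 0 whenever the input vanishes, and the output, which only sees the state modulo \<open>N\<close>,
  vanishes too. Passing to quotient spaces is avoided by working with the seminorm \<open>infdist v N\<close>.
  Smooth VIVO follows from VIVO because the relation is closed under differentiation.
  Conversely, a vector \<open>v\<^sub>0\<close> as in (b) starts a smooth trajectory whose output is an exponential polynomial
  with exponents in the closed right half-plane, and this tends to 0 only if it is identically 0.\<close>

section \<open>Bounded operators on complex Banach spaces\<close>

text \<open>Condition (b) concerns vectors that a product annihilates in \<open>X\<close> itself,
  while a failure of decay is visible only modulo the unobservable subspace: it yields some
  \<open>y\<close> outside it with \<open>(c - T 1) y\<close> in it. Lifting bridges this gap, and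
  it asks that subspace only to be closed and invariant under \<open>T 1\<close>, not complemented.
  Working with \<open>T 1\<close> rather than with \<open>A\<close> makes compactness available but
  forgets which logarithm an eigenvalue comes from; this is why the product in (b) mixes several
  \<open>\<mu>\<close> with the same exponential. Excluding eigenvalues of modulus at least 1 is
  still qualitative. Compactness of \<open>T 1\<close> and of the closed unit disc turns it into one
  lower bound for all \<open>1 - w T 1\<close> with \<open>|w| \<le> 1\<close>, and such a bound
  forces decay by finite sums alone. A further obstacle is that \<open>exp_semigroup\<close> is an
  arbitrary choice among the semigroups generated by \<open>A\<close>, so whatever the contour
  integral yields reaches it only through uniqueness.\<close>

instance complex_banach \<subseteq> banach ..

lemma clinear_simps:
  assumes "clinear f"
  shows "f (x + y) = f x + f y" "f (c *\<^sub>C x) = c *\<^sub>C f x" "f 0 = 0" "f (- x) = - f x"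
    "f (x - y) = f x - f y" "f (r *\<^sub>R x) = r *\<^sub>R f x"
proof -
  interpret Vector_Spaces.linear scaleC scaleC f by fact
  show "f (x + y) = f x + f y" "f (c *\<^sub>C x) = c *\<^sub>C f x" "f 0 = 0" "f (- x) = - f x"
    "f (x - y) = f x - f y" "f (r *\<^sub>R x) = r *\<^sub>R f x"
    by (simp_all add: add scale zero neg diff scaleR_scaleC)
qed

lemma clinearI:
  assumes "\<And>x y. f (x + y) = f x + f y" "\<And>c x. f (c *\<^sub>C x) = c *\<^sub>C f x"
  shows "clinear f"
  by unfold_locales (auto simp: assms)

lemma scaleC_of_real: "complex_of_real r *\<^sub>C x = r *\<^sub>R x"
  by (simp add: scaleR_scaleC)

lemma bounded_bilinear_scaleC:
  "bounded_bilinear (scaleC :: complex \<Rightarrow> 'a::complex_banach \<Rightarrow> 'a)"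
proof
  fix a b :: complex and x y :: 'a and r :: real
  show "(a + b) *\<^sub>C x = a *\<^sub>C x + b *\<^sub>C x" "a *\<^sub>C (x + y) = a *\<^sub>C x + a *\<^sub>C y"
    by (fact scaleC_add_left scaleC_add_right)+
  show "(r *\<^sub>R a) *\<^sub>C x = r *\<^sub>R a *\<^sub>C x" "a *\<^sub>C r *\<^sub>R x = r *\<^sub>R a *\<^sub>C x"
    by (simp_all add: scaleR_scaleC scaleC_scaleC scaleR_conv_of_real mult.commute)
  show "\<exists>K. \<forall>(a::complex) x::'a. norm (a *\<^sub>C x) \<le> norm a * norm x * K"
    by (rule exI[of _ 1]) (simp add: norm_scaleC)
qed

interpretation scaleC: bounded_bilinear "scaleC :: complex \<Rightarrow> 'a::complex_banach \<Rightarrow> 'a"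
  by (rule bounded_bilinear_scaleC)

lemma continuous_clinear_bounded_linear:
  fixes f :: "'a::complex_banach \<Rightarrow> 'b::complex_banach"
  assumes "continuous_clinear f"
  shows "bounded_linear f"
proof -
  have lin: "clinear f" and "isCont f 0"
    using assms by (auto simp: continuous_clinear_def continuous_on_eq_continuous_at)
  note f = clinear_simps[OF lin]
  from \<open>isCont f 0\<close> have "\<exists>d>0. \<forall>x. dist x 0 < d \<longrightarrow> dist (f x) (f 0) < 1"
    unfolding continuous_at_eps_delta using zero_less_one by blast
  then obtain d where "d > 0" and d: "\<And>x. norm x < d \<Longrightarrow> norm (f x) < 1"
    by (auto simp: f(3))
  show ?thesis
  proof (rule bounded_linear_intro)
    show "f (x + y) = f x + f y" "f (r *\<^sub>R x) = r *\<^sub>R f x" for x y r by (fact f)+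
    show "norm (f x) \<le> norm x * (2 / d)" for x
    proof (cases "x = 0")
      case False
      have "norm (f ((d / (2 * norm x)) *\<^sub>R x)) < 1"
        using False \<open>d > 0\<close> by (intro d) simp
      then show ?thesis
        using False \<open>d > 0\<close> by (simp add: f field_simps)
    qed (simp add: f)
  qed
qed

lemma bounded_linear_continuous_clinear:
  fixes f :: "'a::complex_banach \<Rightarrow> 'b::complex_banach"
  assumes "clinear f" "\<And>x. norm (f x) \<le> M * norm x"
  shows "continuous_clinear f"
proof -
  have "bounded_linear f"
    by (rule bounded_linear_intro[where K = M])
      (use assms(2) in \<open>simp_all add: clinear_simps[OF assms(1)] mult.commute\<close>)
  then show ?thesis
    using assms(1) by (simp add: continuous_clinear_def linear_continuous_on)
qed

lemma continuous_clinear_bound: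
  fixes f :: "'a::complex_banach \<Rightarrow> 'b::complex_banach"
  assumes "continuous_clinear f"
  obtains M where "M > 0" "\<And>x. norm (f x) \<le> M * norm x"
  using bounded_linear.pos_bounded[OF continuous_clinear_bounded_linear[OF assms]]
  by (auto simp: mult.commute)

lemma csubspace_simps:
  assumes "csubspace V"
  shows "0 \<in> V" "x \<in> V \<Longrightarrow> y \<in> V \<Longrightarrow> x + y \<in> V" "x \<in> V \<Longrightarrow> c *\<^sub>C x \<in> V" "x \<in> V \<Longrightarrow> - x \<in> V"
    "x \<in> V \<Longrightarrow> y \<in> V \<Longrightarrow> x - y \<in> V" "x \<in> V \<Longrightarrow> r *\<^sub>R x \<in> V"
  using assms
  by (auto intro: complex_vector.subspace_0 complex_vector.subspace_add complex_vector.subspace_scale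
      complex_vector.subspace_neg complex_vector.subspace_diff simp: scaleR_scaleC)

lemma csubspace_image:
  assumes "csubspace V" "clinear f"
  shows "csubspace (f ` V)"
proof -
  interpret Vector_Spaces.linear scaleC scaleC f by fact
  show ?thesis using assms(1) by (rule subspace_image)
qed

section \<open>Distance to a subspace as a quotient seminorm\<close>

lemma le_mult_infdist:
  assumes "N \<noteq> {}" "M \<ge> 0" "\<And>n. n \<in> N \<Longrightarrow> g \<le> M * dist x n"
  shows "g \<le> M * infdist x N"
proof (cases "M = 0")
  case False
  then have "g / M \<le> (INF n\<in>N. dist x n)"
    using assms by (intro cINF_greatest) (auto simp: field_simps)
  then have "g / M \<le> infdist x N"
    using assms(1) by (simp add: infdist_notempty)
  then show ?thesis using False assms(2) by (simp add: field_simps)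
qed (use assms in auto)

lemma infdist_lessE:
  assumes "N \<noteq> {}" "infdist x N < e"
  obtains n where "n \<in> N" "dist x n < e"
  using assms by (auto simp: infdist_notempty cINF_less_iff)

text \<open>This is the triangle inequality of the quotient norm on \<open>X/N\<close>: the sum of
  nearly optimal elements of \<open>N\<close> is a competitor for the sum.\<close>

lemma infdist_add_csubspace:
  fixes x y :: "'a::complex_banach"
  assumes N: "csubspace N"
  shows "infdist (x + y) N \<le> infdist x N + infdist y N"
proof (rule field_le_epsilon)
  have ne: "N \<noteq> {}" using csubspace_simps(1)[OF N] by blast
  fix e :: real assume "e > 0"
  obtain m where m: "m \<in> N" "dist x m < infdist x N + e / 2"
    using infdist_lessE[OF ne, of x "infdist x N + e / 2"] \<open>e > 0\<close> by auto
  obtain n where n: "n \<in> N" "dist y n < infdist y N + e / 2"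
    using infdist_lessE[OF ne, of y "infdist y N + e / 2"] \<open>e > 0\<close> by auto
  have "infdist (x + y) N \<le> dist (x + y) (m + n)"
    using m n by (intro infdist_le csubspace_simps(2)[OF N])
  also have "\<dots> \<le> dist x m + dist y n" by (rule dist_triangle_add)
  finally show "infdist (x + y) N \<le> infdist x N + infdist y N + e"
    using m n by simp
qed

text \<open>An operator that maps \<open>V\<close> into \<open>W\<close> descends to the quotients,
  and its norm does not grow in the process.\<close>

lemma infdist_operator_le:
  fixes f :: "'a::complex_banach \<Rightarrow> 'b::complex_banach"
  assumes "csubspace V" "f ` V \<subseteq> W" "clinear f" "\<And>x. norm (f x) \<le> M * norm x" "M \<ge> 0"
  shows "infdist (f x) W \<le> M * infdist x V"
proof (rule le_mult_infdist)
  show "V \<noteq> {}" using csubspace_simps(1)[OF assms(1)] by blast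
  fix n assume "n \<in> V"
  then have "infdist (f x) W \<le> dist (f x) (f n)" using assms(2) by (intro infdist_le) auto
  also have "\<dots> \<le> M * dist x n"
    using assms(4)[of "x - n"] by (simp add: dist_norm clinear_simps[OF assms(3)])
  finally show "infdist (f x) W \<le> M * dist x n" .
qed fact

lemma clinear_scaleC: "clinear (\<lambda>x. c *\<^sub>C x)"
  by (rule clinearI) (simp_all add: scaleC_add_right scaleC_scaleC mult.commute)

lemma infdist_scaleC_le:
  fixes x :: "'a::complex_banach"
  assumes "csubspace V"
  shows "infdist (c *\<^sub>C x) V \<le> cmod c * infdist x V"
  by (rule infdist_operator_le[OF assms _ clinear_scaleC])
    (auto simp: norm_scaleC intro: csubspace_simps[OF assms])


section \<open>Riesz theory of compact operators\<close>

lemma compact_operator_subseq: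
  fixes K :: "'a::complex_banach \<Rightarrow> 'a"
  assumes "compact_operator K" "\<And>n::nat. norm (x n) \<le> M"
  obtains r l where "strict_mono r" "(\<lambda>n. K (x (r n))) \<longlonglongrightarrow> l"
proof -
  have lin: "clinear K" and comp: "compact (closure (K ` cball 0 1))"
    using assms by (auto simp: compact_operator_def continuous_clinear_def)
  define a where "a = max M 1"
  have a: "a > 0" "norm (x n) \<le> a" for n
    using assms(2)[of n] by (auto simp: a_def)
  have "K (x n /\<^sub>R a) \<in> closure (K ` cball 0 1)" for n
    using a by (intro set_mp[OF closure_subset] imageI) (simp add: field_simps)
  then obtain l r where r: "strict_mono r" "((\<lambda>n. K (x n /\<^sub>R a)) \<circ> r) \<longlonglongrightarrow> l"
    using seq_compactE[OF comp[THEN compact_imp_seq_compact], of "\<lambda>n. K (x n /\<^sub>R a)"] by metis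
  from tendsto_scaleR[OF tendsto_const[of a] r(2)]
  have "(\<lambda>n. K (x (r n))) \<longlonglongrightarrow> a *\<^sub>R l"
    using a by (simp add: clinear_simps[OF lin] o_def)
  with r(1) that show thesis by blast
qed

lemma separated_not_convergent:
  fixes f :: "nat \<Rightarrow> 'a::metric_space"
  assumes "e > 0" "\<And>m n. m < n \<Longrightarrow> e \<le> dist (f m) (f n)" "strict_mono r"
  shows "\<not> (\<lambda>n. f (r n)) \<longlonglongrightarrow> l"
proof
  assume "(\<lambda>n. f (r n)) \<longlonglongrightarrow> l"
  then have "Cauchy (\<lambda>n. f (r n))" by (rule LIMSEQ_imp_Cauchy)
  then obtain N where "\<And>m n. m \<ge> N \<Longrightarrow> n \<ge> N \<Longrightarrow> dist (f (r m)) (f (r n)) < e"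
    using \<open>e > 0\<close> unfolding Cauchy_def by blast
  then have "dist (f (r N)) (f (r (Suc N))) < e" by simp
  with assms(2)[of "r N" "r (Suc N)"] assms(3) show False
    by (auto simp: strict_mono_def)
qed

text \<open>The vector is \<open>y - w\<close> divided by its norm, where \<open>w\<close> is within
  a factor 2 of the best approximation of \<open>y\<close> in \<open>W\<close>; that factor is the
  loss in \<open>1 / 2\<close>.\<close>

lemma Riesz_lemma:
  fixes V W :: "'a::complex_banach set"
  assumes W: "csubspace W" "closed W" and V: "csubspace V" and "W \<subset> V"
  obtains x where "x \<in> V" "norm x = 1" "\<And>w. w \<in> W \<Longrightarrow> 1 / 2 \<le> dist x w"
proof -
  obtain y where y: "y \<in> V" "y \<notin> W" using \<open>W \<subset> V\<close> by blast
  have ne: "W \<noteq> {}" using csubspace_simps(1)[OF W(1)] by blast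
  then have pos: "infdist y W > 0"
    using y W(2) by (simp add: infdist_pos_not_in_closed)
  obtain w where w: "w \<in> W" "dist y w < 2 * infdist y W"
    by (rule infdist_lessE[OF ne, of y "2 * infdist y W"]) (use pos in auto)
  define n where "n = norm (y - w)"
  have n: "n > 0" "n < 2 * infdist y W"
    using w y by (auto simp: n_def dist_norm)
  show thesis
  proof
    show "(y - w) /\<^sub>R n \<in> V"
      using y w \<open>W \<subset> V\<close> by (intro csubspace_simps[OF V]) auto
    show "norm ((y - w) /\<^sub>R n) = 1"
      using n by (simp add: n_def)
    fix v assume "v \<in> W"
    then have "infdist y W \<le> dist y (w + n *\<^sub>R v)"
      using w by (intro infdist_le csubspace_simps[OF W(1)])
    also have "\<dots> = norm (n *\<^sub>R ((y - w) /\<^sub>R n - v))"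
      using n by (simp add: dist_norm scaleR_right_diff_distrib algebra_simps)
    also have "\<dots> = n * dist ((y - w) /\<^sub>R n) v"
      using n by (simp add: dist_norm)
    finally have "n * (1 / 2) \<le> n * dist ((y - w) /\<^sub>R n) v"
      using n by linarith
    then show "1 / 2 \<le> dist ((y - w) /\<^sub>R n) v"
      using n by (simp only: mult_le_cancel_left_pos)
  qed
qed

context
  fixes K :: "'a::complex_banach \<Rightarrow> 'a" and c :: complex
  assumes K: "compact_operator K" and c: "c \<noteq> 0"
begin

private definition S where "S x = c *\<^sub>C x - K x"

private lemma Klin: "clinear K" and Kcont: "continuous_on UNIV K"
  using K by (auto simp: compact_operator_def continuous_clinear_def)

private lemma Slin: "clinear S"
  by (rule clinearI)
    (simp_all add: S_def clinear_simps[OF Klin] scaleC_add_right scaleC_scaleC mult.commute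
      complex_vector.scale_right_diff_distrib)

private lemma Scont: "continuous_on UNIV S"
  unfolding S_def[abs_def] by (intro continuous_intros scaleC.continuous_on Kcont)

text \<open>Because \<open>x = (S x + K x) / c\<close>, a convergent subsequence of
  \<open>K (x n)\<close> together with convergence of \<open>S (x n)\<close> forces
  \<open>x n\<close> to converge along it.\<close>

private lemma convergent_subseq:
  assumes "\<And>n::nat. norm (x n) \<le> M" "(\<lambda>n. S (x n)) \<longlonglongrightarrow> y"
  obtains r l where "strict_mono r" "(\<lambda>n. x (r n)) \<longlonglongrightarrow> l" "S l = y"
proof -
  obtain r l where r: "strict_mono r" "(\<lambda>n. K (x (r n))) \<longlonglongrightarrow> l"
    by (rule compact_operator_subseq[OF K assms(1)])
  have y: "(\<lambda>n. S (x (r n))) \<longlonglongrightarrow> y"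
    using LIMSEQ_subseq_LIMSEQ[OF assms(2) r(1)] by (simp add: o_def)
  have "(\<lambda>n. inverse c *\<^sub>C (S (x (r n)) + K (x (r n)))) \<longlonglongrightarrow> inverse c *\<^sub>C (y + l)"
    by (intro scaleC.tendsto tendsto_add tendsto_const y r)
  then have lim: "(\<lambda>n. x (r n)) \<longlonglongrightarrow> inverse c *\<^sub>C (y + l)"
    using c by (simp add: S_def scaleC_scaleC scaleC_one)
  then have "(\<lambda>n. S (x (r n))) \<longlonglongrightarrow> S (inverse c *\<^sub>C (y + l))"
    by (intro continuous_on_tendsto_compose[OF Scont]) simp_all
  with y have "S (inverse c *\<^sub>C (y + l)) = y" by (rule LIMSEQ_unique[rotated])
  with r lim that show thesis by blast
qed

text \<open>Elements of the range have preimages of comparable size. Preimages of a convergent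
  sequence can thus be chosen bounded, and they converge along a subsequence.\<close>

private lemma closed_range:
  assumes V: "csubspace V" "closed V"
  shows "closed (S ` V)"
proof -
  define Z where "Z = {x \<in> V. S x = 0}"
  have Z: "csubspace Z"
    using V(1) unfolding Z_def complex_vector.subspace_def by (auto simp: clinear_simps[OF Slin])
  have neZ: "Z \<noteq> {}" using csubspace_simps(1)[OF Z] by blast
  \<comment> \<open>If no such \<open>C\<close> existed, there would be bounded vectors at distance
    at least 1 from the kernel \<open>Z\<close> of \<open>S\<close> on \<open>V\<close> with images
    tending to 0; a limit point of them would lie in \<open>Z\<close>.\<close>
  have "\<exists>C. \<forall>v\<in>V. \<exists>w\<in>V. S w = S v \<and> norm w \<le> C * norm (S v)"
  proof (rule ccontr)
    assume neg: "\<not> ?thesis"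
    have "\<exists>u. u \<in> V \<and> norm u \<le> 2 \<and> (\<forall>z\<in>Z. 1 \<le> dist u z) \<and> norm (S u) \<le> 2 / real (Suc n)" for n
    proof -
      obtain v where v: "v \<in> V" and
        v': "\<And>w. w \<in> V \<Longrightarrow> S w = S v \<Longrightarrow> real (Suc n) * norm (S v) < norm w"
        using neg by (meson not_le)
      define D where "D = infdist v Z"
      have "S v \<noteq> 0"
        using v'[of 0] csubspace_simps(1)[OF V(1)] by (auto simp: clinear_simps[OF Slin])
      then have "v \<notin> Z" by (simp add: Z_def)
      have "Z = V \<inter> S -` {0}" by (auto simp: Z_def)
      then have "closed Z"
        using V(2) continuous_closed_vimage[OF closed_singleton, of S 0] Scont
        by (auto simp: continuous_on_eq_continuous_at)
      then have "D > 0"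
        using \<open>v \<notin> Z\<close> neZ by (simp add: D_def infdist_pos_not_in_closed)
      obtain z where z: "z \<in> Z" "dist v z < 2 * D"
        by (rule infdist_lessE[OF neZ, of v "2 * D"]) (use \<open>D > 0\<close> in \<open>auto simp: D_def\<close>)
      have Svz: "S (v - z) = S v" using z(1) by (simp add: Z_def clinear_simps[OF Slin])
      \<comment> \<open>Dividing by the distance to \<open>Z\<close> instead of the norm keeps
        \<open>u\<close> at distance at least 1 from \<open>Z\<close>; subtracting the nearly
        optimal \<open>z\<close> keeps its norm at most 2.\<close>
      define u where "u = (v - z) /\<^sub>R D"
      have "u \<in> V"
        unfolding u_def using v z by (intro csubspace_simps[OF V(1)]) (auto simp: Z_def)
      moreover have "norm u = dist v z / D"
        using \<open>D > 0\<close> by (simp add: u_def dist_norm divide_inverse mult.commute)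
      then have "norm u \<le> 2"
        using z \<open>D > 0\<close> by (simp add: divide_le_eq)
      moreover have "1 \<le> dist u z'" if "z' \<in> Z" for z'
      proof -
        have "D \<le> dist v (z + D *\<^sub>R z')"
          unfolding D_def using z that by (intro infdist_le csubspace_simps[OF Z])
        also have "\<dots> = norm (D *\<^sub>R (u - z'))"
          using \<open>D > 0\<close> by (simp add: u_def dist_norm scaleR_right_diff_distrib algebra_simps)
        finally show ?thesis using \<open>D > 0\<close> by (simp add: dist_norm)
      qed
      moreover have "norm (S u) \<le> 2 / real (Suc n)"
      proof -
        have "real (Suc n) * norm (S v) < 2 * D"
          using v'[of "v - z"] v z Svz by (auto simp: Z_def dist_norm csubspace_simps[OF V(1)])
        then have "norm (S v) / D < 2 / real (Suc n)"
          using \<open>D > 0\<close> by (simp add: field_simps)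
        then show ?thesis
          using \<open>D > 0\<close> Svz by (simp add: u_def clinear_simps(6)[OF Slin] divide_inverse mult.commute)
      qed
      ultimately show ?thesis by blast
    qed
    then obtain u where u: "\<And>n. u n \<in> V" "\<And>n. norm (u n) \<le> 2"
      "\<And>n z. z \<in> Z \<Longrightarrow> 1 \<le> dist (u n) z" "\<And>n. norm (S (u n)) \<le> 2 / real (Suc n)"
      by metis
    have "(\<lambda>n. 2 / real (Suc n)) \<longlonglongrightarrow> 0"
      using tendsto_mult_right_zero[OF LIMSEQ_inverse_real_of_nat, of 2] by (simp add: divide_inverse)
    then have "(\<lambda>n. S (u n)) \<longlonglongrightarrow> 0"
      by (rule Lim_null_comparison[rotated]) (use u(4) in auto)
    from convergent_subseq[OF u(2) this] obtain r l
      where r: "strict_mono r" "(\<lambda>n. u (r n)) \<longlonglongrightarrow> l" "S l = 0" .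
    have "l \<in> V"
      using closed_sequentially[OF V(2) _ r(2)] u(1) by blast
    with r(3) have "l \<in> Z" by (simp add: Z_def)
    have "(\<lambda>n. dist (u (r n)) l) \<longlonglongrightarrow> 0"
      using tendsto_dist[OF r(2) tendsto_const[of l]] by simp
    then have "1 \<le> (0::real)"
      by (rule LIMSEQ_le_const) (use u(3)[OF \<open>l \<in> Z\<close>] in auto)
    then show False by simp
  qed
  then obtain C where C: "\<And>v. v \<in> V \<Longrightarrow> \<exists>w\<in>V. S w = S v \<and> norm w \<le> C * norm (S v)" by blast
  show ?thesis
    unfolding closed_sequential_limits
  proof (intro allI impI, elim conjE)
    fix y l assume y: "\<forall>n. y n \<in> S ` V" "y \<longlonglongrightarrow> l"
    have "\<forall>n. \<exists>w\<in>V. S w = y n \<and> norm w \<le> C * norm (y n)"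
      using y(1) C by (metis imageE)
    then obtain w where w: "\<And>n. w n \<in> V" "\<And>n. S (w n) = y n" "\<And>n. norm (w n) \<le> C * norm (y n)"
      by metis
    obtain B where B: "\<And>n. norm (y n) \<le> B"
      using convergent_imp_bounded[OF y(2)] by (auto simp: bounded_iff)
    have "norm (w n) \<le> \<bar>C\<bar> * B" for n
    proof -
      have "norm (w n) \<le> \<bar>C\<bar> * norm (y n)"
        using w(3)[of n] mult_right_mono[OF abs_ge_self, of "norm (y n)" C] by simp
      also have "\<dots> \<le> \<bar>C\<bar> * B" using B by (intro mult_left_mono) auto
      finally show ?thesis .
    qed
    then obtain r v where r: "strict_mono r" "(\<lambda>n. w (r n)) \<longlonglongrightarrow> v" "S v = l"
      using convergent_subseq[of w "\<bar>C\<bar> * B" l] y(2) w(2) by auto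
    moreover have "v \<in> V"
      using closed_sequentially[OF V(2) _ r(2)] w(1) by blast
    ultimately show "l \<in> S ` V" by blast
  qed
qed

text \<open>If the ranges of the powers kept shrinking, the Riesz lemma would give unit vectors
  \<open>x m\<close> in them, almost orthogonal to the next range, and the vectors
  \<open>K (x m)\<close> would be separated by \<open>cmod c / 2\<close>.\<close>

private lemma descent:
  assumes V: "csubspace V" "closed V" "K ` V \<subseteq> V"
  obtains m where "(S ^^ m) ` V = (S ^^ Suc m) ` V"
proof (rule ccontr)
  assume "\<not> thesis"
  with that have neq: "(S ^^ m) ` V \<noteq> (S ^^ Suc m) ` V" for m by blast
  define M where "M m = (S ^^ m) ` V" for m
  have M_Suc: "M (Suc m) = S ` M m" for m by (simp add: M_def image_comp)
  have M: "csubspace (M m) \<and> closed (M m)" for m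
  proof (induction m)
    case 0
    then show ?case using V by (simp add: M_def)
  next
    case (Suc m)
    then show ?case
      unfolding M_Suc using csubspace_image[OF _ Slin] closed_range by blast
  qed
  have KS: "K (S x) = S (K x)" for x
    by (simp add: S_def clinear_simps[OF Klin])
  have KM: "K ` M m \<subseteq> M m" for m
  proof (induction m)
    case 0
    then show ?case using V by (simp add: M_def)
  next
    case (Suc m)
    then show ?case unfolding M_Suc by (auto simp: KS)
  qed
  have SM: "S x \<in> M m" if "x \<in> M m" for x m
    using that M[of m] KM[of m] unfolding S_def by (auto intro!: csubspace_simps)
  then have step: "M (Suc m) \<subseteq> M m" for m unfolding M_Suc by blast
  have mono: "M n \<subseteq> M m" if "m \<le> n" for m n
    using lift_Suc_antimono_le[of M, OF step that] .
  have "M (Suc m) \<subset> M m" for m using step[of m] neq[of m] unfolding M_def by blast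
  then have "\<exists>x. x \<in> M m \<and> norm x = 1 \<and> (\<forall>w\<in>M (Suc m). 1 / 2 \<le> dist x w)" for m
    using Riesz_lemma[of "M (Suc m)" "M m"] M by metis
  then obtain x where x: "\<And>m. x m \<in> M m" "\<And>m. norm (x m) = 1"
    "\<And>m w. w \<in> M (Suc m) \<Longrightarrow> 1 / 2 \<le> dist (x m) w" by metis
  have sep: "cmod c / 2 \<le> dist (K (x m)) (K (x n))" if "m < n" for m n
  proof -
    have "K (x n) \<in> M (Suc m)" using mono[of "Suc m" n] x(1)[of n] KM[of n] that by auto
    moreover have "S (x m) \<in> M (Suc m)" using x(1) M_Suc by blast
    \<comment> \<open>The element is chosen such that \<open>c\<close> times its difference from
      \<open>x m\<close> is exactly \<open>K (x m) - K (x n)\<close>.\<close>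
    ultimately have "inverse c *\<^sub>C (S (x m) + K (x n)) \<in> M (Suc m)"
      using M by (intro csubspace_simps) auto
    from x(3)[OF this] have "1 / 2 \<le> norm (x m - inverse c *\<^sub>C (S (x m) + K (x n)))"
      by (simp add: dist_norm)
    then have "cmod c * (1 / 2) \<le> norm (c *\<^sub>C (x m - inverse c *\<^sub>C (S (x m) + K (x n))))"
      unfolding norm_scaleC by (intro mult_left_mono) auto
    also have "c *\<^sub>C (x m - inverse c *\<^sub>C (S (x m) + K (x n))) = K (x m) - K (x n)"
      using c by (simp add: complex_vector.scale_right_diff_distrib scaleC_scaleC scaleC_one
          scaleC_add_right S_def algebra_simps)
    finally show ?thesis by (simp add: dist_norm)
  qed
  obtain r l where "strict_mono r" "(\<lambda>n. K (x (r n))) \<longlonglongrightarrow> l"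
    using compact_operator_subseq[OF K, of x 1] x(2) by auto
  with separated_not_convergent[of "cmod c / 2" "\<lambda>n. K (x n)" r l] sep c show False
    by (auto simp: field_simps)
qed

text \<open>An eigenvector modulo \<open>V\<close> becomes a generalized eigenvector after subtracting an element of
  \<open>V\<close>, since the ranges of the powers of \<open>c - K\<close> on \<open>V\<close> become stationary.\<close>

lemma lift_eigenvector:
  assumes V: "csubspace V" "closed V" "K ` V \<subseteq> V" and v: "c *\<^sub>C v - K v \<in> V" "v \<notin> V"
  obtains m v' where "v' \<notin> V" "((\<lambda>x. c *\<^sub>C x - K x) ^^ m) v' = 0"
proof -
  have Seq: "S = (\<lambda>x. c *\<^sub>C x - K x)" by (simp add: S_def fun_eq_iff)
  obtain m where m: "(S ^^ m) ` V = (S ^^ Suc m) ` V" using descent[OF V] .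
  have "(S ^^ m) (S v) \<in> (S ^^ m) ` V" using v by (simp add: S_def)
  then obtain n where n: "n \<in> V" "(S ^^ m) (S v) = (S ^^ Suc m) n" unfolding m by blast
  have lin: "clinear (S ^^ k)" for k
  proof (induction k)
    case 0
    show ?case by (rule clinearI) auto
  next
    case (Suc k)
    show ?case by (rule clinearI) (simp_all add: clinear_simps[OF Slin] clinear_simps[OF Suc])
  qed
  have "(S ^^ Suc m) (v - n) = (S ^^ Suc m) v - (S ^^ Suc m) n"
    by (rule clinear_simps(5)[OF lin])
  also have "\<dots> = 0"
    using n(2) by (simp only: funpow_Suc_right o_apply) simp
  finally have "(S ^^ Suc m) (v - n) = 0" .
  moreover have "v - n \<notin> V"
    using v n(1) csubspace_simps(2)[OF V(1), of "v - n" n] by auto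
  ultimately show thesis using that unfolding Seq by blast
qed

text \<open>Generalized eigenspaces are locally compact: \<open>S\<close> lowers the order by one,
  so the images converge along a subsequence by induction, and then the vectors do by compactness of
  \<open>K\<close>.\<close>

lemma gen_eigenspace_subseq:
  assumes "\<And>n::nat. ((\<lambda>x. c *\<^sub>C x - K x) ^^ m) (x n) = 0" "\<And>n. norm (x n) \<le> M"
  obtains r l where "strict_mono r" "(\<lambda>n. x (r n)) \<longlonglongrightarrow> l"
proof -
  have Seq: "(\<lambda>x. c *\<^sub>C x - K x) = S" by (simp add: S_def fun_eq_iff)
  have "\<exists>r l. strict_mono r \<and> (\<lambda>n. x (r n)) \<longlonglongrightarrow> l"
    using assms unfolding Seq
  proof (induction m arbitrary: x M)
    case 0
    then show ?case by (intro exI[of _ id] exI[of _ 0]) (auto simp: strict_mono_def)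
  next
    case (Suc m)
    obtain B where B: "B > 0" "\<And>y. norm (S y) \<le> B * norm y"
      using continuous_clinear_bound[of S] Slin Scont by (auto simp: continuous_clinear_def)
    have "norm (S (x n)) \<le> B * M" for n
      using B(2)[of "x n"] Suc.prems(2)[of n] B(1) by (smt (verit) mult_left_mono)
    moreover have "(S ^^ m) (S (x n)) = 0" for n
      using Suc.prems(1)[of n] by (simp only: funpow_Suc_right o_apply)
    ultimately obtain r l where r: "strict_mono r" "(\<lambda>n. S (x (r n))) \<longlonglongrightarrow> l"
      using Suc.IH[of "\<lambda>n. S (x n)" "B * M"] by auto
    obtain r' l' where r': "strict_mono r'" "(\<lambda>n. x (r (r' n))) \<longlonglongrightarrow> l'"
      using convergent_subseq[of "\<lambda>n. x (r n)" M l, OF Suc.prems(2) r(2)] by metis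
    then show ?case
      using strict_mono_o[OF r(1) r'(1)] by (intro exI[of _ "r \<circ> r'"] exI[of _ l']) (simp add: o_def)
  qed
  with that show thesis by blast
qed

end

section \<open>Linear dependence in locally compact subspaces\<close>

text \<open>For \<open>g\<close> outside \<open>V\<close>, the coefficient of \<open>g\<close> is
  controlled by the norm of the vector through the distance of \<open>g\<close> from
  \<open>V\<close>; coefficients of a convergent sequence are therefore Cauchy.\<close>

lemma closed_csubspace_add_line:
  fixes V :: "'a::complex_banach set"
  assumes V: "csubspace V" "closed V"
  shows "csubspace {v + a *\<^sub>C g |v a. v \<in> V} \<and> closed {v + a *\<^sub>C g |v a. v \<in> V}"
    (is "csubspace ?W \<and> closed ?W")
proof
  show "csubspace ?W"
    unfolding complex_vector.subspace_def
  proof (intro conjI ballI allI)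
    show "0 \<in> ?W"
      using csubspace_simps(1)[OF V(1)] by (auto intro!: exI[of _ 0])
    show "x + y \<in> ?W" if x: "x \<in> ?W" and y: "y \<in> ?W" for x y
    proof -
      obtain v a w b where "v \<in> V" "w \<in> V" "x = v + a *\<^sub>C g" "y = w + b *\<^sub>C g" using x y by blast
      then show ?thesis
        by (intro CollectI exI[of _ "v + w"] exI[of _ "a + b"])
          (auto simp: scaleC_add_left intro: csubspace_simps[OF V(1)])
    qed
    show "c *\<^sub>C x \<in> ?W" if x: "x \<in> ?W" for x c
    proof -
      obtain v a where "v \<in> V" "x = v + a *\<^sub>C g" using x by blast
      then show ?thesis
        by (intro CollectI exI[of _ "c *\<^sub>C v"] exI[of _ "c * a"])
          (auto simp: scaleC_add_right scaleC_scaleC intro: csubspace_simps[OF V(1)])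
    qed
  qed
  show "closed ?W"
  proof (cases "g \<in> V")
    case True
    have "x \<in> ?W" if "x \<in> V" for x
      using that by (intro CollectI exI[of _ x] exI[of _ 0]) auto
    moreover have "?W \<subseteq> V"
      using True by (auto intro!: csubspace_simps[OF V(1)])
    ultimately have "?W = V" by blast
    then show ?thesis using V(2) by simp
  next
    case False
    have ne: "V \<noteq> {}" using csubspace_simps(1)[OF V(1)] by blast
    define D where "D = infdist g V"
    have "D > 0" using False ne V(2) by (simp add: D_def infdist_pos_not_in_closed)
    have key: "cmod a * D \<le> norm (v + a *\<^sub>C g)" if "v \<in> V" for v a
    proof (cases "a = 0")
      case False
      have "D \<le> dist g (- inverse a *\<^sub>C v)"
        unfolding D_def using that by (intro infdist_le csubspace_simps[OF V(1)])
      then have "cmod a * D \<le> norm (a *\<^sub>C (g + inverse a *\<^sub>C v))"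
        unfolding norm_scaleC by (intro mult_left_mono) (auto simp: dist_norm)
      also have "a *\<^sub>C (g + inverse a *\<^sub>C v) = v + a *\<^sub>C g"
        using False by (simp add: scaleC_add_right scaleC_scaleC scaleC_one add.commute)
      finally show ?thesis .
    qed auto
    show ?thesis
      unfolding closed_sequential_limits
    proof (intro allI impI, elim conjE)
      fix y l assume y: "\<forall>n. y n \<in> ?W" "y \<longlonglongrightarrow> l"
      have "\<forall>n. \<exists>v a. v \<in> V \<and> y n = v + a *\<^sub>C g" using y(1) by blast
      then obtain v a where va: "\<And>n. v n \<in> V" "\<And>n. y n = v n + a n *\<^sub>C g" by metis
      have "Cauchy a"
      proof (rule metric_CauchyI)
        fix e :: real assume "e > 0"
        then have "e * D > 0" using \<open>D > 0\<close> by simp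
        from metric_CauchyD[OF LIMSEQ_imp_Cauchy[OF y(2)] this] obtain n0
          where n0: "\<And>m n. m \<ge> n0 \<Longrightarrow> n \<ge> n0 \<Longrightarrow> dist (y m) (y n) < e * D" by blast
        have "dist (a m) (a n) < e" if "m \<ge> n0" "n \<ge> n0" for m n
        proof -
          have "cmod (a m - a n) * D \<le> norm ((v m - v n) + (a m - a n) *\<^sub>C g)"
            using va by (intro key csubspace_simps[OF V(1)])
          also have "\<dots> = dist (y m) (y n)"
            by (simp add: va dist_norm complex_vector.scale_left_diff_distrib algebra_simps)
          also have "\<dots> < e * D" using that by (rule n0)
          finally show ?thesis using \<open>D > 0\<close> by (simp add: dist_norm)
        qed
        then show "\<exists>M. \<forall>m\<ge>M. \<forall>n\<ge>M. dist (a m) (a n) < e" by blast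
      qed
      then obtain b where b: "a \<longlonglongrightarrow> b" using Cauchy_convergent convergent_def by blast
      have "(\<lambda>n. y n - a n *\<^sub>C g) \<longlonglongrightarrow> l - b *\<^sub>C g"
        by (intro tendsto_diff y scaleC.tendsto b tendsto_const)
      then have "v \<longlonglongrightarrow> l - b *\<^sub>C g" using va(2) by simp
      then have "l - b *\<^sub>C g \<in> V" using closed_sequentially[OF V(2)] va(1) by blast
      then show "l \<in> ?W" by (intro CollectI exI[of _ "l - b *\<^sub>C g"] exI[of _ b]) auto
    qed
  qed
qed

text \<open>Otherwise the closed spans of the first \<open>n\<close> terms increase strictly, and
  the Riesz lemma picks unit vectors of \<open>G\<close> with mutual distance at least
  \<open>1 / 2\<close>.\<close>

lemma linearly_dependent_if_locally_compact:
  fixes g :: "nat \<Rightarrow> 'a::complex_banach"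
  assumes G: "csubspace G" "\<And>n. g n \<in> G"
    and comp: "\<And>(x :: nat \<Rightarrow> 'a) M. (\<And>n. x n \<in> G) \<Longrightarrow> (\<And>n. norm (x n) \<le> M) \<Longrightarrow>
      \<exists>r l. strict_mono r \<and> (\<lambda>n. x (r n)) \<longlonglongrightarrow> l"
  obtains n c where "g n = (\<Sum>i<n. c i *\<^sub>C g i)"
proof -
  define V where "V n = {\<Sum>i<n. c i *\<^sub>C g i |c. True}" for n
  have V_Suc: "V (Suc n) = {v + a *\<^sub>C g n |v a. v \<in> V n}" for n
  proof safe
    show "\<exists>v a. x = v + a *\<^sub>C g n \<and> v \<in> V n" if "x \<in> V (Suc n)" for x
      using that by (auto simp: V_def)
    fix v a assume "v \<in> V n"
    then obtain c where c: "v = (\<Sum>i<n. c i *\<^sub>C g i)" by (auto simp: V_def)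
    have "(\<Sum>i<n. (c(n := a)) i *\<^sub>C g i) = (\<Sum>i<n. c i *\<^sub>C g i)"
      by (rule sum.cong) auto
    then show "v + a *\<^sub>C g n \<in> V (Suc n)"
      unfolding V_def c by (intro CollectI exI[of _ "c(n := a)"]) simp
  qed
  have V: "csubspace (V n) \<and> closed (V n)" for n
  proof (induction n)
    case 0
    then show ?case by (simp add: V_def complex_vector.subspace_def)
  next
    case (Suc n)
    then show ?case unfolding V_Suc using closed_csubspace_add_line by blast
  qed
  have VG: "V n \<subseteq> G" for n
  proof (induction n)
    case 0
    then show ?case using csubspace_simps(1)[OF G(1)] by (simp add: V_def)
  next
    case (Suc n)
    then show ?case unfolding V_Suc using G by (auto intro!: csubspace_simps)
  qed
  have sub: "V n \<subseteq> V (Suc n)" for n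
  proof
    fix x assume "x \<in> V n"
    then show "x \<in> V (Suc n)" unfolding V_Suc by (intro CollectI exI[of _ x] exI[of _ 0]) auto
  qed
  have mono: "V m \<subseteq> V n" if "m \<le> n" for m n
    using lift_Suc_mono_le[of V, OF sub that] .
  have "\<exists>n. g n \<in> V n"
  proof (rule ccontr)
    assume neg: "\<not> ?thesis"
    have "g n \<in> V (Suc n)" for n
      unfolding V_Suc using V[of n]
      by (intro CollectI exI[of _ 0] exI[of _ 1]) (auto simp: scaleC_one csubspace_simps(1))
    then have "V n \<subset> V (Suc n)" for n using neg sub by blast
    then have "\<exists>x. x \<in> V (Suc n) \<and> norm x = 1 \<and> (\<forall>w\<in>V n. 1 / 2 \<le> dist x w)" for n
      using Riesz_lemma[of "V n" "V (Suc n)"] V by metis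
    then obtain x where x: "\<And>n. x n \<in> V (Suc n)" "\<And>n. norm (x n) = 1"
      "\<And>n w. w \<in> V n \<Longrightarrow> 1 / 2 \<le> dist (x n) w" by metis
    have "1 / 2 \<le> dist (x m) (x n)" if "m < n" for m n
      using x(3)[of "x m" n] x(1)[of m] mono[of "Suc m" n] that by (auto simp: dist_commute)
    moreover obtain r l where "strict_mono r" "(\<lambda>n. x (r n)) \<longlonglongrightarrow> l"
      using comp[of x 1] x VG by fastforce
    ultimately show False
      using separated_not_convergent[of "1 / 2" x r l] by auto
  qed
  with that show thesis by (auto simp: V_def)
qed


section \<open>Decay from lower bounds\<close>

lemma cseminorm_simps:
  assumes "cseminorm q"
  shows "0 \<le> q x" "q (x + y) \<le> q x + q y" "q (a *\<^sub>C x) = cmod a * q x" "q 0 = 0" "q (- x) = q x"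
    "q (x - y) \<le> q x + q y"
proof -
  show *: "0 \<le> q x" "q (x + y) \<le> q x + q y" "q (a *\<^sub>C x) = cmod a * q x" for x y a
    using assms by (auto simp: cseminorm_def)
  show "q 0 = 0" using *(3)[of 0 0] by simp
  show m: "q (- x) = q x" for x using *(3)[of "- 1" x] by (simp add: scaleC_one)
  show "q (x - y) \<le> q x + q y" using *(2)[of x "- y"] m by simp
qed

lemma cseminorm_sum_le:
  assumes "cseminorm q" "\<And>i. i \<in> I \<Longrightarrow> q (f i) \<le> B i"
  shows "q (sum f I) \<le> sum B I"
  using assms(2)
proof (induction I rule: infinite_finite_induct)
  case (insert i I)
  then show ?case
    using cseminorm_simps(2)[OF assms(1), of "f i" "sum f I"] by force
qed (simp_all add: cseminorm_simps(4)[OF assms(1)])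

lemma sum_roots_of_unity:
  fixes n :: nat
  assumes "i < n" "0 < i"
  shows "(\<Sum>j<n. cis (2 * pi * real j / real n) ^ i) = 0"
proof -
  define z where "z = cis (2 * pi * real i / real n)"
  have "cis (2 * pi * real j / real n) ^ i = z ^ j" for j
    by (simp add: z_def Complex.DeMoivre algebra_simps)
  moreover have "z ^ n = 1"
    using assms by (simp add: z_def Complex.DeMoivre cis_multiple_2pi)
  moreover have "z \<noteq> 1"
    using complex_root_unity_eq_1[of n i] assms
    by (auto simp: z_def cis_conv_exp algebra_simps dest: dvd_imp_le)
  ultimately show ?thesis by (simp add: geometric_sum)
qed

text \<open>Averaging over the \<open>n\<close>-th roots of unity extracts the term of index
  0.\<close>

lemma sum_roots_of_unity_scaleC:
  assumes "n > 0"
  shows "(\<Sum>j<n. \<Sum>i<n. cis (2 * pi * real j / real n) ^ i *\<^sub>C f i) = of_nat n *\<^sub>C f 0"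
proof -
  have "(\<Sum>j<n. \<Sum>i<n. cis (2 * pi * real j / real n) ^ i *\<^sub>C f i) =
      (\<Sum>i<n. (\<Sum>j<n. cis (2 * pi * real j / real n) ^ i) *\<^sub>C f i)"
    by (subst sum.swap) (simp add: complex_vector.scale_sum_left)
  also have "\<dots> = (\<Sum>i<n. if i = 0 then of_nat n *\<^sub>C f 0 else 0)"
    by (rule sum.cong) (auto simp: sum_roots_of_unity)
  also have "\<dots> = of_nat n *\<^sub>C f 0" using assms by simp
  finally show ?thesis .
qed

text \<open>The spectral radius argument of Rickart, which needs only lower bounds:
  for an \<open>n\<close>-th root of unity \<open>\<zeta>\<close>, the sum \<open>u\<^sub>\<zeta>\<close> of the \<open>\<zeta>\<^sup>i S\<^sup>i v\<close> over \<open>i < n\<close> satisfies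
  \<open>(1 - \<zeta> S) u\<^sub>\<zeta> = v - S\<^sup>n v\<close>, and the average of the \<open>u\<^sub>\<zeta>\<close> is \<open>v\<close>. Comparing these sums for
  \<open>S = wK\<close> and \<open>S' = w'K\<close> with \<open>w'\<close> close to \<open>w\<close> transfers the decay of \<open>S\<^sup>n\<close> to \<open>S'\<^sup>n\<close>.\<close>

context
  fixes q :: "'a::complex_vector \<Rightarrow> real" and K :: "'a \<Rightarrow> 'a" and M0 M :: real
  assumes q: "cseminorm q" and Klin: "clinear K" and M0: "\<And>x. q (K x) \<le> M0 * q x" "0 < M0"
    and M: "\<And>w v. cmod w \<le> 1 \<Longrightarrow> q v \<le> M * q (v - w *\<^sub>C K v)" "0 < M"
begin

private lemma funpow_scaled: "((\<lambda>x. a *\<^sub>C K x) ^^ n) v = a ^ n *\<^sub>C (K ^^ n) v"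
  by (induction n) (simp_all add: clinear_simps[OF Klin] scaleC_scaleC scaleC_one)

text \<open>The vector \<open>u\<close> is a finite Neumann series for \<open>z w K\<close>. Since
  \<open>z ^ n = 1\<close>, the root of unity drops out of the last term, and the right-hand side is
  the same for all roots.\<close>

private lemma telescope:
  fixes w :: complex and v :: 'a
  assumes "z ^ n = 1"
  defines "u \<equiv> (\<Sum>i<n. z ^ i *\<^sub>C w ^ i *\<^sub>C (K ^^ i) v)"
  shows "u - (z * w) *\<^sub>C K u = v - w ^ n *\<^sub>C (K ^^ n) v"
proof -
  have "(\<Sum>i<m. z ^ i *\<^sub>C w ^ i *\<^sub>C (K ^^ i) v) - (z * w) *\<^sub>C K (\<Sum>i<m. z ^ i *\<^sub>C w ^ i *\<^sub>C (K ^^ i) v)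
     = v - (z * w) ^ m *\<^sub>C (K ^^ m) v" for m
  proof (induction m)
    case (Suc m)
    let ?u = "\<Sum>i<m. z ^ i *\<^sub>C w ^ i *\<^sub>C (K ^^ i) v" and ?t = "z ^ m *\<^sub>C w ^ m *\<^sub>C (K ^^ m) v"
    have "(?u + ?t) - (z * w) *\<^sub>C K (?u + ?t) =
        (?u - (z * w) *\<^sub>C K ?u) + (?t - (z * w) *\<^sub>C K ?t)"
      by (simp add: clinear_simps(1)[OF Klin] scaleC_add_right)
    also have "\<dots> = v - (z * w) ^ Suc m *\<^sub>C (K ^^ Suc m) v"
      unfolding Suc.IH
      by (simp add: clinear_simps[OF Klin] scaleC_scaleC power_mult_distrib algebra_simps)
    finally show ?case by simp
  qed (simp add: clinear_simps[OF Klin] scaleC_one)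
  from this[of n] show ?thesis using assms(1) by (simp add: u_def power_mult_distrib)
qed

text \<open>In \<open>\<epsilon>\<close>, the outer \<open>M\<close> is the lower bound at the new
  parameter, \<open>\<delta>\<close> accounts for the defect of the Neumann sum at the old one, and
  the last term for moving the parameter by \<open>h\<close>, with \<open>M * (1 + \<delta>)\<close>
  bounding that sum.\<close>

private lemma continuation:
  fixes w h \<delta> :: real
  assumes n: "n > 0" and w: "0 \<le> w" "0 \<le> h" "w + h \<le> 1" and "0 \<le> \<delta>"
    and small: "\<And>f. q (of_real w ^ n *\<^sub>C (K ^^ n) f) \<le> \<delta> * q f"
  defines "\<epsilon> \<equiv> M * (\<delta> + h * M0 * (M * (1 + \<delta>)))"
  shows "q (of_real (w + h) ^ n *\<^sub>C (K ^^ n) v) \<le> \<epsilon> * q (v - of_real (w + h) ^ n *\<^sub>C (K ^^ n) v)"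
proof -
  note q_simps = cseminorm_simps[OF q]
  define w' :: complex where "w' = of_real (w + h)"
  define f where "f = v - w' ^ n *\<^sub>C (K ^^ n) v"
  define \<zeta> where "\<zeta> j = cis (2 * pi * real j / real n)" for j :: nat
  have \<zeta>: "\<zeta> j ^ n = 1" "cmod (\<zeta> j) = 1" for j
    using n by (simp_all add: \<zeta>_def Complex.DeMoivre cis_multiple_2pi)
  define u' where "u' j = (\<Sum>i<n. \<zeta> j ^ i *\<^sub>C w' ^ i *\<^sub>C (K ^^ i) v)" for j
  \<comment> \<open>The sums for the old parameter start at \<open>f\<close>, not at
    \<open>v\<close>. Then \<open>u' j\<close> solves its equation with right-hand side
    \<open>f\<close> exactly, and \<open>u j\<close> solves the old one up to the small
    defect.\<close>
  define u where "u j = (\<Sum>i<n. \<zeta> j ^ i *\<^sub>C of_real w ^ i *\<^sub>C (K ^^ i) f)" for j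
  have u': "u' j - (\<zeta> j * w') *\<^sub>C K (u' j) = f" for j
    unfolding u'_def f_def by (rule telescope[OF \<zeta>(1)])
  have u: "u j - (\<zeta> j * of_real w) *\<^sub>C K (u j) = f - of_real w ^ n *\<^sub>C (K ^^ n) f" for j
    unfolding u_def by (rule telescope[OF \<zeta>(1)])
  have qu: "q (u j) \<le> M * (1 + \<delta>) * q f" for j
  proof -
    have "q (u j) \<le> M * q (u j - (\<zeta> j * of_real w) *\<^sub>C K (u j))"
      using w by (intro M(1)) (simp add: norm_mult \<zeta>)
    also have "q (u j - (\<zeta> j * of_real w) *\<^sub>C K (u j)) \<le> q f + \<delta> * q f"
      unfolding u using q_simps(6)[of f "of_real w ^ n *\<^sub>C (K ^^ n) f"] small[of f] by linarith
    finally show ?thesis using M(2) by (simp add: algebra_simps)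
  qed
  have diff: "q (u' j - u j) \<le> \<epsilon> * q f" for j
  proof -
    have w'_eq: "w' = of_real w + of_real h" by (simp add: w'_def)
    have "(u' j - u j) - (\<zeta> j * w') *\<^sub>C K (u' j - u j) =
        f - (u j - (\<zeta> j * of_real w) *\<^sub>C K (u j) - (\<zeta> j * of_real h) *\<^sub>C K (u j))"
      unfolding u'[of j, symmetric] w'_eq
      by (simp add: clinear_simps[OF Klin] complex_vector.scale_right_diff_distrib
          scaleC_add_left algebra_simps)
    also have "\<dots> = of_real w ^ n *\<^sub>C (K ^^ n) f + (\<zeta> j * of_real h) *\<^sub>C K (u j)"
      unfolding u by simp
    finally have eq: "(u' j - u j) - (\<zeta> j * w') *\<^sub>C K (u' j - u j) =
        of_real w ^ n *\<^sub>C (K ^^ n) f + (\<zeta> j * of_real h) *\<^sub>C K (u j)" .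
    have "q (u' j - u j) \<le> M * q ((u' j - u j) - (\<zeta> j * w') *\<^sub>C K (u' j - u j))"
      using w by (intro M(1)) (simp add: norm_mult \<zeta> w'_def del: of_real_add)
    also have "\<dots> \<le> M * (\<delta> * q f + h * (M0 * (M * (1 + \<delta>) * q f)))"
    proof (rule mult_left_mono)
      have "q ((\<zeta> j * of_real h) *\<^sub>C K (u j)) = h * q (K (u j))"
        using w by (simp add: q_simps norm_mult \<zeta>)
      also have "\<dots> \<le> h * (M0 * (M * (1 + \<delta>) * q f))"
        using w order_trans[OF M0(1) mult_left_mono[OF qu less_imp_le[OF M0(2)]]]
        by (intro mult_left_mono)
      finally show "q ((u' j - u j) - (\<zeta> j * w') *\<^sub>C K (u' j - u j))
          \<le> \<delta> * q f + h * (M0 * (M * (1 + \<delta>) * q f))"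
        unfolding eq using small[of f] q_simps(2)[of "of_real w ^ n *\<^sub>C (K ^^ n) f"] by (smt (verit))
    qed (use M in auto)
    also have "\<dots> = \<epsilon> * q f" by (simp add: \<epsilon>_def algebra_simps)
    finally show ?thesis .
  qed
  \<comment> \<open>Averaging over the roots leaves only the terms of index 0, which are
    \<open>v\<close> for \<open>u'\<close> and \<open>f\<close> for \<open>u\<close>; and
    \<open>v - f\<close> is the vector to be estimated.\<close>
  have "(\<Sum>j<n. u' j - u j) = of_nat n *\<^sub>C (v - f)"
    using sum_roots_of_unity_scaleC[OF n, of "\<lambda>i. w' ^ i *\<^sub>C (K ^^ i) v"]
      sum_roots_of_unity_scaleC[OF n, of "\<lambda>i. of_real w ^ i *\<^sub>C (K ^^ i) f"]
    by (simp add: sum_subtractf u'_def u_def \<zeta>_def scaleC_one complex_vector.scale_right_diff_distrib)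
  moreover have "q (\<Sum>j<n. u' j - u j) \<le> (\<Sum>j<n. \<epsilon> * q f)"
    by (intro cseminorm_sum_le[OF q] diff)
  ultimately have "real n * q (v - f) \<le> real n * (\<epsilon> * q f)"
    by (simp add: q_simps)
  then have "q (v - f) \<le> \<epsilon> * q f"
    using n by simp
  then show ?thesis
    by (simp add: f_def w'_def)
qed

text \<open>The parameter walks from 0 to 1 in \<open>L\<close> steps. Their length depends on
  \<open>M0\<close> and \<open>M\<close> only, because before each step the decay already reached is
  sharpened by passing to a higher power.\<close>

lemma decay_of_lower_bound: "\<exists>n>0. \<forall>v. q ((K ^^ n) v) \<le> q v / 2"
proof -
  note q_simps = cseminorm_simps[OF q]
  \<comment> \<open>The constant 12 makes the perturbation term in \<open>\<epsilon>\<close> at most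
    \<open>1 / 6\<close>, as \<open>1 + \<delta> \<le> 2\<close>. Together with
    \<open>M * \<delta> \<le> 1 / 6\<close> this gives \<open>\<epsilon> \<le> 1 / 3\<close>, and
    \<open>a \<le> (b + a) / 3\<close> means \<open>a \<le> b / 2\<close>.\<close>
  define L :: nat where "L = nat \<lceil>12 * M0 * M * M\<rceil> + 1"
  have L: "12 * M0 * M * M \<le> real L" "L > 0" by (auto simp: L_def) linarith
  define h where "h = 1 / real L"
  have h: "h > 0" "h * M0 * M * M \<le> 1 / 12"
    using L by (auto simp: h_def field_simps)
  have "\<exists>n>0. \<forall>v. q (of_real (real i * h) ^ n *\<^sub>C (K ^^ n) v) \<le> q v / 2" if "i \<le> L" for i
    using that
  proof (induction i)
    case 0
    then show ?case by (intro exI[of _ 1]) (auto simp: q_simps)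
  next
    case (Suc i)
    then obtain n where n: "n > 0" "\<And>v. q (of_real (real i * h) ^ n *\<^sub>C (K ^^ n) v) \<le> q v / 2"
      by auto
    define w where "w = real i * h"
    have w: "0 \<le> w" "w + h = real (Suc i) * h" "w + h \<le> 1"
      using h Suc.prems L by (auto simp: w_def algebra_simps) (auto simp: h_def field_simps)
    have "(\<lambda>k. (1 / 2 :: real) ^ k) \<longlonglongrightarrow> 0" by (rule LIMSEQ_realpow_zero) auto
    then obtain k where k: "(1 / 2 :: real) ^ k < min 1 (1 / (6 * M))"
      using order_tendstoD(2)[of _ 0 sequentially "min 1 (1 / (6 * M))"] M(2)
      by (auto simp: eventually_sequentially)
    define \<delta> :: real where "\<delta> = (1 / 2) ^ Suc k"
    have \<delta>: "0 \<le> \<delta>" "\<delta> \<le> 1" "M * \<delta> \<le> 1 / 6"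
      using k M(2) by (auto simp: \<delta>_def field_simps)
    define m where "m = n * Suc k"
    have small: "q (of_real w ^ m *\<^sub>C (K ^^ m) f) \<le> \<delta> * q f" for f
    proof -
      let ?S = "\<lambda>x. of_real w *\<^sub>C K x"
      have 1: "q ((?S ^^ n) x) \<le> q x / 2" for x
        using n(2)[of x] by (simp add: funpow_scaled w_def)
      have "q (((?S ^^ n) ^^ j) x) \<le> (1 / 2) ^ j * q x" for j x
      proof (induction j)
        case (Suc j)
        then show ?case using 1[of "((?S ^^ n) ^^ j) x"] by simp
      qed simp
      from this[of "Suc k" f] show ?thesis
        by (simp only: funpow_mult funpow_scaled m_def \<delta>_def)
    qed
    have "m > 0" using n by (simp add: m_def)
    define \<epsilon> where "\<epsilon> = M * (\<delta> + h * M0 * (M * (1 + \<delta>)))"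
    have \<epsilon>: "\<epsilon> \<le> 1 / 3" "0 \<le> \<epsilon>"
    proof -
      have "h * M0 * M * M * (1 + \<delta>) \<le> (1 / 12) * 2"
        using h \<delta> M M0 by (intro mult_mono) auto
      then show "\<epsilon> \<le> 1 / 3" using \<delta> by (simp add: \<epsilon>_def algebra_simps)
      show "0 \<le> \<epsilon>" using h \<delta> M M0 by (simp add: \<epsilon>_def)
    qed
    have "q (of_real (w + h) ^ m *\<^sub>C (K ^^ m) v) \<le> q v / 2" for v
    proof -
      let ?a = "of_real (w + h) ^ m *\<^sub>C (K ^^ m) v"
      have "q ?a \<le> \<epsilon> * q (v - ?a)"
        unfolding \<epsilon>_def using \<open>m > 0\<close> w h \<delta> small by (intro continuation) auto
      also have "\<dots> \<le> 1 / 3 * (q v + q ?a)"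
        using \<epsilon> q_simps(6)[of v ?a] by (intro mult_mono) (auto simp: q_simps)
      finally show ?thesis by simp
    qed
    then show ?case using \<open>m > 0\<close> unfolding w(2) by blast
  qed
  from this[of L] L show ?thesis by (auto simp: h_def scaleC_one)
qed

end

section \<open>A uniform lower bound modulo an invariant subspace\<close>

text \<open>A violating sequence has \<open>u n - w n K (u n)\<close> tending to 0 modulo
  \<open>N\<close>. Along a subsequence \<open>K (u n)\<close> tends to \<open>y\<close> and
  \<open>w n\<close> to \<open>w0\<close>, so \<open>u n\<close> tends to \<open>w0 y\<close> modulo
  \<open>N\<close>, and \<open>y\<close> is an eigenvector modulo \<open>N\<close> for
  \<open>inverse w0\<close>.\<close>

lemma compact_operator_lower_bound:
  fixes K :: "'a::complex_banach \<Rightarrow> 'a"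
  assumes K: "compact_operator K" and N: "csubspace N" "closed N" "K ` N \<subseteq> N"
    and inj: "\<And>c y. cmod c \<ge> 1 \<Longrightarrow> c *\<^sub>C y - K y \<in> N \<Longrightarrow> y \<in> N"
  obtains M where "M > 0" "\<And>w v. cmod w \<le> 1 \<Longrightarrow> infdist v N \<le> M * infdist (v - w *\<^sub>C K v) N"
proof -
  have Kcc: "continuous_clinear K" and Klin: "clinear K"
    using K by (auto simp: compact_operator_def continuous_clinear_def)
  obtain M0 where M0: "M0 > 0" "\<And>x. norm (K x) \<le> M0 * norm x"
    using continuous_clinear_bound[OF Kcc] by blast
  have ne: "N \<noteq> {}" using csubspace_simps(1)[OF N(1)] by blast
  have q_add: "infdist (x + y) N \<le> infdist x N + infdist y N" for x y
    by (rule infdist_add_csubspace[OF N(1)])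
  have q_norm: "infdist x N \<le> norm x" for x
    using infdist_le[OF csubspace_simps(1)[OF N(1)], of x] by simp
  have q_K: "infdist (K x) N \<le> M0 * infdist x N" for x
    using infdist_operator_le[OF N(1,3) Klin M0(2)] M0(1) by simp
  have q_scale: "infdist (r *\<^sub>R x) N \<le> \<bar>r\<bar> * infdist x N" for r x
    using infdist_scaleC_le[OF N(1), of "of_real r" x] by (simp add: scaleC_of_real)
  have "\<exists>M. \<forall>w v. cmod w \<le> 1 \<longrightarrow> infdist v N \<le> M * infdist (v - w *\<^sub>C K v) N"
  proof (rule ccontr)
    assume neg: "\<not> ?thesis"
    have "\<exists>w u. cmod w \<le> 1 \<and> norm u \<le> 2 \<and> 1 \<le> infdist u N \<and>
        infdist (u - w *\<^sub>C K u) N \<le> 1 / real (Suc n)" for n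
    proof -
      obtain w v where w: "cmod w \<le> 1"
        and v: "real (Suc n) * infdist (v - w *\<^sub>C K v) N < infdist v N"
        using neg by (meson not_le)
      define D where "D = infdist v N"
      have "D > 0"
        using v infdist_nonneg[of "v - w *\<^sub>C K v" N]
        by (smt (verit) D_def mult_nonneg_nonneg of_nat_0_le_iff)
      obtain z where z: "z \<in> N" "dist v z < 2 * D"
        by (rule infdist_lessE[OF ne, of v "2 * D"]) (use \<open>D > 0\<close> in \<open>auto simp: D_def\<close>)
      \<comment> \<open>A representative of distance at least 1 from \<open>N\<close> but of norm at
        most 2, so that compactness of \<open>K\<close> applies to the vectors themselves and not
        just to their classes.\<close>
      define u where "u = (v - z) /\<^sub>R D"
      have "norm u = dist v z / D"
        using \<open>D > 0\<close> by (simp add: u_def dist_norm divide_inverse mult.commute)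
      then have "norm u \<le> 2" using z \<open>D > 0\<close> by (simp add: divide_le_eq)
      moreover have "1 \<le> infdist u N"
      proof -
        have "D \<le> infdist (D *\<^sub>R u) N + infdist z N"
          using q_add[of "D *\<^sub>R u" z] \<open>D > 0\<close> by (simp add: u_def D_def)
        also have "\<dots> \<le> D * infdist u N" using q_scale[of D u] z(1) \<open>D > 0\<close> by simp
        finally show ?thesis using \<open>D > 0\<close> by simp
      qed
      moreover have "infdist (u - w *\<^sub>C K u) N \<le> 1 / real (Suc n)"
      proof -
        have zN: "w *\<^sub>C K z - z \<in> N" using z(1) N(3) by (intro csubspace_simps[OF N(1)]) auto
        have "u - w *\<^sub>C K u = (1 / D) *\<^sub>R ((v - w *\<^sub>C K v) + (w *\<^sub>C K z - z))"
          unfolding u_def clinear_simps[OF Klin] scaleC.scaleR_right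
          by (simp add: scaleC.diff_right scaleR_right_diff_distrib scaleR_right_distrib divide_inverse)
        then have "infdist (u - w *\<^sub>C K u) N \<le> 1 / D * infdist ((v - w *\<^sub>C K v) + (w *\<^sub>C K z - z)) N"
          using q_scale[of "1 / D" "(v - w *\<^sub>C K v) + (w *\<^sub>C K z - z)"] \<open>D > 0\<close> by simp
        also have "\<dots> \<le> 1 / D * infdist (v - w *\<^sub>C K v) N"
          using q_add[of "v - w *\<^sub>C K v" "w *\<^sub>C K z - z"] zN \<open>D > 0\<close>
          by (intro mult_left_mono) auto
        also have "\<dots> \<le> 1 / real (Suc n)"
          using v \<open>D > 0\<close> by (simp add: D_def field_simps)
        finally show ?thesis .
      qed
      ultimately show ?thesis using w by blast
    qed
    then obtain w u where w: "\<And>n. cmod (w n) \<le> 1" and u: "\<And>n. norm (u n) \<le> 2"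
      "\<And>n. 1 \<le> infdist (u n) N" "\<And>n. infdist (u n - w n *\<^sub>C K (u n)) N \<le> 1 / real (Suc n)"
      by metis
    obtain r y where r: "strict_mono r" "(\<lambda>n. K (u (r n))) \<longlonglongrightarrow> y"
      by (rule compact_operator_subseq[OF K u(1)])
    have "\<forall>n. w (r n) \<in> cball 0 1" using w by simp
    then obtain w0 r' where "w0 \<in> cball 0 1" "strict_mono r'" "((\<lambda>n. w (r n)) \<circ> r') \<longlonglongrightarrow> w0"
      by (rule seq_compactE[OF compact_imp_seq_compact[OF compact_cball]])
    then have r': "strict_mono r'" "(\<lambda>n. w (r (r' n))) \<longlonglongrightarrow> w0" "cmod w0 \<le> 1"
      by (simp_all add: o_def)
    define \<rho> where "\<rho> n = r (r' n)" for n
    have "strict_mono \<rho>" using strict_mono_o[OF r(1) r'(1)] by (simp add: \<rho>_def[abs_def] o_def)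
    have Ku: "(\<lambda>n. K (u (\<rho> n))) \<longlonglongrightarrow> y"
      using LIMSEQ_subseq_LIMSEQ[OF r(2) r'(1)] by (simp add: o_def \<rho>_def)
    have wlim: "(\<lambda>n. w (\<rho> n)) \<longlonglongrightarrow> w0" using r'(2) by (simp add: \<rho>_def)
    have "(\<lambda>n. 1 / real (Suc n)) \<longlonglongrightarrow> 0"
      using LIMSEQ_inverse_real_of_nat by (simp add: divide_inverse)
    then have inv0: "(\<lambda>n. 1 / real (Suc (\<rho> n))) \<longlonglongrightarrow> 0"
      using LIMSEQ_subseq_LIMSEQ[OF _ \<open>strict_mono \<rho>\<close>] by (auto simp: o_def)
    have "(\<lambda>n. w (\<rho> n) *\<^sub>C K (u (\<rho> n)) - w0 *\<^sub>C y) \<longlonglongrightarrow> 0"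
      using tendsto_diff[OF scaleC.tendsto[OF wlim Ku] tendsto_const[of "w0 *\<^sub>C y"]] by simp
    then have "(\<lambda>n. 1 / real (Suc (\<rho> n)) + norm (w (\<rho> n) *\<^sub>C K (u (\<rho> n)) - w0 *\<^sub>C y)) \<longlonglongrightarrow> 0"
      using tendsto_add[OF inv0 tendsto_norm[of _ 0]] by simp
    then have lim1: "(\<lambda>n. infdist (u (\<rho> n) - w0 *\<^sub>C y) N) \<longlonglongrightarrow> 0"
    proof (rule Lim_null_comparison[rotated], intro always_eventually allI)
      fix n
      have "infdist (u (\<rho> n) - w0 *\<^sub>C y) N \<le> infdist (u (\<rho> n) - w (\<rho> n) *\<^sub>C K (u (\<rho> n))) N
          + infdist (w (\<rho> n) *\<^sub>C K (u (\<rho> n)) - w0 *\<^sub>C y) N"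
        using q_add[of "u (\<rho> n) - w (\<rho> n) *\<^sub>C K (u (\<rho> n))" "w (\<rho> n) *\<^sub>C K (u (\<rho> n)) - w0 *\<^sub>C y"] by simp
      then show "norm (infdist (u (\<rho> n) - w0 *\<^sub>C y) N)
          \<le> 1 / real (Suc (\<rho> n)) + norm (w (\<rho> n) *\<^sub>C K (u (\<rho> n)) - w0 *\<^sub>C y)"
        using u(3)[of "\<rho> n"] q_norm[of "w (\<rho> n) *\<^sub>C K (u (\<rho> n)) - w0 *\<^sub>C y"]
        by (simp add: infdist_nonneg)
    qed
    have "1 \<le> infdist (u (\<rho> n) - w0 *\<^sub>C y) N + infdist (w0 *\<^sub>C y) N" for n
      using u(2)[of "\<rho> n"] q_add[of "u (\<rho> n) - w0 *\<^sub>C y" "w0 *\<^sub>C y"] by simp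
    \<comment> \<open>Thus \<open>w0 y\<close> is nonzero modulo \<open>N\<close>. In particular
      \<open>w0 \<noteq> 0\<close>, so \<open>inverse w0\<close> is available as the eigenvalue to
      be excluded.\<close>
    then have big: "1 \<le> infdist (w0 *\<^sub>C y) N"
      using LIMSEQ_le_const[OF tendsto_add[OF lim1 tendsto_const[of "infdist (w0 *\<^sub>C y) N"]], of 1]
      by auto
    have lim2: "(\<lambda>n. norm (y - K (u (\<rho> n))) + M0 * infdist (u (\<rho> n) - w0 *\<^sub>C y) N) \<longlonglongrightarrow> 0"
      using tendsto_add[OF tendsto_norm[OF tendsto_diff[OF tendsto_const[of y] Ku]]
          tendsto_mult[OF tendsto_const[of M0] lim1]] by simp
    have "infdist (y - w0 *\<^sub>C K y) N \<le> 0"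
    proof (rule LIMSEQ_le_const[OF lim2], intro exI allI impI)
      fix n
      have eq: "y - w0 *\<^sub>C K y = (y - K (u (\<rho> n))) + K (u (\<rho> n) - w0 *\<^sub>C y)"
        by (simp add: clinear_simps[OF Klin])
      show "infdist (y - w0 *\<^sub>C K y) N
          \<le> norm (y - K (u (\<rho> n))) + M0 * infdist (u (\<rho> n) - w0 *\<^sub>C y) N"
        unfolding eq
        using q_add[of "y - K (u (\<rho> n))" "K (u (\<rho> n) - w0 *\<^sub>C y)"] q_norm[of "y - K (u (\<rho> n))"]
          q_K[of "u (\<rho> n) - w0 *\<^sub>C y"] by linarith
    qed
    then have "y - w0 *\<^sub>C K y \<in> N"
      using N(2) ne infdist_nonneg[of "y - w0 *\<^sub>C K y" N]
      by (simp add: in_closed_iff_infdist_zero)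
    then have "inverse w0 *\<^sub>C (y - w0 *\<^sub>C K y) \<in> N" by (rule csubspace_simps[OF N(1)])
    moreover have "w0 \<noteq> 0" using big csubspace_simps(1)[OF N(1)] by auto
    ultimately have "inverse w0 *\<^sub>C y - K y \<in> N"
      by (simp add: scaleC.diff_right scaleC_scaleC scaleC_one)
    moreover have "cmod (inverse w0) \<ge> 1"
      using r'(3) \<open>w0 \<noteq> 0\<close> by (simp add: norm_inverse one_le_inverse)
    ultimately have "y \<in> N" using inj by blast
    then have "w0 *\<^sub>C y \<in> N" by (rule csubspace_simps[OF N(1)])
    then show False using big by simp
  qed
  then obtain M where M: "\<And>w v. cmod w \<le> 1 \<Longrightarrow> infdist v N \<le> M * infdist (v - w *\<^sub>C K v) N"
    by blast
  have "infdist v N \<le> max M 1 * infdist (v - w *\<^sub>C K v) N" if "cmod w \<le> 1" for w v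
    using M[OF that, of v] by (smt (verit) infdist_nonneg mult_right_mono max.cobounded1)
  then show thesis by (intro that[of "max M 1"]) auto
qed

section \<open>Integrals along a Hankel contour\<close>

text \<open>An improper integral along integer end points, which determine the limit for the
  exponentially decaying integrands considered here.\<close>

definition halfline_integral :: "(real \<Rightarrow> 'a::banach) \<Rightarrow> 'a"
  where "halfline_integral f = lim (\<lambda>n. integral {0..real n} f)"

text \<open>An integral starting at \<open>a\<close> is at most
  \<open>C / k * exp (- (k * a))\<close>. This gives the Cauchy property, and for
  \<open>a = 0\<close> the bound.\<close>

lemma halfline_integral:
  fixes f :: "real \<Rightarrow> 'a::banach"
  assumes cont: "continuous_on {0..} f" and bound: "\<And>s. 0 \<le> s \<Longrightarrow> norm (f s) \<le> C * exp (- (k * s))"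
    and k: "0 < k"
  shows "(\<lambda>n. integral {0..real n} f) \<longlonglongrightarrow> halfline_integral f"
    and "norm (halfline_integral f) \<le> C / k"
proof -
  have "C \<ge> 0" using order_trans[OF norm_ge_zero bound[of 0]] by simp
  have int: "f integrable_on {a..b}" if "0 \<le> a" for a b
    by (rule integrable_continuous_real, rule continuous_on_subset[OF cont]) (use that in auto)
  have part: "norm (integral {a..b} f) \<le> C / k * exp (- (k * a))" if "0 \<le> a" "a \<le> b" for a b
  proof -
    have "((\<lambda>s. C * exp (- (k * s))) has_integral
        (- C / k * exp (- (k * b)) - - C / k * exp (- (k * a)))) {a..b}"
      by (rule fundamental_theorem_of_calculus)
        (use that k in \<open>auto intro!: derivative_eq_intros
          simp flip: has_real_derivative_iff_has_vector_derivative\<close>)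
    moreover have "norm (integral {a..b} f) \<le> integral {a..b} (\<lambda>s. C * exp (- (k * s)))"
      using that bound int calculation
      by (intro Henstock_Kurzweil_Integration.integral_norm_bound_integral) auto
    ultimately have "norm (integral {a..b} f)
        \<le> - C / k * exp (- (k * b)) - - C / k * exp (- (k * a))"
      by (simp only: integral_unique)
    moreover have "0 \<le> C / k * exp (- (k * b))" using \<open>C \<ge> 0\<close> k by simp
    ultimately show ?thesis by simp
  qed
  have "(\<lambda>n. C / k * exp (- k) ^ n) \<longlonglongrightarrow> C / k * 0"
    using k by (intro tendsto_mult tendsto_const LIMSEQ_realpow_zero) auto
  then have lim: "(\<lambda>n. C / k * exp (- (k * real n))) \<longlonglongrightarrow> 0"
    by (simp add: mult.commute flip: exp_of_nat_mult)
  have "Cauchy (\<lambda>n. integral {0..real n} f)"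
  proof (rule metric_CauchyI)
    fix e :: real assume "e > 0"
    then obtain N where N: "\<And>n. n \<ge> N \<Longrightarrow> C / k * exp (- (k * real n)) < e / 2"
      using order_tendstoD(2)[OF lim, of "e / 2"] by (auto simp: eventually_sequentially)
    have *: "dist (integral {0..real N} f) (integral {0..real n} f) < e / 2" if "n \<ge> N" for n
    proof -
      have "integral {0..real N} f + integral {real N..real n} f = integral {0..real n} f"
        using that int[of 0 "real n"] by (intro Henstock_Kurzweil_Integration.integral_combine) auto
      then have "dist (integral {0..real N} f) (integral {0..real n} f)
          = norm (integral {real N..real n} f)"
        by (metis add_diff_cancel_left' dist_commute dist_norm)
      also have "\<dots> \<le> C / k * exp (- (k * real N))" using that by (intro part) auto
      also have "\<dots> < e / 2" by (rule N) simp
      finally show ?thesis .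
    qed
    show "\<exists>M. \<forall>m\<ge>M. \<forall>n\<ge>M. dist (integral {0..real m} f) (integral {0..real n} f) < e"
      by (rule exI[of _ N]) (auto intro: dist_triangle_half_r[OF * *])
  qed
  then show lim2: "(\<lambda>n. integral {0..real n} f) \<longlonglongrightarrow> halfline_integral f"
    unfolding halfline_integral_def by (simp add: Cauchy_convergent_iff convergent_LIMSEQ_iff)
  show "norm (halfline_integral f) \<le> C / k"
    by (rule LIMSEQ_le_const2[OF tendsto_norm[OF lim2]]) (use part[of 0] in auto)
qed

text \<open>The contour consists of the rays from 1 in the directions \<open>-\<kappa> \<plusminus> i\<close>.\<close>

definition hankel_contour :: "real \<Rightarrow> complex set"
  where "hankel_contour \<kappa> = {z. Re z = 1 - \<kappa> * \<bar>Im z\<bar>}"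

definition hankel_dir :: "real \<Rightarrow> complex"
  where "hankel_dir \<kappa> = Complex (- \<kappa>) 1"

text \<open>Both rays share the parameter \<open>s = |Im z|\<close>. The minus sign reverses the
  lower ray, so that the contour runs upwards: from infinity to 1 and out again.\<close>

definition hankel_integrand :: "real \<Rightarrow> (complex \<Rightarrow> 'a::complex_banach) \<Rightarrow> real \<Rightarrow> 'a"
  where "hankel_integrand \<kappa> f s = hankel_dir \<kappa> *\<^sub>C f (1 + s *\<^sub>R hankel_dir \<kappa>)
    - cnj (hankel_dir \<kappa>) *\<^sub>C f (1 + s *\<^sub>R cnj (hankel_dir \<kappa>))"

definition hankel_integral :: "real \<Rightarrow> (complex \<Rightarrow> 'a::complex_banach) \<Rightarrow> 'a"
  where "hankel_integral \<kappa> f = halfline_integral (hankel_integrand \<kappa> f)"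

text \<open>Since \<open>Re z = 1 - \<kappa> |Im z|\<close> on the contour, \<open>exp z\<close>
  times a bounded function satisfies such an estimate. The constant is explicit because bounds
  uniform in time are read off from it.\<close>

definition hankel_admissible :: "real \<Rightarrow> real \<Rightarrow> (complex \<Rightarrow> 'a::complex_banach) \<Rightarrow> bool"
  where "hankel_admissible \<kappa> C f \<longleftrightarrow> continuous_on (hankel_contour \<kappa>) f \<and>
    (\<forall>z\<in>hankel_contour \<kappa>. norm (f z) \<le> C * exp (- (\<kappa> * \<bar>Im z\<bar>)))"

lemma hankel_contour_points:
  "0 \<le> s \<Longrightarrow> 1 + s *\<^sub>R hankel_dir \<kappa> \<in> hankel_contour \<kappa>"
  "0 \<le> s \<Longrightarrow> 1 + s *\<^sub>R cnj (hankel_dir \<kappa>) \<in> hankel_contour \<kappa>"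
  "Im (1 + s *\<^sub>R hankel_dir \<kappa>) = s" "Im (1 + s *\<^sub>R cnj (hankel_dir \<kappa>)) = - s"
  by (auto simp: hankel_contour_def hankel_dir_def)

lemma hankel_admissible_add:
  "hankel_admissible \<kappa> C f \<Longrightarrow> hankel_admissible \<kappa> C' g \<Longrightarrow> hankel_admissible \<kappa> (C + C') (\<lambda>z. f z + g z)"
  unfolding hankel_admissible_def
  by (auto intro!: continuous_on_add norm_triangle_le add_mono simp: distrib_right)

lemma hankel_admissible_operator:
  fixes h :: "'a::complex_banach \<Rightarrow> 'b::complex_banach"
  assumes f: "hankel_admissible \<kappa> C f" and h: "continuous_clinear h" "\<And>x. norm (h x) \<le> M * norm x" "M \<ge> 0"
  shows "hankel_admissible \<kappa> (M * C) (\<lambda>z. h (f z))"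
  unfolding hankel_admissible_def
proof (intro conjI ballI)
  show "continuous_on (hankel_contour \<kappa>) (\<lambda>z. h (f z))"
    using f h(1) unfolding hankel_admissible_def continuous_clinear_def
    by (auto intro: continuous_on_compose2[where t = UNIV and g = h])
  fix z assume z: "z \<in> hankel_contour \<kappa>"
  have "norm (h (f z)) \<le> M * norm (f z)" by (rule h)
  also have "\<dots> \<le> M * (C * exp (- (\<kappa> * \<bar>Im z\<bar>)))"
    using f z h(3) by (intro mult_left_mono) (auto simp: hankel_admissible_def)
  finally show "norm (h (f z)) \<le> M * C * exp (- (\<kappa> * \<bar>Im z\<bar>))" by (simp add: mult.assoc)
qed

context
  fixes \<kappa> :: real assumes \<kappa>: "0 < \<kappa>"
begin

lemma hankel_integrand_continuous:
  assumes "hankel_admissible \<kappa> C f"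
  shows "continuous_on {0..} (hankel_integrand \<kappa> f)"
proof -
  have f: "continuous_on (hankel_contour \<kappa>) f" using assms by (simp add: hankel_admissible_def)
  show ?thesis
    unfolding hankel_integrand_def[abs_def]
    by (intro continuous_on_diff scaleC.continuous_on continuous_on_const
        continuous_on_compose2[OF f] continuous_intros) (auto simp: hankel_contour_points)
qed

lemma hankel_integrand_bound:
  assumes "hankel_admissible \<kappa> C f" "0 \<le> s"
  shows "norm (hankel_integrand \<kappa> f s) \<le> 2 * cmod (hankel_dir \<kappa>) * C * exp (- (\<kappa> * s))"
proof -
  have 1: "norm (f (1 + s *\<^sub>R hankel_dir \<kappa>)) \<le> C * exp (- (\<kappa> * s))"
      "norm (f (1 + s *\<^sub>R cnj (hankel_dir \<kappa>))) \<le> C * exp (- (\<kappa> * s))"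
    using assms hankel_contour_points[of s \<kappa>] unfolding hankel_admissible_def
    by (metis abs_of_nonneg abs_minus_cancel)+
  have "norm (hankel_integrand \<kappa> f s) \<le> cmod (hankel_dir \<kappa>) * norm (f (1 + s *\<^sub>R hankel_dir \<kappa>))
      + cmod (hankel_dir \<kappa>) * norm (f (1 + s *\<^sub>R cnj (hankel_dir \<kappa>)))"
    unfolding hankel_integrand_def
    by (rule order_trans[OF norm_triangle_ineq4]) (simp add: norm_scaleC)
  also have "\<dots> \<le> cmod (hankel_dir \<kappa>) * (C * exp (- (\<kappa> * s))) + cmod (hankel_dir \<kappa>) * (C * exp (- (\<kappa> * s)))"
    by (intro add_mono mult_left_mono 1) auto
  finally show ?thesis by (simp add: algebra_simps)
qed

lemma hankel_integral_tendsto: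
  assumes "hankel_admissible \<kappa> C f"
  shows "(\<lambda>n. integral {0..real n} (hankel_integrand \<kappa> f)) \<longlonglongrightarrow> hankel_integral \<kappa> f"
  unfolding hankel_integral_def
  by (rule halfline_integral(1)[OF hankel_integrand_continuous[OF assms] hankel_integrand_bound[OF assms] \<kappa>])

lemma norm_hankel_integral_le:
  assumes "hankel_admissible \<kappa> C f"
  shows "norm (hankel_integral \<kappa> f) \<le> 2 * cmod (hankel_dir \<kappa>) / \<kappa> * C"
  using halfline_integral(2)[OF hankel_integrand_continuous[OF assms]
      hankel_integrand_bound[OF assms] \<kappa>]
  by (simp add: hankel_integral_def)

lemma hankel_integrable:
  assumes "hankel_admissible \<kappa> C f"
  shows "hankel_integrand \<kappa> f integrable_on {0..real n}"
  by (rule integrable_continuous_real, rule continuous_on_subset[OF hankel_integrand_continuous[OF assms]])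
    auto

lemma hankel_integral_add:
  assumes f: "hankel_admissible \<kappa> C f" and g: "hankel_admissible \<kappa> C' g"
  shows "hankel_integral \<kappa> (\<lambda>z. f z + g z) = hankel_integral \<kappa> f + hankel_integral \<kappa> g"
proof (rule LIMSEQ_unique[OF hankel_integral_tendsto[OF hankel_admissible_add[OF f g]]])
  have "hankel_integrand \<kappa> (\<lambda>z. f z + g z) = (\<lambda>s. hankel_integrand \<kappa> f s + hankel_integrand \<kappa> g s)"
    by (simp add: hankel_integrand_def fun_eq_iff scaleC_add_right)
  then show "(\<lambda>n. integral {0..real n} (hankel_integrand \<kappa> (\<lambda>z. f z + g z)))
      \<longlonglongrightarrow> hankel_integral \<kappa> f + hankel_integral \<kappa> g"
    using tendsto_add[OF hankel_integral_tendsto[OF f] hankel_integral_tendsto[OF g]]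
    by (simp add: integral_add hankel_integrable[OF f] hankel_integrable[OF g])
qed

lemma hankel_integral_operator:
  fixes h :: "'a::complex_banach \<Rightarrow> 'b::complex_banach"
  assumes f: "hankel_admissible \<kappa> C f" and h: "continuous_clinear h"
  shows "hankel_integral \<kappa> (\<lambda>z. h (f z)) = h (hankel_integral \<kappa> f)"
proof -
  obtain M where M: "M > 0" "\<And>x. norm (h x) \<le> M * norm x" using continuous_clinear_bound[OF h] by blast
  have lin: "clinear h" using h by (simp add: continuous_clinear_def)
  have bl: "bounded_linear h" by (rule continuous_clinear_bounded_linear[OF h])
  have adm: "hankel_admissible \<kappa> (M * C) (\<lambda>z. h (f z))"
    using M by (intro hankel_admissible_operator[OF f h]) auto
  have "hankel_integrand \<kappa> (\<lambda>z. h (f z)) = h \<circ> hankel_integrand \<kappa> f"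
    by (simp add: hankel_integrand_def fun_eq_iff clinear_simps[OF lin])
  then have "(\<lambda>n. integral {0..real n} (hankel_integrand \<kappa> (\<lambda>z. h (f z)))) \<longlonglongrightarrow> h (hankel_integral \<kappa> f)"
    using bounded_linear.tendsto[OF bl hankel_integral_tendsto[OF f]]
    by (simp add: integral_linear[OF hankel_integrable[OF f] bl])
  with hankel_integral_tendsto[OF adm] show ?thesis by (rule LIMSEQ_unique)
qed

lemma hankel_integral_cong:
  assumes "\<And>z. z \<in> hankel_contour \<kappa> \<Longrightarrow> f z = g z" "hankel_admissible \<kappa> C f"
  shows "hankel_integral \<kappa> f = hankel_integral \<kappa> g"
proof -
  have adm: "hankel_admissible \<kappa> C g"
    using assms unfolding hankel_admissible_def by (metis continuous_on_cong)
  have "integral {0..real n} (hankel_integrand \<kappa> f) = integral {0..real n} (hankel_integrand \<kappa> g)" for n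
    by (rule integral_cong) (auto simp: hankel_integrand_def assms(1) hankel_contour_points)
  then show ?thesis
    using hankel_integral_tendsto[OF adm] hankel_integral_tendsto[OF assms(2)] LIMSEQ_unique by auto
qed

text \<open>The contributions of the common end point of both rays cancel.\<close>

lemma hankel_integral_derivative:
  assumes f: "hankel_admissible \<kappa> C f"
    and F: "\<And>e s. e \<in> {hankel_dir \<kappa>, cnj (hankel_dir \<kappa>)} \<Longrightarrow> 0 \<le> s \<Longrightarrow>
      ((\<lambda>s. F (1 + s *\<^sub>R e)) has_vector_derivative e *\<^sub>C f (1 + s *\<^sub>R e)) (at s within {0..})"
    and bound: "\<And>z. z \<in> hankel_contour \<kappa> \<Longrightarrow> norm (F z) \<le> C' * exp (- (\<kappa> * \<bar>Im z\<bar>))"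
  shows "hankel_integral \<kappa> f = 0"
proof (rule LIMSEQ_unique[OF hankel_integral_tendsto[OF f]])
  let ?d = "hankel_dir \<kappa>"
  have int: "integral {0..real n} (hankel_integrand \<kappa> f)
      = F (1 + real n *\<^sub>R ?d) - F (1 + real n *\<^sub>R cnj ?d)" for n
  proof -
    have "(hankel_integrand \<kappa> f has_integral
      ((F (1 + real n *\<^sub>R ?d) - F (1 + real n *\<^sub>R cnj ?d)) - (F (1 + 0 *\<^sub>R ?d) - F (1 + 0 *\<^sub>R cnj ?d))))
        {0..real n}"
      unfolding hankel_integrand_def[abs_def]
      by (rule fundamental_theorem_of_calculus)
        (auto intro!: has_vector_derivative_diff has_vector_derivative_within_subset[OF F])
    then show ?thesis by (simp add: integral_unique)
  qed
  have "(\<lambda>n. 2 * C' * exp (- \<kappa>) ^ n) \<longlonglongrightarrow> 2 * C' * 0"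
    using \<kappa> by (intro tendsto_mult tendsto_const LIMSEQ_realpow_zero) auto
  then have lim: "(\<lambda>n. 2 * C' * exp (- (\<kappa> * real n))) \<longlonglongrightarrow> 0"
    by (simp add: mult.commute flip: exp_of_nat_mult)
  show "(\<lambda>n. integral {0..real n} (hankel_integrand \<kappa> f)) \<longlonglongrightarrow> 0"
  proof (rule Lim_null_comparison[OF _ lim], intro always_eventually allI)
    fix n
    show "norm (integral {0..real n} (hankel_integrand \<kappa> f)) \<le> 2 * C' * exp (- (\<kappa> * real n))"
      unfolding int
      using bound[OF hankel_contour_points(1)[of "real n"]] bound[OF hankel_contour_points(2)[of "real n"]]
        norm_triangle_ineq4[of "F (1 + real n *\<^sub>R ?d)" "F (1 + real n *\<^sub>R cnj ?d)"]
      unfolding hankel_contour_points(3,4) by simp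
  qed
qed

end

text \<open>Scalar contour integrals become a special case; they are carried to vectors by the
  operator \<open>a \<mapsto> a x\<close>.\<close>

instantiation complex :: complex_banach
begin

definition scaleC_complex :: "complex \<Rightarrow> complex \<Rightarrow> complex"
  where "scaleC_complex a z = a * z"

instance
  by standard (auto simp: scaleC_complex_def algebra_simps scaleR_conv_of_real norm_mult)

end

section \<open>The normalization of the contour integral\<close>

text \<open>The threshold \<open>r = 1 / (1 + \<kappa>)\<close> solves
  \<open>1 - \<kappa> r = r\<close>: either the imaginary part reaches it in modulus, or the real
  part does.\<close>

lemma hankel_contour_norm_ge:
  assumes "z \<in> hankel_contour \<kappa>" "0 < \<kappa>"
  shows "1 / (1 + \<kappa>) \<le> cmod z"
proof (cases "\<bar>Im z\<bar> \<ge> 1 / (1 + \<kappa>)")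
  case True
  then show ?thesis using abs_Im_le_cmod[of z] by linarith
next
  case False
  then have "\<kappa> * \<bar>Im z\<bar> \<le> \<kappa> * (1 / (1 + \<kappa>))" using assms by (intro mult_left_mono) auto
  then have "1 - \<kappa> * (1 / (1 + \<kappa>)) \<le> Re z" using assms by (simp add: hankel_contour_def)
  moreover have "1 - \<kappa> * (1 / (1 + \<kappa>)) = 1 / (1 + \<kappa>)" using assms by (simp add: field_simps)
  ultimately show ?thesis using complex_Re_le_cmod[of z] by linarith
qed

lemma hankel_admissible_exp_inverse:
  assumes "0 < \<kappa>"
  shows "hankel_admissible \<kappa> (exp 1 * (1 + \<kappa>)) (\<lambda>z. exp z / z)"
  unfolding hankel_admissible_def
proof (intro conjI ballI)
  have nz: "z \<noteq> 0" if "z \<in> hankel_contour \<kappa>" for z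
    using hankel_contour_norm_ge[OF that assms] assms by auto
  show "continuous_on (hankel_contour \<kappa>) (\<lambda>z. exp z / z)"
    using nz by (intro continuous_intros) auto
  fix z assume z: "z \<in> hankel_contour \<kappa>"
  have "cmod (exp z / z) = exp 1 * exp (- (\<kappa> * \<bar>Im z\<bar>)) * (1 / cmod z)"
    using z by (simp add: norm_divide norm_exp_eq_Re hankel_contour_def flip: exp_add)
  also have "\<dots> \<le> exp 1 * exp (- (\<kappa> * \<bar>Im z\<bar>)) * (1 + \<kappa>)"
  proof (intro mult_left_mono)
    have "cmod z > 0" using nz[OF z] by simp
    then show "1 / cmod z \<le> 1 + \<kappa>"
      using hankel_contour_norm_ge[OF z assms] assms by (simp add: field_simps)
  qed auto
  finally show "cmod (exp z / z) \<le> exp 1 * (1 + \<kappa>) * exp (- (\<kappa> * \<bar>Im z\<bar>))" by (simp add: mult_ac)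
qed

text \<open>The rays truncated at height \<open>n\<close> are closed by the vertical segment between
  their ends. The triangle surrounds 0, so Cauchy's formula gives \<open>2 * pi * \<i>\<close>, and
  the segment contributes nothing in the limit.\<close>

lemma hankel_integral_exp_inverse:
  assumes \<kappa>: "0 < \<kappa>"
  shows "hankel_integral \<kappa> (\<lambda>z. exp z / z) = 2 * pi * \<i>"
proof -
  let ?d = "hankel_dir \<kappa>" and ?f = "\<lambda>z::complex. exp z / z"
  define p where "p n = 1 + real n *\<^sub>R ?d" for n :: nat
  have p: "Re (p n) = 1 - \<kappa> * real n" "Im (p n) = real n" for n
    by (simp_all add: p_def hankel_dir_def)
  note adm = hankel_admissible_exp_inverse[OF \<kappa>]
  have cont: "continuous_on {0..real n} (\<lambda>s. e * ?f (1 + s *\<^sub>R e))" if "e = ?d \<or> e = cnj ?d" for e and n :: nat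
  proof -
    have *: "continuous_on (hankel_contour \<kappa>) ?f" using adm by (simp add: hankel_admissible_def)
    show ?thesis
      by (intro continuous_on_mult continuous_on_const continuous_on_compose2[OF *] continuous_intros)
        (use that hankel_contour_points in auto)
  qed
  have ray: "(?f has_contour_integral integral {0..real n} (\<lambda>s. e * ?f (1 + s *\<^sub>R e))) (linepath 1 (1 + real n *\<^sub>R e))"
    if "n > 0" "e = ?d \<or> e = cnj ?d" for n :: nat and e
  proof -
    have "((\<lambda>s. e * ?f (1 + s *\<^sub>R e)) has_integral integral {0..real n} (\<lambda>s. e * ?f (1 + s *\<^sub>R e))) {0..real n}"
      using integrable_continuous_real[OF cont[OF that(2)]] by (rule integrable_integral)
    from has_integral_stretch_real[OF this, of "real n"] that(1)
    have "((\<lambda>x. e * ?f (1 + (real n * x) *\<^sub>R e)) has_integral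
        (1 / real n) *\<^sub>R integral {0..real n} (\<lambda>s. e * ?f (1 + s *\<^sub>R e))) {0..1}"
      by simp
    from has_integral_cmul[OF this, of "real n"] that(1)
    have "((\<lambda>x. real n *\<^sub>R (e * ?f (1 + (real n * x) *\<^sub>R e))) has_integral
        integral {0..real n} (\<lambda>s. e * ?f (1 + s *\<^sub>R e))) {0..1}"
      by simp
    moreover have "linepath 1 (1 + real n *\<^sub>R e) x = 1 + (real n * x) *\<^sub>R e" for x
      by (simp add: linepath_def scaleR_conv_of_real algebra_simps)
    ultimately show ?thesis
      unfolding has_contour_integral_linepath by (simp add: scaleR_conv_of_real mult_ac)
  qed
  have split: "integral {0..real n} (hankel_integrand \<kappa> ?f) =
      contour_integral (linepath 1 (p n)) ?f - contour_integral (linepath 1 (cnj (p n))) ?f" if "n > 0" for n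
  proof -
    have "integral {0..real n} (hankel_integrand \<kappa> ?f) = integral {0..real n} (\<lambda>s. ?d * ?f (1 + s *\<^sub>R ?d))
        - integral {0..real n} (\<lambda>s. cnj ?d * ?f (1 + s *\<^sub>R cnj ?d))"
      unfolding hankel_integrand_def[abs_def] scaleC_complex_def
      by (intro integral_diff integrable_continuous_real cont) auto
    then show ?thesis
      using ray[OF that, of ?d, THEN contour_integral_unique]
        ray[OF that, of "cnj ?d", THEN contour_integral_unique]
      by (simp add: p_def)
  qed
  have triangle: "contour_integral (linepath 1 (p n)) ?f - contour_integral (linepath 1 (cnj (p n))) ?f
      = 2 * pi * \<i> - contour_integral (linepath (p n) (cnj (p n))) ?f"
    if n: "real n > 1 / \<kappa>" for n
  proof -
    let ?g = "linepath (cnj (p n)) 1 +++ linepath 1 (p n) +++ linepath (p n) (cnj (p n))"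
    have n': "\<kappa> * real n > 1" using n \<kappa> by (simp add: field_simps)
    then have "n > 0" by (cases n) auto
    \<comment> \<open>For a nondegenerate triangle the interior consists of the points with strictly
      positive barycentric coordinates.\<close>
    have "\<not> collinear {cnj (p n), 1, p n}"
    proof
      assume "collinear {cnj (p n), 1, p n}"
      then have "Im ((p n - 1) / (cnj (p n) - 1)) = 0"
        by (simp add: collinear_3 collinear_iff_Reals complex_is_Real_iff)
      then show False
        using \<kappa> \<open>n > 0\<close> by (simp add: Im_divide p)
    qed
    note eq = interior_convex_hull_3_minimal[OF this DIM_complex]
    define a where "a = \<kappa> * real n"
    \<comment> \<open>Barycentric coordinates of 0: equal weights on the conjugate corners cancel
      the imaginary parts, and \<open>1 / (2 * a)\<close> balances the real parts
      \<open>1 - a\<close> and 1. Positivity requires \<open>a > 1\<close>, hence the condition on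
      \<open>n\<close>.\<close>
    have "(1 / (2 * a)) *\<^sub>R cnj (p n) + (1 - 1 / a) *\<^sub>R 1 + (1 / (2 * a)) *\<^sub>R p n = 0"
    proof (rule complex_eqI)
      have "1 / (2 * a) * (1 - a) + (1 - 1 / a) + 1 / (2 * a) * (1 - a) = 0"
        using n' by (simp add: a_def[symmetric] field_simps)
      then show "Re ((1 / (2 * a)) *\<^sub>R cnj (p n) + (1 - 1 / a) *\<^sub>R 1 + (1 / (2 * a)) *\<^sub>R p n) = Re 0"
        by (simp add: p a_def[symmetric])
    qed (simp add: p)
    moreover have "0 < 1 / (2 * a)" "0 < 1 - 1 / a" "1 / (2 * a) + (1 - 1 / a) + 1 / (2 * a) = 1"
      using n' by (auto simp: a_def[symmetric] field_simps)
    ultimately have int0: "0 \<in> interior (convex hull {cnj (p n), 1, p n})"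
      unfolding eq by blast
    have wn: "winding_number ?g 0 = 1"
      using winding_number_triangle[OF int0] \<open>n > 0\<close> by (simp add: p)
    have nz: "0 \<notin> closed_segment (cnj (p n)) 1" "0 \<notin> closed_segment 1 (p n)" "0 \<notin> closed_segment (p n) (cnj (p n))"
      using int0 interior_of_triangle[of "cnj (p n)" 1 "p n"] by (auto simp: closed_segment_commute)
    then have path: "path_image ?g \<subseteq> UNIV - {0}"
      by (auto simp: path_image_join)
    have "((\<lambda>w. exp w / (w - 0)) has_contour_integral (2 * pi * \<i> * winding_number ?g 0 * exp 0)) ?g"
      by (rule Cauchy_integral_formula_convex_simple[OF convex_UNIV]) (use path in \<open>auto intro!: holomorphic_intros\<close>)
    then have "contour_integral ?g ?f = 2 * pi * \<i>" using wn by (simp add: contour_integral_unique)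
    have ci: "?f contour_integrable_on linepath (cnj (p n)) 1" "?f contour_integrable_on linepath 1 (p n)"
      "?f contour_integrable_on linepath (p n) (cnj (p n))"
      using nz by (auto intro!: contour_integrable_continuous_linepath continuous_intros)
    have "contour_integral ?g ?f = contour_integral (linepath (cnj (p n)) 1) ?f +
        (contour_integral (linepath 1 (p n)) ?f + contour_integral (linepath (p n) (cnj (p n))) ?f)"
      using ci by simp
    moreover have "contour_integral (linepath (cnj (p n)) 1) ?f = - contour_integral (linepath 1 (cnj (p n))) ?f"
      using contour_integral_reversepath[of "linepath 1 (cnj (p n))" ?f] by simp
    ultimately show ?thesis using \<open>contour_integral ?g ?f = 2 * pi * \<i>\<close> by (simp add: algebra_simps)
  qed
  \<comment> \<open>The segment has length \<open>2 * real n\<close> and constant real part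
    \<open>1 - \<kappa> * real n\<close>, so \<open>exp z\<close> is exponentially small on
    it.\<close>
  have small: "norm (contour_integral (linepath (p n) (cnj (p n))) ?f)
      \<le> exp (1 - \<kappa> * real n) / (\<kappa> * real n - 1) * (2 * real n)" if n: "real n > 1 / \<kappa>" for n
  proof -
    have n': "\<kappa> * real n > 1" using n \<kappa> by (simp add: field_simps)
    have re: "Re z = 1 - \<kappa> * real n" if z: "z \<in> closed_segment (p n) (cnj (p n))" for z
    proof -
      obtain u where "z = (1 - u) *\<^sub>R p n + u *\<^sub>R cnj (p n)" using z by (auto simp: in_segment)
      then have "Re z = (1 - u) * (1 - \<kappa> * real n) + u * (1 - \<kappa> * real n)" by (simp add: p)
      then show ?thesis by (simp add: algebra_simps)
    qed
    then have nz: "0 \<notin> closed_segment (p n) (cnj (p n))" using n' by fastforce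
    have "norm (contour_integral (linepath (p n) (cnj (p n))) ?f)
        \<le> exp (1 - \<kappa> * real n) / (\<kappa> * real n - 1) * norm (cnj (p n) - p n)"
    proof (rule contour_integral_bound_linepath)
      show "?f contour_integrable_on linepath (p n) (cnj (p n))"
        using nz by (auto intro!: contour_integrable_continuous_linepath continuous_intros)
      show "0 \<le> exp (1 - \<kappa> * real n) / (\<kappa> * real n - 1)" using n' by simp
      fix z assume z: "z \<in> closed_segment (p n) (cnj (p n))"
      have "\<kappa> * real n - 1 \<le> cmod z" using abs_Re_le_cmod[of z] re[OF z] by simp
      then show "norm (exp z / z) \<le> exp (1 - \<kappa> * real n) / (\<kappa> * real n - 1)"
        using n' re[OF z] by (auto simp: norm_divide norm_exp_eq_Re intro!: divide_left_mono mult_pos_pos)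
    qed
    also have "norm (cnj (p n) - p n) = 2 * real n"
    proof -
      have "cnj (p n) - p n = Complex 0 (- 2 * real n)" by (simp add: complex_eq_iff p)
      then show ?thesis by (simp add: cmod_def real_sqrt_mult)
    qed
    finally show ?thesis .
  qed
  have "eventually (\<lambda>n. real n > 1 / \<kappa>) sequentially"
    using filterlim_real_sequentially by (auto simp: filterlim_at_top_dense)
  have "((\<lambda>n::nat. exp (1 - \<kappa> * real n) / (\<kappa> * real n - 1) * (2 * real n)) \<longlonglongrightarrow> 0)"
    using \<kappa> by real_asymp
  then have "(\<lambda>n. contour_integral (linepath (p n) (cnj (p n))) ?f) \<longlonglongrightarrow> 0"
    by (rule Lim_null_comparison[rotated])
      (use \<open>eventually (\<lambda>n. real n > 1 / \<kappa>) sequentially\<close> small in \<open>auto elim: eventually_mono\<close>)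
  then have "(\<lambda>n. 2 * pi * \<i> - contour_integral (linepath (p n) (cnj (p n))) ?f) \<longlonglongrightarrow> 2 * pi * \<i> - 0"
    by (intro tendsto_diff tendsto_const)
  moreover have "\<forall>\<^sub>F n in sequentially. 2 * pi * \<i> - contour_integral (linepath (p n) (cnj (p n))) ?f
      = integral {0..real n} (hankel_integrand \<kappa> ?f)"
    using \<open>eventually (\<lambda>n. real n > 1 / \<kappa>) sequentially\<close> eventually_gt_at_top[of 0]
    by eventually_elim (simp add: split triangle)
  ultimately have "(\<lambda>n. integral {0..real n} (hankel_integrand \<kappa> ?f)) \<longlonglongrightarrow> 2 * pi * \<i> - 0"
    by (rule Lim_transform_eventually)
  from LIMSEQ_unique[OF hankel_integral_tendsto[OF \<kappa> adm] this] show ?thesis by simp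
qed

section \<open>Derivatives of operator families\<close>

lemma has_vector_derivative_iff_quotient:
  fixes f :: "real \<Rightarrow> 'a::real_normed_vector"
  shows "(f has_vector_derivative d) (at t within I) \<longleftrightarrow>
    ((\<lambda>s. (f s - f t) /\<^sub>R (s - t)) \<longlongrightarrow> d) (at t within I)"
proof -
  have "norm ((f s - f t) /\<^sub>R (s - t) - d) = norm ((f s - f t - (s - t) *\<^sub>R d) /\<^sub>R norm (s - t))"
    if "s \<noteq> t" for s
  proof -
    have "(f s - f t) /\<^sub>R (s - t) - d = (f s - f t - (s - t) *\<^sub>R d) /\<^sub>R (s - t)"
      using that by (simp add: scaleR_right_diff_distrib)
    then show ?thesis by simp
  qed
  then have "((\<lambda>s. (f s - f t) /\<^sub>R (s - t)) \<longlongrightarrow> d) (at t within I) \<longleftrightarrow>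
      ((\<lambda>s. norm ((f s - f t - (s - t) *\<^sub>R d) /\<^sub>R norm (s - t))) \<longlongrightarrow> 0) (at t within I)"
    by (subst LIM_zero_iff[symmetric], subst tendsto_norm_zero_iff[symmetric], intro tendsto_cong)
      (auto simp: eventually_at_filter)
  also have "\<dots> \<longleftrightarrow> (f has_vector_derivative d) (at t within I)"
    unfolding has_vector_derivative_def has_derivative_within tendsto_norm_zero_iff
    by (simp add: bounded_linear_scaleR_left divide_inverse_commute diff_diff_eq)
  finally show ?thesis by simp
qed

text \<open>A product rule under strong assumptions only: differentiability of \<open>S\<close> is
  needed at the single vector \<open>x t\<close>, continuity at \<open>x'\<close>, and the uniform
  bound \<open>M\<close> disposes of the remainder of \<open>x\<close>.\<close>

lemma has_vector_derivative_operator_family: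
  fixes S :: "real \<Rightarrow> 'a::complex_banach \<Rightarrow> 'b::complex_banach"
  assumes x: "(x has_vector_derivative x') (at t within I)"
    and S: "((\<lambda>s. S s (x t)) has_vector_derivative y') (at t within I)"
    and Sx': "((\<lambda>s. S s x') \<longlongrightarrow> S t x') (at t within I)"
    and lin: "\<And>s. s \<in> I \<Longrightarrow> clinear (S s)" and bound: "\<And>s v. s \<in> I \<Longrightarrow> norm (S s v) \<le> M * norm v"
    and "t \<in> I"
  shows "((\<lambda>s. S s (x s)) has_vector_derivative (y' + S t x')) (at t within I)"
  unfolding has_vector_derivative_iff_quotient
proof -
  let ?q = "\<lambda>s. (x s - x t) /\<^sub>R (s - t)"
  have "(?q \<longlongrightarrow> x') (at t within I)"
    using x unfolding has_vector_derivative_iff_quotient .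
  then have q: "((\<lambda>s. norm (?q s - x')) \<longlongrightarrow> 0) (at t within I)"
    using tendsto_norm_zero LIM_zero by blast
  have "((\<lambda>s. M * norm (?q s - x')) \<longlongrightarrow> 0) (at t within I)"
    using tendsto_mult_right_zero[OF q] .
  then have 1: "((\<lambda>s. S s (?q s - x')) \<longlongrightarrow> 0) (at t within I)"
    by (rule Lim_null_comparison[rotated]) (auto simp: eventually_at_filter bound)
  have "((\<lambda>s. S s (?q s - x') + S s x' + (S s (x t) - S t (x t)) /\<^sub>R (s - t)) \<longlongrightarrow> 0 + S t x' + y') (at t within I)"
    using S unfolding has_vector_derivative_iff_quotient by (intro tendsto_add 1 Sx')
  moreover have "\<forall>\<^sub>F s in at t within I. S s (?q s - x') + S s x' + (S s (x t) - S t (x t)) /\<^sub>R (s - t)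
      = (S s (x s) - S t (x t)) /\<^sub>R (s - t)"
    by (auto simp: eventually_at_filter clinear_simps[OF lin] simp flip: scaleR_right_distrib)
  ultimately have "((\<lambda>s. (S s (x s) - S t (x t)) /\<^sub>R (s - t)) \<longlongrightarrow> 0 + S t x' + y') (at t within I)"
    by (rule Lim_transform_eventually)
  then show "((\<lambda>s. (S s (x s) - S t (x t)) /\<^sub>R (s - t)) \<longlongrightarrow> y' + S t x') (at t within I)"
    by (simp add: add.commute)
qed

text \<open>Strong continuity and a uniform bound give joint continuity along a moving
  argument.\<close>

lemma continuous_on_operator_family:
  fixes S :: "'i::topological_space \<Rightarrow> 'a::complex_banach \<Rightarrow> 'b::complex_banach"
  assumes S: "\<And>y. continuous_on I (\<lambda>s. S s y)" and x: "continuous_on I x"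
    and lin: "\<And>s. s \<in> I \<Longrightarrow> clinear (S s)" and bound: "\<And>s v. s \<in> I \<Longrightarrow> norm (S s v) \<le> M * norm v"
  shows "continuous_on I (\<lambda>s. S s (x s))"
  unfolding continuous_on_def
proof
  fix t assume t: "t \<in> I"
  have "((\<lambda>s. norm (x s - x t)) \<longlongrightarrow> 0) (at t within I)"
    using x t unfolding continuous_on_def by (intro tendsto_norm_zero LIM_zero) blast
  moreover have "((\<lambda>s. norm (S s (x t) - S t (x t))) \<longlongrightarrow> 0) (at t within I)"
    using S[of "x t"] t unfolding continuous_on_def by (intro tendsto_norm_zero LIM_zero) blast
  ultimately have lim: "((\<lambda>s. M * norm (x s - x t) + norm (S s (x t) - S t (x t))) \<longlongrightarrow> 0) (at t within I)"
    by (auto intro!: tendsto_add_zero tendsto_mult_right_zero)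
  have "((\<lambda>s. S s (x s) - S t (x t)) \<longlongrightarrow> 0) (at t within I)"
  proof (rule Lim_null_comparison[OF _ lim])
    have "norm (S s (x s) - S t (x t)) \<le> M * norm (x s - x t) + norm (S s (x t) - S t (x t))"
      if s: "s \<in> I" for s
    proof -
      have "S s (x s) - S t (x t) = S s (x s - x t) + (S s (x t) - S t (x t))"
        by (simp add: clinear_simps[OF lin[OF s]])
      then have "norm (S s (x s) - S t (x t)) \<le> norm (S s (x s - x t)) + norm (S s (x t) - S t (x t))"
        by (metis norm_triangle_ineq)
      then show ?thesis using bound[OF s, of "x s - x t"] by linarith
    qed
    then show "\<forall>\<^sub>F s in at t within I. norm (S s (x s) - S t (x t))
        \<le> M * norm (x s - x t) + norm (S s (x t) - S t (x t))"
      by (simp add: eventually_at_filter)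
  qed
  then show "((\<lambda>s. S s (x s)) \<longlongrightarrow> S t (x t)) (at t within I)" by (rule LIM_zero_cancel)
qed

lemma has_vector_derivative_reflect:
  fixes f :: "real \<Rightarrow> 'a::real_normed_vector"
  assumes "(f has_vector_derivative d) (at (\<tau> - s) within J)" "(\<lambda>r. \<tau> - r) ` I \<subseteq> J"
  shows "((\<lambda>r. f (\<tau> - r)) has_vector_derivative - d) (at s within I)"
proof -
  have "((\<lambda>r. \<tau> - r) has_vector_derivative - 1) (at s within I)"
    by (auto intro!: derivative_eq_intros simp flip: has_real_derivative_iff_has_vector_derivative)
  from vector_diff_chain_within[OF this has_vector_derivative_within_subset[OF assms]]
  show ?thesis by (simp add: o_def)
qed

lemma vector_mean_value_bound:
  fixes f :: "real \<Rightarrow> 'a::real_normed_vector"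
  assumes "a \<le> b" "continuous_on {a..b} f"
    "\<And>x. a < x \<Longrightarrow> x < b \<Longrightarrow> (f has_vector_derivative f' x) (at x)"
    "\<And>x. a < x \<Longrightarrow> x < b \<Longrightarrow> norm (f' x) \<le> M"
  shows "norm (f b - f a) \<le> M * (b - a)"
proof (cases "a = b")
  case False
  then have "norm (f b - f a) \<le> M * b - M * a"
    using assms
    by (intro differentiable_bound_general[where f = f and \<phi> = "\<lambda>x. M * x" and f' = f' and \<phi>' = "\<lambda>_. M"])
      (auto intro!: continuous_intros derivative_eq_intros simp flip: has_real_derivative_iff_has_vector_derivative)
  then show ?thesis by (simp add: algebra_simps)
qed simp


section \<open>Generation of analytic semigroups\<close>

text \<open>Here \<open>R z = (z - A)\<^sup>-\<^sup>1\<close> on a sector around the closed right half-plane without 0. The semigroup is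
  \<open>T t = (2\<pi>i)\<^sup>-\<^sup>1 \<integral> e\<^sup>z (z - t A)\<^sup>-\<^sup>1 dz\<close>. Rescaling the contour with \<open>t\<close> makes all estimates uniform in
  \<open>t\<close>, and the only instance of Cauchy's theorem which is needed is integration by parts.\<close>

locale sectorial_resolvent =
  fixes domA :: "'x::complex_banach set" and A :: "'x \<Rightarrow> 'x" and R :: "complex \<Rightarrow> 'x \<Rightarrow> 'x"
    and \<kappa> c :: real
  assumes A_lin: "linear_operator_on domA A" and dense: "closure domA = UNIV"
    and \<kappa>: "0 < \<kappa>" and c: "0 < c"
    and R_dom: "\<And>z x. - \<kappa> * \<bar>Im z\<bar> < Re z \<Longrightarrow> R z x \<in> domA"
    and R_right: "\<And>z x. - \<kappa> * \<bar>Im z\<bar> < Re z \<Longrightarrow> z *\<^sub>C R z x - A (R z x) = x"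
    and R_left: "\<And>z x. - \<kappa> * \<bar>Im z\<bar> < Re z \<Longrightarrow> x \<in> domA \<Longrightarrow> R z (z *\<^sub>C x - A x) = x"
    and R_bound: "\<And>z x. - \<kappa> * \<bar>Im z\<bar> < Re z \<Longrightarrow> norm (R z x) \<le> c / cmod z * norm x"
begin

lemma dom: "csubspace domA"
  and A_add: "x \<in> domA \<Longrightarrow> y \<in> domA \<Longrightarrow> A (x + y) = A x + A y"
  and A_scale: "x \<in> domA \<Longrightarrow> A (a *\<^sub>C x) = a *\<^sub>C A x"
  using A_lin by (auto simp: linear_operator_on_def)

lemma A_scaleR: "x \<in> domA \<Longrightarrow> A (r *\<^sub>R x) = r *\<^sub>R A x"
  by (simp add: scaleR_scaleC A_scale)

lemma A_diff: "x \<in> domA \<Longrightarrow> y \<in> domA \<Longrightarrow> A (x - y) = A x - A y"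
  using A_add[of x "- 1 *\<^sub>C y"] A_scale[of y "- 1"] csubspace_simps(3)[OF dom, of y "- 1"]
  by (simp add: scaleC_one)

lemma R_clinear:
  assumes "- \<kappa> * \<bar>Im z\<bar> < Re z"
  shows "clinear (R z)"
proof (rule clinearI)
  fix x y :: 'x and a
  have "z *\<^sub>C (R z x + R z y) - A (R z x + R z y) = x + y"
    using R_right[OF assms, of x] R_right[OF assms, of y] A_add[OF R_dom[OF assms] R_dom[OF assms], of x y]
    by (simp add: scaleC_add_right algebra_simps)
  then show "R z (x + y) = R z x + R z y"
    using R_left[OF assms csubspace_simps(2)[OF dom R_dom[OF assms] R_dom[OF assms]], of x y] by simp
  have "z *\<^sub>C (a *\<^sub>C R z x) - A (a *\<^sub>C R z x) = a *\<^sub>C (z *\<^sub>C R z x - A (R z x))"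
    by (simp add: A_scale[OF R_dom[OF assms]] scaleC.diff_right scaleC_scaleC mult.commute)
  then show "R z (a *\<^sub>C x) = a *\<^sub>C R z x"
    using R_left[OF assms csubspace_simps(3)[OF dom R_dom[OF assms]], of a x] R_right[OF assms, of x] by simp
qed

text \<open>This is \<open>(z - t A)^-1\<close>, expressed by the resolvent at
  \<open>z / t\<close>.\<close>

definition Q :: "real \<Rightarrow> complex \<Rightarrow> 'x \<Rightarrow> 'x"
  where "Q t z x = R (z / of_real t) x /\<^sub>R t"

abbreviation \<Gamma> where "\<Gamma> \<equiv> hankel_contour \<kappa>"

text \<open>The bound of \<open>Q t z\<close> on the contour, uniform in \<open>t\<close>:
  \<open>c / |z|\<close> with \<open>|z| \<ge> 1 / (1 + \<kappa>)\<close>.\<close>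

abbreviation K where "K \<equiv> c * (1 + \<kappa>)"

context
  fixes t :: real and z :: complex
  assumes t: "0 < t" and z: "z \<in> \<Gamma>"
begin

text \<open>The region where the resolvent is controlled is a cone, so division by
  \<open>t > 0\<close> does not leave it.\<close>

lemma sector: "- \<kappa> * \<bar>Im (z / of_real t)\<bar> < Re (z / of_real t)"
proof -
  have "- \<kappa> * \<bar>Im z\<bar> < Re z" using z by (simp add: hankel_contour_def)
  from divide_strict_right_mono[OF this t] show ?thesis using t by (simp add: abs_divide)
qed

lemma Q_dom: "Q t z x \<in> domA"
  unfolding Q_def by (intro csubspace_simps[OF dom] R_dom[OF sector])

lemma Q_clinear: "clinear (Q t z)"
  by (rule clinearI)
    (simp_all add: Q_def clinear_simps[OF R_clinear[OF sector]] scaleR_add_right scaleC.scaleR_right)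

lemma Q_right: "z *\<^sub>C Q t z x - t *\<^sub>R A (Q t z x) = x"
proof -
  have "z *\<^sub>C Q t z x = (z / of_real t) *\<^sub>C R (z / of_real t) x"
    by (simp add: Q_def scaleR_scaleC scaleC_scaleC divide_inverse)
  moreover have "t *\<^sub>R A (Q t z x) = A (R (z / of_real t) x)"
    using t by (simp add: Q_def A_scaleR R_dom[OF sector])
  ultimately show ?thesis using R_right[OF sector, of x] by simp
qed

lemma Q_left:
  assumes "x \<in> domA"
  shows "Q t z (z *\<^sub>C x - t *\<^sub>R A x) = x"
proof -
  have "(z / of_real t) *\<^sub>C x - A x = (z *\<^sub>C x - t *\<^sub>R A x) /\<^sub>R t"
    using t by (simp add: scaleC.diff_right scaleR_scaleC scaleC_scaleC divide_inverse mult.commute scaleC_one)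
  then show ?thesis
    using R_left[OF sector assms] by (simp add: Q_def clinear_simps[OF R_clinear[OF sector]])
qed

text \<open>The \<open>t\<close> from the estimate of the resolvent at \<open>z / t\<close> cancels
  against the \<open>t\<close> in \<open>Q\<close>; this is the source of uniformity in
  time.\<close>

lemma Q_bound_z: "cmod z * norm (Q t z x) \<le> c * norm x"
proof -
  have "0 < 1 / (1 + \<kappa>)" using \<kappa> by simp
  then have "0 < cmod z" using hankel_contour_norm_ge[OF z \<kappa>] by linarith
  then have "z \<noteq> 0" by simp
  have "norm (Q t z x) \<le> (c / cmod (z / of_real t) * norm x) / t"
    using R_bound[OF sector, of x] t by (simp add: Q_def divide_right_mono divide_inverse mult.commute)
  also have "\<dots> = c * norm x / cmod z" using t by (simp add: norm_divide)
  finally show ?thesis using \<open>z \<noteq> 0\<close> by (simp add: field_simps)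
qed

lemma Q_bound: "norm (Q t z x) \<le> K * norm x"
proof -
  have "1 / (1 + \<kappa>) * norm (Q t z x) \<le> cmod z * norm (Q t z x)"
    using hankel_contour_norm_ge[OF z \<kappa>] by (intro mult_right_mono) auto
  also note Q_bound_z
  finally show ?thesis using \<kappa> by (simp add: field_simps)
qed

lemma AQ_eq: "A (Q t z x) = (z *\<^sub>C Q t z x - x) /\<^sub>R t"
proof -
  have "t *\<^sub>R A (Q t z x) = z *\<^sub>C Q t z x - x" using Q_right[of x] by (simp add: algebra_simps)
  then have "inverse t *\<^sub>R t *\<^sub>R A (Q t z x) = inverse t *\<^sub>R (z *\<^sub>C Q t z x - x)" by simp
  then show ?thesis using t by simp
qed

text \<open>Since \<open>A Q = (z Q - 1) / t\<close>, the operator \<open>A Q\<close> is bounded, at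
  the price \<open>1 / t\<close> typical of analytic semigroups.\<close>

lemma AQ_bound: "norm (A (Q t z x)) \<le> (c + 1) / t * norm x"
proof -
  have "norm (A (Q t z x)) \<le> (cmod z * norm (Q t z x) + norm x) / t"
    unfolding AQ_eq using t norm_triangle_ineq4[of "z *\<^sub>C Q t z x" x]
    by (simp add: norm_scaleC divide_inverse mult.commute mult_left_mono)
  also have "\<dots> \<le> (c * norm x + norm x) / t"
    using Q_bound_z[of x] t by (intro divide_right_mono add_mono) auto
  finally show ?thesis by (simp add: algebra_simps add_divide_distrib)
qed

lemma AQ_clinear: "clinear (\<lambda>x. A (Q t z x))"
  by (rule clinearI) (simp_all add: clinear_simps[OF Q_clinear] A_add A_scale Q_dom)

lemma AQ_commute:
  assumes "x \<in> domA"
  shows "A (Q t z x) = Q t z (A x)"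
proof -
  have "t *\<^sub>R A (Q t z x) = z *\<^sub>C Q t z x - x" using Q_right[of x] by (simp add: algebra_simps)
  also have "\<dots> = t *\<^sub>R Q t z (A x)"
    using Q_left[OF assms] by (simp add: clinear_simps[OF Q_clinear] algebra_simps)
  finally show ?thesis using t by simp
qed

end

lemma resolvent_identity:
  assumes "0 < t" "z \<in> \<Gamma>" "z' \<in> \<Gamma>"
  shows "Q t z' x - Q t z x = (z - z') *\<^sub>C Q t z (Q t z' x)"
proof -
  let ?y = "Q t z' x"
  have y: "?y \<in> domA" by (rule Q_dom[OF assms(1,3)])
  have "x = (z *\<^sub>C ?y - t *\<^sub>R A ?y) - (z - z') *\<^sub>C ?y"
    using Q_right[OF assms(1,3), of x] by (simp add: scaleC.diff_left algebra_simps)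
  then have "Q t z x = ?y - (z - z') *\<^sub>C Q t z ?y"
    using Q_left[OF assms(1,2) y] by (metis clinear_simps(2,5)[OF Q_clinear[OF assms(1,2)]])
  then show ?thesis by simp
qed

text \<open>Dividing by \<open>t' - t\<close> shows that the time derivative of \<open>Q\<close> is
  \<open>A Q Q\<close>.\<close>

lemma resolvent_identity_t:
  assumes "0 < t" "0 < t'" "z \<in> \<Gamma>"
  shows "Q t' z x - Q t z x = (t' - t) *\<^sub>R A (Q t z (Q t' z x))"
proof -
  let ?y = "Q t' z x"
  have y: "?y \<in> domA" by (rule Q_dom[OF assms(2,3)])
  have "x = (z *\<^sub>C ?y - t *\<^sub>R A ?y) - (t' - t) *\<^sub>R A ?y"
    using Q_right[OF assms(2,3), of x] by (simp add: algebra_simps)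
  then have "Q t z x = ?y - (t' - t) *\<^sub>R Q t z (A ?y)"
    using Q_left[OF assms(1,3) y] by (metis clinear_simps(5,6)[OF Q_clinear[OF assms(1,3)]])
  then show ?thesis by (simp add: AQ_commute[OF assms(1,3) y])
qed


section \<open>The weighted contour integral with factor \<open>exp z\<close>\<close>

definition J :: "(complex \<Rightarrow> 'x) \<Rightarrow> 'x"
  where "J f = inverse (2 * pi * \<i>) *\<^sub>C hankel_integral \<kappa> (\<lambda>z. exp z *\<^sub>C f z)"

text \<open>Bounded and continuous on the contour: with the weight \<open>exp z\<close>, this
  suffices for the integral to exist.\<close>

definition bc :: "real \<Rightarrow> (complex \<Rightarrow> 'x) \<Rightarrow> bool"
  where "bc B f \<longleftrightarrow> continuous_on \<Gamma> f \<and> (\<forall>z\<in>\<Gamma>. norm (f z) \<le> B)"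

lemma bc_admissible:
  assumes "bc B f"
  shows "hankel_admissible \<kappa> (exp 1 * B) (\<lambda>z. exp z *\<^sub>C f z)"
  unfolding hankel_admissible_def
proof (intro conjI ballI)
  show "continuous_on \<Gamma> (\<lambda>z. exp z *\<^sub>C f z)"
    using assms unfolding bc_def by (intro scaleC.continuous_on continuous_intros) auto
  fix z assume z: "z \<in> \<Gamma>"
  have "norm (exp z *\<^sub>C f z) = exp 1 * exp (- (\<kappa> * \<bar>Im z\<bar>)) * norm (f z)"
    using z by (simp add: norm_scaleC norm_exp_eq_Re hankel_contour_def flip: exp_add)
  also have "\<dots> \<le> exp 1 * exp (- (\<kappa> * \<bar>Im z\<bar>)) * B"
    using assms z by (intro mult_left_mono) (auto simp: bc_def)
  finally show "norm (exp z *\<^sub>C f z) \<le> exp 1 * B * exp (- (\<kappa> * \<bar>Im z\<bar>))" by (simp add: mult_ac)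
qed

text \<open>Product of \<open>1 / (2 * pi)\<close> from the normalization,
  \<open>2 * cmod (hankel_dir \<kappa>) / \<kappa>\<close> from the integral of the exponential
  along both rays, and \<open>exp 1\<close> from the vertex 1 of the contour.\<close>

definition M_J :: real where "M_J = cmod (hankel_dir \<kappa>) / (pi * \<kappa>) * exp 1"

lemma J_bound:
  assumes "bc B f"
  shows "norm (J f) \<le> M_J * B"
proof -
  have "norm (J f) \<le> 1 / (2 * pi) * (2 * cmod (hankel_dir \<kappa>) / \<kappa> * (exp 1 * B))"
    unfolding J_def norm_scaleC
  proof (rule mult_mono)
    show "cmod (inverse (2 * pi * \<i>)) \<le> 1 / (2 * pi)"
      by (simp add: inverse_eq_divide norm_divide norm_mult)
    show "norm (hankel_integral \<kappa> (\<lambda>z. exp z *\<^sub>C f z)) \<le> 2 * cmod (hankel_dir \<kappa>) / \<kappa> * (exp 1 * B)"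
      by (rule norm_hankel_integral_le[OF \<kappa> bc_admissible[OF assms]])
  qed simp_all
  also have "\<dots> = M_J * B" by (simp add: M_J_def)
  finally show ?thesis .
qed

lemma J_operator:
  assumes "bc B f" "continuous_clinear h"
  shows "J (\<lambda>z. h (f z)) = h (J f)"
proof -
  have lin: "clinear h" using assms(2) by (simp add: continuous_clinear_def)
  have "(\<lambda>z. exp z *\<^sub>C h (f z)) = (\<lambda>z. h (exp z *\<^sub>C f z))"
    by (simp add: clinear_simps[OF lin])
  then show ?thesis
    using hankel_integral_operator[OF \<kappa> bc_admissible[OF assms(1)] assms(2)]
    by (simp only: J_def clinear_simps[OF lin])
qed

lemma J_add:
  assumes "bc B f" "bc C g"
  shows "J (\<lambda>z. f z + g z) = J f + J g"
  using hankel_integral_add[OF \<kappa> bc_admissible[OF assms(1)] bc_admissible[OF assms(2)]]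
  by (simp add: J_def scaleC_add_right)

lemma J_cong:
  assumes "\<And>z. z \<in> \<Gamma> \<Longrightarrow> f z = g z" "bc B f"
  shows "J f = J g"
  unfolding J_def using hankel_integral_cong[OF \<kappa> _ bc_admissible[OF assms(2)], of "\<lambda>z. exp z *\<^sub>C g z"] assms(1)
  by simp

lemma bc_add: "bc B f \<Longrightarrow> bc C g \<Longrightarrow> bc (B + C) (\<lambda>z. f z + g z)"
  by (auto simp: bc_def intro!: continuous_on_add norm_triangle_le add_mono)

lemma bc_operator:
  assumes "bc B f" "continuous_clinear h" "\<And>x. norm (h x) \<le> M * norm x" "0 \<le> M"
  shows "bc (M * B) (\<lambda>z. h (f z))"
  unfolding bc_def
proof (intro conjI ballI)
  show "continuous_on \<Gamma> (\<lambda>z. h (f z))"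
    using assms(1,2) unfolding bc_def continuous_clinear_def
    by (auto intro: continuous_on_compose2[where t = UNIV and g = h])
  show "norm (h (f z)) \<le> M * B" if "z \<in> \<Gamma>" for z
    using order_trans[OF assms(3) mult_left_mono[OF _ assms(4)]] assms(1) that by (auto simp: bc_def)
qed

lemma continuous_clinear_scaleC: "continuous_clinear (\<lambda>x::'x. a *\<^sub>C x)"
  by (rule bounded_linear_continuous_clinear[where M = "cmod a"]) (auto simp: clinear_scaleC norm_scaleC)

lemma bc_scaleC: "bc B f \<Longrightarrow> bc (cmod a * B) (\<lambda>z. a *\<^sub>C f z)"
  by (rule bc_operator[OF _ continuous_clinear_scaleC]) (auto simp: norm_scaleC)

lemma J_scaleC: "bc B f \<Longrightarrow> J (\<lambda>z. a *\<^sub>C f z) = a *\<^sub>C J f"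
  by (rule J_operator[OF _ continuous_clinear_scaleC])

lemma J_scaleR: "bc B f \<Longrightarrow> J (\<lambda>z. r *\<^sub>R f z) = r *\<^sub>R J f"
  using J_scaleC[of B f "of_real r"] by (simp add: scaleC_of_real)

lemma bc_scaleR: "bc B f \<Longrightarrow> bc (\<bar>r\<bar> * B) (\<lambda>z. r *\<^sub>R f z)"
  using bc_scaleC[of B f "of_real r"] by (simp add: scaleC_of_real)

lemma bc_diff: "bc B f \<Longrightarrow> bc C g \<Longrightarrow> bc (B + C) (\<lambda>z. f z - g z)"
  using bc_add[OF _ bc_scaleC[of C g "- 1"], of B f] by (simp add: scaleC_one)

lemma J_diff: "bc B f \<Longrightarrow> bc C g \<Longrightarrow> J (\<lambda>z. f z - g z) = J f - J g"
  using J_add[OF _ bc_scaleC[of C g "- 1"], of B f] J_scaleC[of C g "- 1"] by (simp add: scaleC_one)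

text \<open>The scalar integral \<open>2 * pi * \<i>\<close> is pushed through
  \<open>a \<mapsto> a x\<close>. It provides the comparison term for \<open>T t x\<close> as
  \<open>t\<close> tends to 0.\<close>

lemma J_inverse: "J (\<lambda>z. inverse z *\<^sub>C x) = x"
proof -
  have "continuous_clinear (\<lambda>a::complex. a *\<^sub>C x)"
    by (rule bounded_linear_continuous_clinear[where M = "norm x"])
      (auto intro!: clinearI simp: scaleC_complex_def scaleC_add_left scaleC_scaleC norm_scaleC)
  from hankel_integral_operator[OF \<kappa> hankel_admissible_exp_inverse[OF \<kappa>] this]
  have "hankel_integral \<kappa> (\<lambda>z. (exp z / z) *\<^sub>C x) = (2 * pi * \<i>) *\<^sub>C x"
    by (simp add: hankel_integral_exp_inverse[OF \<kappa>])
  moreover have "(\<lambda>z. exp z *\<^sub>C inverse z *\<^sub>C x) = (\<lambda>z. (exp z / z) *\<^sub>C x)"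
    by (simp add: scaleC_scaleC divide_inverse)
  ultimately have "J (\<lambda>z. inverse z *\<^sub>C x) = inverse (2 * pi * \<i>) *\<^sub>C (2 * pi * \<i>) *\<^sub>C x"
    by (simp only: J_def)
  moreover have "inverse (2 * pi * \<i>) * (2 * pi * \<i>) = 1" by (rule left_inverse) simp
  ultimately show ?thesis by (simp only: scaleC_scaleC scaleC_one)
qed

text \<open>The derivative of \<open>exp z f z\<close> is \<open>exp z (f z + f' z)\<close>, and it
  integrates to 0 along the contour.\<close>

lemma J_by_parts:
  assumes "bc B f" "bc C f'"
    and deriv: "\<And>e s. e \<in> {hankel_dir \<kappa>, cnj (hankel_dir \<kappa>)} \<Longrightarrow> 0 \<le> s \<Longrightarrow>
      ((\<lambda>s. f (1 + s *\<^sub>R e)) has_vector_derivative e *\<^sub>C f' (1 + s *\<^sub>R e)) (at s within {0..})"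
  shows "J f = - J f'"
proof -
  have "hankel_integral \<kappa> (\<lambda>z. exp z *\<^sub>C (f z + f' z)) = 0"
  proof (rule hankel_integral_derivative[OF \<kappa> bc_admissible[OF bc_add[OF assms(1,2)]],
      where F = "\<lambda>z. exp z *\<^sub>C f z"])
    show "norm (exp z *\<^sub>C f z) \<le> exp 1 * B * exp (- (\<kappa> * \<bar>Im z\<bar>))" if "z \<in> \<Gamma>" for z
      using bc_admissible[OF assms(1)] that by (auto simp: hankel_admissible_def)
    fix e s assume e: "e \<in> {hankel_dir \<kappa>, cnj (hankel_dir \<kappa>)}" "0 \<le> (s::real)"
    have "((\<lambda>s. exp (1 + of_real s * e)) has_vector_derivative e * exp (1 + of_real s * e)) (at s within {0..})"
      by (rule has_vector_derivative_real_field) (auto intro!: derivative_eq_intros)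
    then have 1: "((\<lambda>s. exp (1 + s *\<^sub>R e)) has_vector_derivative e * exp (1 + s *\<^sub>R e)) (at s within {0..})"
      by (simp add: scaleR_conv_of_real)
    from scaleC.has_vector_derivative[OF this deriv[OF e]]
    show "((\<lambda>s. exp (1 + s *\<^sub>R e) *\<^sub>C f (1 + s *\<^sub>R e)) has_vector_derivative
        e *\<^sub>C exp (1 + s *\<^sub>R e) *\<^sub>C (f (1 + s *\<^sub>R e) + f' (1 + s *\<^sub>R e))) (at s within {0..})"
      by (simp add: scaleC_add_right scaleC_scaleC mult_ac add.commute)
  qed
  then have "J (\<lambda>z. f z + f' z) = 0" by (simp add: J_def)
  then show ?thesis using J_add[OF assms(1,2)] by (simp add: eq_neg_iff_add_eq_0)
qed

end

context sectorial_resolvent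
begin

lemma K: "0 < K"
  using c \<kappa> by simp

lemma Q_lipschitz:
  assumes "0 < t" "z \<in> \<Gamma>" "z' \<in> \<Gamma>"
  shows "norm (Q t z' x - Q t z x) \<le> K * (K * norm x) * dist z' z"
proof -
  have "norm (Q t z' x - Q t z x) = cmod (z - z') * norm (Q t z (Q t z' x))"
    by (simp add: resolvent_identity[OF assms] norm_scaleC)
  also have "\<dots> \<le> cmod (z - z') * (K * (K * norm x))"
    using order_trans[OF Q_bound[OF assms(1,2)] mult_left_mono[OF Q_bound[OF assms(1,3)] less_imp_le[OF K]]]
    by (intro mult_left_mono) auto
  finally show ?thesis by (simp add: dist_norm norm_minus_commute mult.commute)
qed

lemma Q_continuous: "0 < t \<Longrightarrow> continuous_on \<Gamma> (\<lambda>z. Q t z x)"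
  using K
  by (intro lipschitz_on_continuous_on[where L = "K * (K * norm x)"] lipschitz_onI)
    (auto simp: Q_lipschitz dist_norm[of "Q _ _ _"])

lemma Q_continuous_compose:
  assumes t: "0 < t" and f: "continuous_on \<Gamma> f"
  shows "continuous_on \<Gamma> (\<lambda>z. Q t z (f z))"
  by (rule continuous_on_operator_family[OF Q_continuous[OF t] f Q_clinear[OF t] Q_bound[OF t]])

lemma AQ_continuous_compose:
  assumes t: "0 < t" and f: "continuous_on \<Gamma> f"
  shows "continuous_on \<Gamma> (\<lambda>z. A (Q t z (f z)))"
proof -
  have "continuous_on \<Gamma> (\<lambda>z. (z *\<^sub>C Q t z (f z) - f z) /\<^sub>R t)"
    by (intro continuous_intros scaleC.continuous_on Q_continuous_compose f t)
  then show ?thesis by (simp add: AQ_eq[OF t] cong: continuous_on_cong)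
qed

lemma bc_Q: "0 < t \<Longrightarrow> bc (K * norm x) (\<lambda>z. Q t z x)"
  by (simp add: bc_def Q_continuous Q_bound)

lemma bc_AQ: "0 < t \<Longrightarrow> bc ((c + 1) / t * norm x) (\<lambda>z. A (Q t z x))"
  unfolding bc_def by (intro conjI ballI AQ_bound AQ_continuous_compose continuous_on_const)

lemma AQ_norm_le:
  assumes "0 < t" "z \<in> \<Gamma>" "norm x \<le> B"
  shows "norm (A (Q t z x)) \<le> (c + 1) / t * B"
  using assms c by (intro order_trans[OF AQ_bound[OF assms(1,2)] mult_left_mono]) auto

lemma bc_AQQ:
  assumes "0 < t"
  shows "bc ((c + 1) / t * (K * norm x)) (\<lambda>z. A (Q t z (Q t z x)))"
  unfolding bc_def
  by (intro conjI ballI AQ_continuous_compose Q_continuous AQ_norm_le Q_bound assms)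

text \<open>By the resolvent identity, the derivative of \<open>A (z - t A)^-1\<close> in
  \<open>z\<close> is \<open>- A (z - t A)^-2\<close>; the factor \<open>e\<close> is the speed
  along the ray.\<close>

lemma AQ_derivative:
  assumes e: "e \<in> {hankel_dir \<kappa>, cnj (hankel_dir \<kappa>)}" and s: "0 \<le> s" and t: "0 < t"
  shows "((\<lambda>s. A (Q t (1 + s *\<^sub>R e) x)) has_vector_derivative
    e *\<^sub>C - A (Q t (1 + s *\<^sub>R e) (Q t (1 + s *\<^sub>R e) x))) (at s within {0..})"
  unfolding has_vector_derivative_iff_quotient
proof -
  define \<zeta> where "\<zeta> s = 1 + s *\<^sub>R e" for s :: real
  have \<zeta>: "\<zeta> r \<in> \<Gamma>" if "0 \<le> r" for r
    using e that hankel_contour_points[of r] by (auto simp: \<zeta>_def)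
  note lin = AQ_clinear[OF t \<zeta>[OF s]]
  have quot: "(A (Q t (\<zeta> r) x) - A (Q t (\<zeta> s) x)) /\<^sub>R (r - s) = e *\<^sub>C - A (Q t (\<zeta> s) (Q t (\<zeta> r) x))"
    if r: "0 \<le> r" "r \<noteq> s" for r
  proof -
    have "A (Q t (\<zeta> r) x) - A (Q t (\<zeta> s) x) = A (Q t (\<zeta> r) x - Q t (\<zeta> s) x)"
      by (simp add: A_diff Q_dom[OF t \<zeta>[OF s]] Q_dom[OF t \<zeta>[OF r(1)]])
    also have "\<dots> = (\<zeta> s - \<zeta> r) *\<^sub>C A (Q t (\<zeta> s) (Q t (\<zeta> r) x))"
      by (simp add: resolvent_identity[OF t \<zeta>[OF s] \<zeta>[OF r(1)]] A_scale Q_dom[OF t \<zeta>[OF s]])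
    also have "\<zeta> s - \<zeta> r = - of_real (r - s) * e"
      by (simp add: \<zeta>_def scaleR_conv_of_real algebra_simps)
    also have "(- of_real (r - s) * e) *\<^sub>C A (Q t (\<zeta> s) (Q t (\<zeta> r) x))
        = (r - s) *\<^sub>R (e *\<^sub>C - A (Q t (\<zeta> s) (Q t (\<zeta> r) x)))"
      by (simp add: scaleR_scaleC scaleC_scaleC del: of_real_diff)
    finally show ?thesis using r by simp
  qed
  have "continuous_on {0..} (\<lambda>r. Q t (\<zeta> r) x)"
    unfolding \<zeta>_def by (rule continuous_on_compose2[OF Q_continuous[OF t]])
      (use \<zeta> in \<open>auto simp: \<zeta>_def intro!: continuous_intros\<close>)
  then have lim: "((\<lambda>r. Q t (\<zeta> r) x) \<longlongrightarrow> Q t (\<zeta> s) x) (at s within {0..})"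
    using s by (auto simp: continuous_on_def)
  have "continuous_clinear (\<lambda>x. A (Q t (\<zeta> s) x))"
    using AQ_bound[OF t \<zeta>[OF s]] by (rule bounded_linear_continuous_clinear[OF lin])
  then have "bounded_linear (\<lambda>x. A (Q t (\<zeta> s) x))" by (rule continuous_clinear_bounded_linear)
  from bounded_linear.tendsto[OF this lim]
  have "((\<lambda>r. e *\<^sub>C - A (Q t (\<zeta> s) (Q t (\<zeta> r) x))) \<longlongrightarrow> e *\<^sub>C - A (Q t (\<zeta> s) (Q t (\<zeta> s) x))) (at s within {0..})"
    by (intro scaleC.tendsto tendsto_const tendsto_minus)
  then have "((\<lambda>r. (A (Q t (\<zeta> r) x) - A (Q t (\<zeta> s) x)) /\<^sub>R (r - s)) \<longlongrightarrow>
      e *\<^sub>C - A (Q t (\<zeta> s) (Q t (\<zeta> s) x))) (at s within {0..})"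
    by (rule Lim_transform_eventually) (auto simp: eventually_at_filter quot)
  then show "((\<lambda>r. (A (Q t (1 + r *\<^sub>R e) x) - A (Q t (1 + s *\<^sub>R e) x)) /\<^sub>R (r - s)) \<longlongrightarrow>
      e *\<^sub>C - A (Q t (1 + s *\<^sub>R e) (Q t (1 + s *\<^sub>R e) x))) (at s within {0..})"
    by (simp only: \<zeta>_def)
qed

text \<open>Differentiating \<open>T\<close> in time under the integral produces
  \<open>A Q Q\<close>. Integration by parts in \<open>z\<close> brings it back to
  \<open>A Q\<close>, which is the integrand for \<open>A (T t x)\<close>.\<close>

lemma J_AQQ:
  assumes t: "0 < t"
  shows "J (\<lambda>z. A (Q t z (Q t z x))) = J (\<lambda>z. A (Q t z x))"
proof -
  have bcm: "bc ((c + 1) / t * (K * norm x)) (\<lambda>z. - A (Q t z (Q t z x)))"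
    using bc_scaleC[OF bc_AQQ[OF t, of x], of "- 1"] by (simp add: scaleC_one)
  have "J (\<lambda>z. A (Q t z x)) = - J (\<lambda>z. - A (Q t z (Q t z x)))"
    by (rule J_by_parts[OF bc_AQ[OF t] bcm AQ_derivative[OF _ _ t]])
  then show ?thesis
    using J_scaleC[OF bc_AQQ[OF t, of x], of "- 1"] by (simp add: scaleC_one)
qed


section \<open>The analytic semigroup of the rescaled contour integral\<close>

text \<open>The integral makes sense for \<open>t > 0\<close>; the other branch supplies
  \<open>T 0 = id\<close>.\<close>

definition T :: "real \<Rightarrow> 'x \<Rightarrow> 'x"
  where "T t x = (if 0 < t then J (\<lambda>z. Q t z x) else x)"

text \<open>For \<open>t > 0\<close> this turns out to be both \<open>A (T t x)\<close> and the time
  derivative of \<open>T t x\<close>.\<close>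

definition T1 :: "real \<Rightarrow> 'x \<Rightarrow> 'x"
  where "T1 t x = J (\<lambda>z. A (Q t z x))"

text \<open>The maximum with 1 covers the branch in which \<open>T t\<close> is the
  identity.\<close>

definition M_T :: real where "M_T = max 1 (M_J * K)"

lemma M_T: "0 < M_T" by (simp add: M_T_def)

lemma T_bound: "norm (T t x) \<le> M_T * norm x"
proof (cases "0 < t")
  case True
  have "norm (T t x) \<le> M_J * K * norm x"
    using J_bound[OF bc_Q[OF True, of x]] True by (simp add: T_def mult.assoc)
  also have "\<dots> \<le> M_T * norm x" by (intro mult_right_mono) (auto simp: M_T_def)
  finally show ?thesis .
next
  case False
  have "1 * norm x \<le> M_T * norm x" by (intro mult_right_mono) (auto simp: M_T_def)
  then show ?thesis using False by (simp add: T_def)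
qed

lemma T_clinear: "clinear (T t)"
proof (cases "0 < t")
  case True
  show ?thesis
  proof (rule clinearI)
    fix x y a
    have "J (\<lambda>z. Q t z (x + y)) = J (\<lambda>z. Q t z x + Q t z y)"
      by (rule J_cong[OF _ bc_Q[OF True]]) (simp add: clinear_simps[OF Q_clinear[OF True]])
    then show "T t (x + y) = T t x + T t y"
      using True by (simp add: T_def J_add[OF bc_Q bc_Q])
    have "J (\<lambda>z. Q t z (a *\<^sub>C x)) = J (\<lambda>z. a *\<^sub>C Q t z x)"
      by (rule J_cong[OF _ bc_Q[OF True]]) (simp add: clinear_simps[OF Q_clinear[OF True]])
    then show "T t (a *\<^sub>C x) = a *\<^sub>C T t x"
      using True by (simp add: T_def J_scaleC[OF bc_Q])
  qed
next
  case False
  then show ?thesis by (intro clinearI) (auto simp: T_def)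
qed

lemma T_continuous_clinear: "continuous_clinear (T t)"
  by (rule bounded_linear_continuous_clinear[OF T_clinear T_bound])

lemma T1_bound: "0 < t \<Longrightarrow> norm (T1 t x) \<le> M_J * ((c + 1) / t) * norm x"
  using J_bound[OF bc_AQ[of t x]] by (simp add: T1_def mult.assoc)

lemma one_in_sector: "- \<kappa> * \<bar>Im 1\<bar> < Re 1" by simp

text \<open>An argument by closedness of \<open>A\<close> in resolvent form: the bounded operator
  \<open>R 1\<close> passes through the integral, and \<open>R 1 A Q = R 1 Q - Q\<close> exhibits
  \<open>T t x\<close> as a value of \<open>R 1\<close>.\<close>

lemma T_dom_A:
  assumes t: "0 < t"
  shows "T t x \<in> domA" and "A (T t x) = T1 t x"
proof -
  note R1 = R_clinear[OF one_in_sector]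
  have R1c: "continuous_clinear (R 1)"
    using R_bound[OF one_in_sector] by (rule bounded_linear_continuous_clinear[OF R1])
  have "R 1 (T1 t x) = J (\<lambda>z. R 1 (A (Q t z x)))"
    by (simp add: T1_def J_operator[OF bc_AQ[OF t] R1c])
  also have "\<dots> = J (\<lambda>z. R 1 (Q t z x) - Q t z x)"
  proof (rule J_cong)
    show "bc (c * ((c + 1) / t * norm x)) (\<lambda>z. R 1 (A (Q t z x)))"
      using R_bound[OF one_in_sector] c by (intro bc_operator[OF bc_AQ[OF t] R1c]) auto
    fix z assume z: "z \<in> \<Gamma>"
    show "R 1 (A (Q t z x)) = R 1 (Q t z x) - Q t z x"
      using R_left[OF one_in_sector Q_dom[OF t z, of x]] by (simp add: clinear_simps[OF R1] scaleC_one algebra_simps)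
  qed
  also have "\<dots> = J (\<lambda>z. R 1 (Q t z x)) - J (\<lambda>z. Q t z x)"
  proof (rule J_diff)
    show "bc (c * (K * norm x)) (\<lambda>z. R 1 (Q t z x))"
      using R_bound[OF one_in_sector] c by (intro bc_operator[OF bc_Q[OF t] R1c]) auto
  qed (rule bc_Q[OF t])
  also have "\<dots> = R 1 (T t x) - T t x"
    using t by (simp add: T_def J_operator[OF bc_Q[OF t] R1c])
  finally have eq: "T t x = R 1 (T t x - T1 t x)" by (simp add: clinear_simps[OF R1])
  show "T t x \<in> domA" by (subst eq) (rule R_dom[OF one_in_sector])
  from R_right[OF one_in_sector, of "T t x - T1 t x"]
  show "A (T t x) = T1 t x" by (simp add: scaleC_one flip: eq)
qed

lemma T1_eq: "0 < t \<Longrightarrow> x \<in> domA \<Longrightarrow> T1 t x = T t (A x)"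
  using J_cong[OF AQ_commute bc_AQ, of t x] by (simp add: T1_def T_def)

text \<open>Two applications of the resolvent identity in \<open>t\<close> make the integrand of the
  Taylor remainder quadratic in \<open>t' - t\<close>, and \<open>J_AQQ\<close> identifies the
  linear term.\<close>

lemma T_second_order:
  assumes t: "0 < t" and t': "0 < t'"
  shows "norm (T t' x - T t x - (t' - t) *\<^sub>R T1 t x)
    \<le> M_J * ((c + 1) / t * ((c + 1) / t * (K * norm x))) * (t' - t)\<^sup>2"
proof -
  define f where "f z = Q t' z x - Q t z x - (t' - t) *\<^sub>R A (Q t z (Q t z x))" for z
  have f_eq: "f z = (t' - t)\<^sup>2 *\<^sub>R A (Q t z (A (Q t z (Q t' z x))))" if z: "z \<in> \<Gamma>" for z
  proof -
    note lin = AQ_clinear[OF t z]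
    have "f z = (t' - t) *\<^sub>R (A (Q t z (Q t' z x)) - A (Q t z (Q t z x)))"
      by (simp add: f_def resolvent_identity_t[OF t t' z] scaleR_right_diff_distrib)
    also have "\<dots> = (t' - t) *\<^sub>R A (Q t z (Q t' z x - Q t z x))"
      by (simp add: clinear_simps(5)[OF lin])
    also have "\<dots> = (t' - t) *\<^sub>R (t' - t) *\<^sub>R A (Q t z (A (Q t z (Q t' z x))))"
      by (simp only: resolvent_identity_t[OF t t' z] clinear_simps(6)[OF lin])
    finally show ?thesis by (simp add: power2_eq_square)
  qed
  have bc1: "bc (K * norm x + K * norm x) (\<lambda>z. Q t' z x - Q t z x)"
    by (rule bc_diff[OF bc_Q[OF t'] bc_Q[OF t]])
  note bc2 = bc_scaleR[OF bc_AQQ[OF t, of x], of "t' - t"]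
  have "J f = T t' x - T t x - (t' - t) *\<^sub>R J (\<lambda>z. A (Q t z (Q t z x)))"
    unfolding f_def using t t'
    by (simp add: J_diff[OF bc1 bc2] J_diff[OF bc_Q[OF t'] bc_Q[OF t]] J_scaleR[OF bc_AQQ[OF t]] T_def)
  then have Jf: "J f = T t' x - T t x - (t' - t) *\<^sub>R T1 t x"
    by (simp add: J_AQQ[OF t] T1_def)
  have "bc ((t' - t)\<^sup>2 * ((c + 1) / t * ((c + 1) / t * (K * norm x)))) f"
    unfolding bc_def
  proof (intro conjI ballI)
    show "continuous_on \<Gamma> f" using bc_diff[OF bc1 bc2] unfolding bc_def f_def by blast
    fix z assume z: "z \<in> \<Gamma>"
    show "norm (f z) \<le> (t' - t)\<^sup>2 * ((c + 1) / t * ((c + 1) / t * (K * norm x)))"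
      unfolding f_eq[OF z] norm_scaleR abs_power2
      by (intro mult_left_mono AQ_norm_le Q_bound t t' z zero_le_power2)
  qed
  from J_bound[OF this] show ?thesis unfolding Jf by (simp add: mult_ac)
qed

lemma T_derivative:
  assumes t: "0 < t"
  shows "((\<lambda>t. T t x) has_vector_derivative T1 t x) (at t)"
  unfolding has_vector_derivative_iff_quotient
proof (rule LIM_zero_cancel)
  let ?C = "M_J * ((c + 1) / t * ((c + 1) / t * (K * norm x)))"
  have "((\<lambda>t'. ?C * \<bar>t' - t\<bar>) \<longlongrightarrow> ?C * \<bar>t - t\<bar>) (at t)"
    by (intro tendsto_intros)
  then have lim: "((\<lambda>t'. ?C * \<bar>t' - t\<bar>) \<longlongrightarrow> 0) (at t)" by simp
  show "((\<lambda>t'. (T t' x - T t x) /\<^sub>R (t' - t) - T1 t x) \<longlongrightarrow> 0) (at t)"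
  proof (rule Lim_null_comparison[OF _ lim])
    have bound: "norm ((T t' x - T t x) /\<^sub>R (t' - t) - T1 t x) \<le> ?C * \<bar>t' - t\<bar>" if t': "0 < t'" "t' \<noteq> t" for t'
    proof -
      have "(T t' x - T t x) /\<^sub>R (t' - t) - T1 t x = (T t' x - T t x - (t' - t) *\<^sub>R T1 t x) /\<^sub>R (t' - t)"
        using t' by (simp add: scaleR_right_diff_distrib)
      then have "norm ((T t' x - T t x) /\<^sub>R (t' - t) - T1 t x)
          = norm (T t' x - T t x - (t' - t) *\<^sub>R T1 t x) / \<bar>t' - t\<bar>"
        by (simp add: divide_inverse mult.commute)
      also have "\<dots> \<le> ?C * (t' - t)\<^sup>2 / \<bar>t' - t\<bar>"
        by (rule divide_right_mono[OF T_second_order[OF t t'(1)]]) simp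
      also have "\<dots> = ?C * \<bar>t' - t\<bar>"
      proof -
        have *: "C * q\<^sup>2 / \<bar>q\<bar> = C * \<bar>q\<bar>" if "q \<noteq> 0" for C q :: real
          using that by (cases "q > 0") (auto simp: power2_eq_square abs_if)
        show ?thesis by (rule *) (use t' in simp)
      qed
      finally show ?thesis .
    qed
    have "\<forall>\<^sub>F t' in at t. 0 < t'"
      using order_tendstoD(1)[OF tendsto_ident_at t] .
    then show "\<forall>\<^sub>F t' in at t. norm ((T t' x - T t x) /\<^sub>R (t' - t) - T1 t x) \<le> ?C * \<bar>t' - t\<bar>"
      using bound by (auto simp: eventually_at_filter elim: eventually_mono)
  qed
qed

text \<open>For \<open>x\<close> in the domain, \<open>Q t z x - x / z\<close> equals
  \<open>t / z\<close> times \<open>Q t z (A x)\<close>, and the weighted integral of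
  \<open>x / z\<close> is \<open>x\<close>.\<close>

lemma T_small_time:
  assumes t: "0 < t" and x: "x \<in> domA"
  shows "norm (T t x - x) \<le> t * (M_J * ((1 + \<kappa>) * (K * norm (A x))))"
proof -
  have nz: "z \<noteq> 0" "cmod (inverse z) \<le> 1 + \<kappa>" if z: "z \<in> \<Gamma>" for z
  proof -
    have "0 < 1 / (1 + \<kappa>)" using \<kappa> by simp
    then have pos: "0 < cmod z" using hankel_contour_norm_ge[OF z \<kappa>] by linarith
    then show "z \<noteq> 0" by simp
    show "cmod (inverse z) \<le> 1 + \<kappa>"
      using le_imp_inverse_le[OF hankel_contour_norm_ge[OF z \<kappa>]] \<kappa>
      by (simp add: norm_divide inverse_eq_divide)
  qed
  have bc_inv: "bc ((1 + \<kappa>) * B) (\<lambda>z. inverse z *\<^sub>C f z)" if f: "bc B f" for f :: "complex \<Rightarrow> 'x" and B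
    unfolding bc_def
  proof (intro conjI ballI)
    show "continuous_on \<Gamma> (\<lambda>z. inverse z *\<^sub>C f z)"
      using f nz unfolding bc_def by (intro scaleC.continuous_on continuous_intros) auto
    show "norm (inverse z *\<^sub>C f z) \<le> (1 + \<kappa>) * B" if "z \<in> \<Gamma>" for z
      unfolding norm_scaleC using f nz[OF that] that \<kappa> by (intro mult_mono) (auto simp: bc_def)
  qed
  have "bc (norm x) (\<lambda>_. x)" by (simp add: bc_def)
  note bcx = bc_inv[OF this]
  note bcQ = bc_inv[OF bc_Q[OF t, of "A x"]]
  have eq: "Q t z x - inverse z *\<^sub>C x = t *\<^sub>R inverse z *\<^sub>C Q t z (A x)" if z: "z \<in> \<Gamma>" for z
  proof -
    have "z *\<^sub>C Q t z x - x = t *\<^sub>R Q t z (A x)"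
      using Q_right[OF t z, of x] AQ_commute[OF t z x] by (simp add: algebra_simps)
    then have "inverse z *\<^sub>C (z *\<^sub>C Q t z x - x) = inverse z *\<^sub>C t *\<^sub>R Q t z (A x)" by simp
    then show ?thesis
      using nz[OF z] by (simp add: scaleC.diff_right scaleC_scaleC scaleC_one scaleC.scaleR_right)
  qed
  have "T t x - x = J (\<lambda>z. Q t z x - inverse z *\<^sub>C x)"
    using t by (simp add: T_def J_inverse J_diff[OF bc_Q[OF t] bcx])
  also have "\<dots> = J (\<lambda>z. t *\<^sub>R inverse z *\<^sub>C Q t z (A x))"
    by (rule J_cong[OF eq bc_diff[OF bc_Q[OF t] bcx]])
  also have "\<dots> = t *\<^sub>R J (\<lambda>z. inverse z *\<^sub>C Q t z (A x))"
    by (rule J_scaleR[OF bcQ])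
  finally have "norm (T t x - x) = t * norm (J (\<lambda>z. inverse z *\<^sub>C Q t z (A x)))"
    using t by simp
  also have "\<dots> \<le> t * (M_J * ((1 + \<kappa>) * (K * norm (A x))))"
    using t by (intro mult_left_mono J_bound bcQ) auto
  finally show ?thesis .
qed

lemma T_tendsto_0: "((\<lambda>t. T t x) \<longlongrightarrow> x) (at_right 0)"
proof (rule tendstoI)
  fix e :: real assume e: "0 < e"
  \<comment> \<open>The approximation error of \<open>y\<close> enters twice, once under
    \<open>T t\<close> and once directly; \<open>d\<close> makes the sum \<open>m * d\<close> equal
    to \<open>e / 2\<close>.\<close>
  define m where "m = M_T + 1"
  have m: "0 < m" using M_T by (simp add: m_def)
  define d where "d = e / (2 * m)"
  have d: "0 < d" using e m by (simp add: d_def)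
  obtain y where y: "y \<in> domA" "dist y x < d"
    using dense d by (metis closure_approachable UNIV_I)
  have "((\<lambda>t. t * (M_J * ((1 + \<kappa>) * (K * norm (A y))))) \<longlongrightarrow> 0) (at_right 0)"
    by (auto intro!: tendsto_eq_intros)
  then have "\<forall>\<^sub>F t in at_right 0. t * (M_J * ((1 + \<kappa>) * (K * norm (A y)))) < e / 2"
    using e by (intro order_tendstoD) auto
  moreover have "\<forall>\<^sub>F t::real in at_right 0. 0 < t" by (simp add: eventually_at_filter)
  ultimately show "\<forall>\<^sub>F t in at_right 0. dist (T t x) x < e"
  proof eventually_elim
    case (elim t)
    have "T t x - x = T t (x - y) + (T t y - y) + (y - x)"
      by (simp add: clinear_simps[OF T_clinear])
    then have "norm (T t x - x) \<le> norm (T t (x - y)) + norm (T t y - y) + norm (y - x)"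
      by (metis (no_types) add_mono norm_triangle_ineq norm_triangle_le order_refl)
    also have "norm (T t (x - y)) \<le> M_T * d"
      using y(2) M_T by (intro order_trans[OF T_bound mult_left_mono]) (auto simp: dist_norm norm_minus_commute)
    also have "norm (y - x) < d" using y(2) by (simp add: dist_norm)
    also have "norm (T t y - y) < e / 2"
      using T_small_time[OF elim(2) y(1)] elim(1) by linarith
    finally have "norm (T t x - x) < M_T * d + e / 2 + d" by simp
    also have "\<dots> = m * d + e / 2" by (simp add: m_def algebra_simps)
    also have "\<dots> = e" using m by (simp add: d_def)
    finally show ?case by (simp add: dist_norm)
  qed
qed

lemma T_continuous: "continuous_on {0..} (\<lambda>t. T t x)"
  unfolding continuous_on_eq_continuous_within
proof
  fix t :: real assume "t \<in> {0..}"
  then consider "t = 0" | "0 < t" by force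
  then show "continuous (at t within {0..}) (\<lambda>t. T t x)"
  proof cases
    case 1
    have "T 0 x = x" by (simp add: T_def)
    then show ?thesis
      using T_tendsto_0[of x] 1 by (simp add: continuous_within at_within_Ici_at_right)
  next
    case 2
    then have "isCont (\<lambda>t. T t x) t"
      using T_derivative has_vector_derivative_continuous by blast
    then show ?thesis by (rule continuous_at_imp_continuous_at_within)
  qed
qed

text \<open>The function \<open>r \<mapsto> T (\<tau> - r) (T r x)\<close> has derivative 0 on the
  open interval, where both factors are differentiable. Its constant value is identified by letting
  \<open>r\<close> tend to 0.\<close>

lemma T_semigroup_pos:
  assumes "0 < t" "0 < s"
  shows "T (t + s) x = T t (T s x)"
proof -
  define \<tau> where "\<tau> = t + s"
  let ?I = "{0<..<\<tau>}"
  have "((\<lambda>r. T (\<tau> - r) (T r x)) has_vector_derivative 0) (at r within ?I)" if r: "r \<in> ?I" for r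
  proof -
    have 1: "((\<lambda>r. T (\<tau> - r) y) has_vector_derivative - T1 (\<tau> - r) y) (at r within ?I)" for y
      by (rule has_vector_derivative_reflect[OF T_derivative]) (use r in auto)
    have "((\<lambda>r. T (\<tau> - r) (T r x)) has_vector_derivative (- T1 (\<tau> - r) (T r x) + T (\<tau> - r) (T1 r x))) (at r within ?I)"
    proof (rule has_vector_derivative_operator_family
        [where M = M_T and S = "\<lambda>r. T (\<tau> - r)" and x = "\<lambda>r. T r x" and x' = "T1 r x"])
      show "((\<lambda>r. T r x) has_vector_derivative T1 r x) (at r within ?I)"
        by (rule has_vector_derivative_at_within[OF T_derivative]) (use r in auto)
      show "((\<lambda>s. T (\<tau> - s) (T1 r x)) \<longlongrightarrow> T (\<tau> - r) (T1 r x)) (at r within ?I)"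
        using has_vector_derivative_continuous[OF 1[of "T1 r x"]] by (simp add: continuous_within)
    qed (use r 1 T_clinear T_bound in auto)
    moreover have "T (\<tau> - r) (T1 r x) = T1 (\<tau> - r) (T r x)"
      using r T_dom_A[of r x] T1_eq[of "\<tau> - r" "T r x"] by simp
    ultimately show ?thesis by simp
  qed
  then obtain C where C: "\<And>r. r \<in> ?I \<Longrightarrow> T (\<tau> - r) (T r x) = C"
    using has_vector_derivative_zero_constant[of ?I "\<lambda>r. T (\<tau> - r) (T r x)"] by auto
  have "0 < \<tau>" using assms by (simp add: \<tau>_def)
  have "((\<lambda>r. T (\<tau> - r) x) \<longlongrightarrow> T \<tau> x) (at_right 0)"
  proof -
    have "isCont (\<lambda>t. T t x) \<tau>"
      using T_derivative[OF \<open>0 < \<tau>\<close>] has_vector_derivative_continuous by blast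
    then show ?thesis
      by (rule isCont_tendsto_compose) (auto intro!: tendsto_eq_intros)
  qed
  then have l1: "((\<lambda>r. norm (T (\<tau> - r) x - T \<tau> x)) \<longlongrightarrow> 0) (at_right 0)"
    by (intro tendsto_norm_zero LIM_zero)
  have l2: "((\<lambda>r. norm (T r x - x)) \<longlongrightarrow> 0) (at_right 0)"
    by (intro tendsto_norm_zero LIM_zero T_tendsto_0)
  have "((\<lambda>r. M_T * norm (T r x - x) + norm (T (\<tau> - r) x - T \<tau> x)) \<longlongrightarrow> 0) (at_right 0)"
    by (intro tendsto_add_zero tendsto_mult_right_zero l1 l2)
  then have "((\<lambda>r. T (\<tau> - r) (T r x) - T \<tau> x) \<longlongrightarrow> 0) (at_right 0)"
  proof (rule Lim_null_comparison[rotated], intro always_eventually allI)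
    fix r
    have "T (\<tau> - r) (T r x) - T \<tau> x = T (\<tau> - r) (T r x - x) + (T (\<tau> - r) x - T \<tau> x)"
      by (simp add: clinear_simps[OF T_clinear])
    then have "norm (T (\<tau> - r) (T r x) - T \<tau> x)
        \<le> norm (T (\<tau> - r) (T r x - x)) + norm (T (\<tau> - r) x - T \<tau> x)"
      by (metis norm_triangle_ineq)
    then show "norm (T (\<tau> - r) (T r x) - T \<tau> x) \<le> M_T * norm (T r x - x) + norm (T (\<tau> - r) x - T \<tau> x)"
      using T_bound[of "\<tau> - r" "T r x - x"] by linarith
  qed
  moreover have "\<forall>\<^sub>F r in at_right 0. T (\<tau> - r) (T r x) - T \<tau> x = C - T \<tau> x"
    using eventually_at_right_less[of 0] order_tendstoD(2)[OF tendsto_ident_at \<open>0 < \<tau>\<close>, of "{0<..}"]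
    by eventually_elim (simp add: C)
  ultimately have "((\<lambda>r::real. C - T \<tau> x) \<longlongrightarrow> 0) (at_right 0)"
    by (rule Lim_transform_eventually)
  then have "C = T \<tau> x" by (simp add: tendsto_const_iff)
  then show ?thesis using C[of s] assms by (simp add: \<tau>_def)
qed

lemma T_C0_semigroup: "C0_semigroup T"
  unfolding C0_semigroup_def
proof (intro conjI allI impI)
  show "T 0 = id" by (simp add: T_def fun_eq_iff)
  fix s t :: real assume "0 \<le> s" "0 \<le> t"
  then consider "s = 0" | "t = 0" | "0 < s" "0 < t" by force
  then show "T (s + t) = T s \<circ> T t"
    by cases (auto simp: T_semigroup_pos fun_eq_iff \<open>T 0 = id\<close>)
qed (simp_all add: T_continuous_clinear T_continuous)

text \<open>The mean value estimate is applied to \<open>T r x - r A x\<close>, whose derivative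
  \<open>T r (A x) - A x\<close> is small near 0.\<close>

lemma T_generator_limit:
  assumes x: "x \<in> domA"
  shows "((\<lambda>h. (T h x - x) /\<^sub>R h) \<longlongrightarrow> A x) (at_right 0)"
proof (rule tendstoI)
  fix e :: real assume "0 < e"
  from tendstoD[OF T_tendsto_0[of "A x"], of "e / 2"] \<open>0 < e\<close>
  obtain \<delta> where \<delta>: "0 < \<delta>" "\<And>r. 0 < r \<Longrightarrow> r < \<delta> \<Longrightarrow> dist (T r (A x)) (A x) < e / 2"
    by (auto simp: eventually_at_right_field)
  have "dist ((T h x - x) /\<^sub>R h) (A x) < e" if h: "0 < h" "h < \<delta>" for h
  proof -
    have "norm ((T h x - h *\<^sub>R A x) - (T 0 x - 0 *\<^sub>R A x)) \<le> e / 2 * (h - 0)"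
    proof (rule vector_mean_value_bound[where f' = "\<lambda>r. T r (A x) - A x"])
      show "continuous_on {0..h} (\<lambda>r. T r x - r *\<^sub>R A x)"
        by (intro continuous_intros continuous_on_subset[OF T_continuous]) auto
      fix r assume r: "0 < r" "r < h"
      show "((\<lambda>r. T r x - r *\<^sub>R A x) has_vector_derivative T r (A x) - A x) (at r)"
        using T_derivative[OF r(1), of x] T1_eq[OF r(1) x]
        by (auto intro!: derivative_eq_intros)
      show "norm (T r (A x) - A x) \<le> e / 2"
        using \<delta>(2)[of r] r h by (simp add: dist_norm)
    qed (use h in auto)
    then have *: "norm (T h x - x - h *\<^sub>R A x) \<le> e / 2 * h"
      by (simp add: T_def algebra_simps)
    have "(T h x - x) /\<^sub>R h - A x = (T h x - x - h *\<^sub>R A x) /\<^sub>R h"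
      using h by (simp add: scaleR_right_diff_distrib)
    then have "norm ((T h x - x) /\<^sub>R h - A x) = norm (T h x - x - h *\<^sub>R A x) / h"
      using h by (simp add: divide_inverse mult.commute)
    also have "\<dots> \<le> e / 2" using * h by (simp add: field_simps)
    finally show ?thesis using \<open>0 < e\<close> by (simp add: dist_norm)
  qed
  then show "\<forall>\<^sub>F h in at_right 0. dist ((T h x - x) /\<^sub>R h) (A x) < e"
    using \<delta>(1) by (auto simp: eventually_at_right_field)
qed

text \<open>The generator is no larger than \<open>A\<close>: for a difference quotient of
  \<open>x\<close> with limit \<open>l\<close>, applying \<open>R 1\<close> gives
  \<open>R 1 l = A y\<close> with \<open>y = R 1 x\<close>, so
  \<open>x = y - A y = y - R 1 l\<close> lies in the domain.\<close>

lemma T_has_generator: "has_generator T domA A"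
  unfolding has_generator_def
proof (intro conjI set_eqI iffI ballI)
  fix x assume "x \<in> {x. \<exists>l. ((\<lambda>h. (T h x - x) /\<^sub>R h) \<longlongrightarrow> l) (at_right 0)}"
  then obtain l where l: "((\<lambda>h. (T h x - x) /\<^sub>R h) \<longlongrightarrow> l) (at_right 0)" by blast
  note R1 = R_clinear[OF one_in_sector]
  have "continuous_clinear (R 1)"
    using R_bound[OF one_in_sector] by (rule bounded_linear_continuous_clinear[OF R1])
  then have R1b: "bounded_linear (R 1)" by (rule continuous_clinear_bounded_linear)
  define y where "y = R 1 x"
  have y: "y \<in> domA" "y - A y = x"
    using R_dom[OF one_in_sector, of x] R_right[OF one_in_sector, of x] by (auto simp: y_def scaleC_one)
  have "R 1 (T h x) = T h y" if "0 < h" for h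
  proof -
    have "T h x = T h y - A (T h y)"
      using T_dom_A[OF that, of y] T1_eq[OF that y(1)] y(2) by (metis clinear_simps(5)[OF T_clinear])
    then show ?thesis
      using R_left[OF one_in_sector T_dom_A(1)[OF that, of y]] by (simp add: scaleC_one)
  qed
  then have "\<forall>\<^sub>F h in at_right 0. R 1 ((T h x - x) /\<^sub>R h) = (T h y - y) /\<^sub>R h"
    by (auto simp: eventually_at_filter clinear_simps[OF R1] y_def)
  with bounded_linear.tendsto[OF R1b l] have "((\<lambda>h. (T h y - y) /\<^sub>R h) \<longlongrightarrow> R 1 l) (at_right 0)"
    by (rule Lim_transform_eventually)
  then have "R 1 l = A y"
    using tendsto_unique[OF _ _ T_generator_limit[OF y(1)]] by simp
  then have "x = y - R 1 l" using y(2) by simp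
  then show "x \<in> domA"
    using y(1) R_dom[OF one_in_sector, of l] csubspace_simps(5)[OF dom] by simp
qed (use T_generator_limit in auto)

end

section \<open>Semigroups of sectorial operators\<close>

text \<open>Here \<open>\<kappa>\<close> is minus the cotangent of an angle \<open>\<theta>'\<close>
  strictly between \<open>pi / 2\<close> and \<open>\<theta>\<close>, so the region is the open
  sector of half-angle \<open>\<theta>'\<close>.\<close>

lemma subset_sector:
  assumes "pi / 2 < \<theta>" "\<theta> \<le> pi"
  obtains \<kappa> where "0 < \<kappa>" "\<And>z. - \<kappa> * \<bar>Im z\<bar> < Re z \<Longrightarrow> z \<in> sector \<theta>"
proof -
  define \<theta>' where "\<theta>' = (pi / 2 + \<theta>) / 2"
  have \<theta>': "pi / 2 < \<theta>'" "\<theta>' < \<theta>" "\<theta>' < pi"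
    using assms by (auto simp: \<theta>'_def)
  have "0 < \<theta>'" using \<theta>'(1) pi_gt_zero by linarith
  then have s: "0 < sin \<theta>'" using \<theta>' by (intro sin_gt_zero)
  have "0 < cos (pi - \<theta>')" using \<theta>' by (intro cos_gt_zero_pi) auto
  then have co: "cos \<theta>' < 0" by simp
  define \<kappa> where "\<kappa> = - cos \<theta>' / sin \<theta>'"
  have "0 < \<kappa>" using s co by (simp add: \<kappa>_def divide_neg_pos)
  moreover have "z \<in> sector \<theta>" if z: "- \<kappa> * \<bar>Im z\<bar> < Re z" for z
  proof -
    have "z \<noteq> 0" using z by auto
    have zeq: "z = of_real (cmod z) * cis (Arg z)"
      using rcis_cmod_Arg[of z] by (simp add: rcis_def)
    have "\<bar>Arg z\<bar> < \<theta>"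
    proof (rule ccontr)
      assume neg: "\<not> ?thesis"
      define \<alpha> where "\<alpha> = \<bar>Arg z\<bar>"
      have \<alpha>: "\<theta> \<le> \<alpha>" "\<alpha> \<le> pi"
        using neg Arg_bounded[of z] by (auto simp: \<alpha>_def)
      have "0 \<le> \<alpha>" by (simp add: \<alpha>_def)
      then have "0 \<le> sin \<alpha>" using \<alpha> by (intro sin_ge_zero)
      have re: "Re z = cmod z * cos \<alpha>"
        by (subst zeq) (auto simp: \<alpha>_def abs_if)
      have "Im z = cmod z * sin (Arg z)" by (subst zeq) simp
      then have "\<bar>Im z\<bar> = cmod z * \<bar>sin (Arg z)\<bar>" by (simp add: abs_mult)
      also have "\<bar>sin (Arg z)\<bar> = \<bar>sin \<alpha>\<bar>" by (auto simp: \<alpha>_def abs_if)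
      finally have im: "\<bar>Im z\<bar> = cmod z * sin \<alpha>" using \<open>0 \<le> sin \<alpha>\<close> by simp
      \<comment> \<open>The bracket has the sign of \<open>- sin (\<alpha> - \<theta>')\<close>, and
        \<open>\<alpha> - \<theta>'\<close> lies strictly between 0 and \<open>pi\<close>.\<close>
      have "0 < (Re z + \<kappa> * \<bar>Im z\<bar>) * sin \<theta>'" using z s by (intro mult_pos_pos) auto
      also have "\<dots> = cmod z * (cos \<alpha> * sin \<theta>' - cos \<theta>' * sin \<alpha>)"
        using s unfolding re im \<kappa>_def by (simp add: field_simps)
      also have "cos \<alpha> * sin \<theta>' - cos \<theta>' * sin \<alpha> = - sin (\<alpha> - \<theta>')"
        by (simp add: sin_diff algebra_simps)
      finally have "sin (\<alpha> - \<theta>') < 0" by (simp add: mult_less_0_iff)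
      moreover have "0 < sin (\<alpha> - \<theta>')"
        using \<alpha> \<theta>' \<open>0 < \<theta>'\<close> by (intro sin_gt_zero) auto
      ultimately show False by simp
    qed
    then show ?thesis
      unfolding sector_def using zeq \<open>z \<noteq> 0\<close>
      by (intro CollectI exI[of _ "cmod z"] exI[of _ "Arg z"]) auto
  qed
  ultimately show thesis by (rule that)
qed

text \<open>In general this follows from strong continuity by uniform boundedness. It is carried as
  a separate property because the contour estimate delivers it directly.\<close>

definition locally_bounded :: "(real \<Rightarrow> 'x::complex_banach \<Rightarrow> 'x) \<Rightarrow> bool"
  where "locally_bounded T \<longleftrightarrow> (\<forall>\<tau>. \<exists>M>0. \<forall>t\<in>{0..\<tau>}. \<forall>x. norm (T t x) \<le> M * norm x)"

text \<open>A product rule at 0. It is used with \<open>\<omega>\<close> to pass from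
  \<open>A - \<omega>\<close> to \<open>A\<close>, and with \<open>- \<omega>\<close> to see that
  the domain has not grown.\<close>

lemma rescaled_generator_limit:
  fixes T :: "real \<Rightarrow> 'x::complex_banach \<Rightarrow> 'x"
  assumes "((\<lambda>h. (T h x - x) /\<^sub>R h) \<longlongrightarrow> l) (at_right 0)"
  shows "((\<lambda>h. (exp (\<omega> * h) *\<^sub>R T h x - x) /\<^sub>R h) \<longlongrightarrow> l + \<omega> *\<^sub>R x) (at_right 0)"
proof -
  have "((\<lambda>h. exp (\<omega> * h)) has_real_derivative \<omega>) (at 0 within {0<..})"
    by (auto intro!: derivative_eq_intros)
  then have "((\<lambda>h. (exp (\<omega> * h) - 1) / h) \<longlongrightarrow> \<omega>) (at_right 0)"
    by (simp add: has_field_derivative_iff)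
  moreover have "((\<lambda>h. exp (\<omega> * h)) \<longlongrightarrow> 1) (at_right 0)"
    by (auto intro!: tendsto_eq_intros)
  ultimately have "((\<lambda>h. exp (\<omega> * h) *\<^sub>R ((T h x - x) /\<^sub>R h) + ((exp (\<omega> * h) - 1) / h) *\<^sub>R x)
      \<longlongrightarrow> 1 *\<^sub>R l + \<omega> *\<^sub>R x) (at_right 0)"
    by (intro tendsto_add tendsto_scaleR assms tendsto_const)
  moreover have "exp (\<omega> * h) *\<^sub>R ((T h x - x) /\<^sub>R h) + ((exp (\<omega> * h) - 1) / h) *\<^sub>R x
      = (exp (\<omega> * h) *\<^sub>R T h x - x) /\<^sub>R h" for h
    by (simp add: algebra_simps divide_inverse)
  ultimately show ?thesis by simp
qed

text \<open>The sector of \<open>A - \<omega>\<close> has its vertex at 0, as the contour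
  construction requires; the factor \<open>exp (\<omega> * t)\<close> returns to \<open>A\<close>.
  The last two conclusions are what compactness at time 1 relies on.\<close>

lemma sectorial_semigroup_exists:
  fixes domA :: "'x::complex_banach set"
  assumes "sectorial domA A"
  obtains S L where "C0_semigroup S" "has_generator S domA A" "locally_bounded S"
    "\<And>x. S 1 x \<in> domA" "\<And>x. norm (A (S 1 x)) \<le> L * norm x"
proof -
  from assms obtain \<theta> \<omega> c where lin: "linear_operator_on domA A" and dense: "closure domA = UNIV"
    and \<theta>: "pi / 2 < \<theta>" "\<theta> \<le> pi" and c: "0 < c"
    and res: "\<And>\<mu>. \<mu> - complex_of_real \<omega> \<in> sector \<theta> \<Longrightarrow>
      \<mu> \<in> resolvent_set domA A \<and> onorm (resolvent domA A \<mu>) \<le> c / cmod (\<mu> - of_real \<omega>)"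
    unfolding sectorial_def by blast
  obtain \<kappa> where \<kappa>: "0 < \<kappa>" and sec: "\<And>z. - \<kappa> * \<bar>Im z\<bar> < Re z \<Longrightarrow> z \<in> sector \<theta>"
    using subset_sector[OF \<theta>] by blast
  define R where "R z = resolvent domA A (of_real \<omega> + z)" for z
  define A' where "A' x = A x - \<omega> *\<^sub>R x" for x
  have bij: "bij_betw (\<lambda>x. (of_real \<omega> + z) *\<^sub>C x - A x) domA UNIV" and cont: "continuous_clinear (R z)"
    and on: "onorm (R z) \<le> c / cmod z" if "- \<kappa> * \<bar>Im z\<bar> < Re z" for z
    using res[of "of_real \<omega> + z"] sec[OF that] by (auto simp: resolvent_set_def R_def)
  have op: "z *\<^sub>C x - A' x = (of_real \<omega> + z) *\<^sub>C x - A x" for z x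
    by (simp add: A'_def scaleC_add_left scaleR_scaleC)
  interpret sectorial_resolvent domA A' R \<kappa> c
  proof
    show "linear_operator_on domA A'"
      using lin unfolding linear_operator_on_def A'_def
      by (auto simp: scaleR_scaleC scaleC_add_right scaleC_scaleC scaleC.diff_right mult.commute)
    fix z x assume z: "- \<kappa> * \<bar>Im z\<bar> < Re z"
    note b = bij[OF z]
    show "R z x \<in> domA"
      unfolding R_def resolvent_def using bij_betw_imp_surj_on[OF b] by (intro inv_into_into) auto
    show "z *\<^sub>C R z x - A' (R z x) = x"
      unfolding op unfolding R_def resolvent_def
      using bij_betw_inv_into_right[OF b, of x] by simp
    show "R z (z *\<^sub>C x - A' x) = x" if "x \<in> domA"
      unfolding op unfolding R_def resolvent_def using bij_betw_inv_into_left[OF b that] by simp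
    show "norm (R z x) \<le> c / cmod z * norm x"
      using onorm[OF continuous_clinear_bounded_linear[OF cont[OF z]], of x]
        mult_right_mono[OF on[OF z], of "norm x"] by simp
  qed fact+
  define S where "S t x = exp (\<omega> * t) *\<^sub>R T t x" for t x
  have S_norm: "norm (S t x) \<le> exp (\<omega> * t) * (M_T * norm x)" for t x
    by (simp add: S_def T_bound)
  have "C0_semigroup S"
    unfolding C0_semigroup_def
  proof (intro conjI allI impI)
    show "S 0 = id" using T_C0_semigroup by (simp add: S_def[abs_def] C0_semigroup_def fun_eq_iff)
    show "continuous_clinear (S t)" for t
    proof (rule bounded_linear_continuous_clinear)
      show "clinear (S t)"
        by (rule clinearI)
          (simp_all add: S_def clinear_simps[OF T_clinear] scaleR_scaleC scaleC_add_right scaleC_scaleC mult.commute)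
      show "norm (S t x) \<le> exp (\<omega> * t) * M_T * norm x" for x using S_norm[of t x] by simp
    qed
    show "S (s + t) = S s \<circ> S t" if "0 \<le> s" "0 \<le> t" for s t
      using T_C0_semigroup that
      by (simp add: S_def[abs_def] C0_semigroup_def fun_eq_iff clinear_simps[OF T_clinear] algebra_simps exp_add)
    show "continuous_on {0..} (\<lambda>t. S t x)" for x
      unfolding S_def by (intro continuous_intros T_continuous)
  qed
  moreover have "has_generator S domA A"
    unfolding has_generator_def
  proof (intro conjI set_eqI iffI ballI)
    have lim: "((\<lambda>h. (S h x - x) /\<^sub>R h) \<longlongrightarrow> A x) (at_right 0)" if "x \<in> domA" for x
      using rescaled_generator_limit[of T x "A' x" \<omega>, OF T_generator_limit[OF that]]
      by (simp add: S_def A'_def)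
    then show "((\<lambda>h. (S h x - x) /\<^sub>R h) \<longlongrightarrow> A x) (at_right 0)"
        "x \<in> {x. \<exists>l. ((\<lambda>h. (S h x - x) /\<^sub>R h) \<longlongrightarrow> l) (at_right 0)}" if "x \<in> domA" for x
      using that by blast+
    fix x assume "x \<in> {x. \<exists>l. ((\<lambda>h. (S h x - x) /\<^sub>R h) \<longlongrightarrow> l) (at_right 0)}"
    then obtain l where "((\<lambda>h. (S h x - x) /\<^sub>R h) \<longlongrightarrow> l) (at_right 0)" by blast
    from rescaled_generator_limit[of S x l "- \<omega>", OF this]
    have "\<exists>l. ((\<lambda>h. (T h x - x) /\<^sub>R h) \<longlongrightarrow> l) (at_right 0)"
      by (auto simp: S_def simp flip: exp_add)
    then show "x \<in> domA" using T_has_generator unfolding has_generator_def by blast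
  qed
  moreover have "locally_bounded S"
    unfolding locally_bounded_def
  proof (intro allI exI conjI ballI)
    fix \<tau> t :: real and x :: 'x assume t: "t \<in> {0..\<tau>}"
    have "exp (\<omega> * t) \<le> exp (\<bar>\<omega>\<bar> * \<tau>)"
      using t mult_mono[of "\<omega>" "\<bar>\<omega>\<bar>" t \<tau>] by simp
    then have "exp (\<omega> * t) * (M_T * norm x) \<le> exp (\<bar>\<omega>\<bar> * \<tau>) * (M_T * norm x)"
      using M_T by (intro mult_right_mono) auto
    then show "norm (S t x) \<le> exp (\<bar>\<omega>\<bar> * \<tau>) * M_T * norm x"
      using S_norm[of t x] by simp
  qed (use M_T in simp)
  moreover have S1: "S 1 x \<in> domA" for x
    unfolding S_def by (intro csubspace_simps[OF dom] T_dom_A) simp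
  moreover have "norm (A (S 1 x)) \<le> exp \<omega> * (M_J * (c + 1) + \<bar>\<omega>\<bar> * M_T) * norm x" for x
  proof -
    have "A (S 1 x) = exp \<omega> *\<^sub>R (T1 1 x + \<omega> *\<^sub>R T 1 x)"
      using A_scaleR[of "T 1 x" "exp \<omega>"] T_dom_A[of 1 x]
      by (simp add: A'_def S_def algebra_simps)
    also have "norm \<dots> \<le> exp \<omega> * (M_J * (c + 1) * norm x + \<bar>\<omega>\<bar> * (M_T * norm x))"
      using T1_bound[of 1 x] T_bound[of 1 x]
      by (auto intro!: norm_triangle_le add_mono mult_left_mono)
    finally show ?thesis by (simp add: algebra_simps)
  qed
  ultimately show thesis by (rule that)
qed

section \<open>Uniqueness of the semigroup generated by an operator\<close>

text \<open>For each slope \<open>e\<close>, the supremum of the times up to which \<open>f\<close>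
  stays in the cone of slope \<open>e\<close> around \<open>f a\<close> must be \<open>b\<close>:
  continuity includes the supremum, and the right derivative pushes beyond it.\<close>

lemma right_derivative_zero_constant:
  fixes f :: "real \<Rightarrow> 'a::real_normed_vector"
  assumes ab: "a \<le> b" and cont: "continuous_on {a..b} f"
    and deriv: "\<And>t. a \<le> t \<Longrightarrow> t < b \<Longrightarrow> (f has_vector_derivative 0) (at t within {t..b})"
  shows "f b = f a"
proof -
  have le: "norm (f b - f a) \<le> e * (b - a)" if e: "0 < e" for e
  proof -
    define S where "S = {t \<in> {a..b}. \<forall>s\<in>{a..t}. norm (f s - f a) \<le> e * (s - a)}"
    have "a \<in> S" using ab by (auto simp: S_def)
    have Sb: "s \<le> b" if "s \<in> S" for s using that by (simp add: S_def)
    have bdd: "bdd_above S" by (rule bdd_aboveI[of _ b]) (rule Sb)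
    define m where "m = Sup S"
    have "S \<noteq> {}" using \<open>a \<in> S\<close> by blast
    have m: "a \<le> m" "m \<le> b"
      unfolding m_def by (rule cSup_upper[OF \<open>a \<in> S\<close> bdd], rule cSup_least[OF \<open>S \<noteq> {}\<close> Sb])
    have below: "norm (f s - f a) \<le> e * (s - a)" if "a \<le> s" "s < m" for s
    proof -
      obtain t where "t \<in> S" "s < t"
        using less_cSup_iff[OF \<open>S \<noteq> {}\<close> bdd, of s] \<open>s < m\<close> unfolding m_def by blast
      then show ?thesis using that by (auto simp: S_def)
    qed
    have at_m: "norm (f m - f a) \<le> e * (m - a)"
    proof (cases "a = m")
      case False
      then have "a < m" using m by simp
      have "continuous_on {a..b} (\<lambda>s. norm (f s - f a) - e * (s - a))"
        by (intro continuous_intros cont)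
      then have "((\<lambda>s. norm (f s - f a) - e * (s - a)) \<longlongrightarrow> norm (f m - f a) - e * (m - a)) (at m within {a..b})"
        using m by (auto simp: continuous_on_def)
      then have "((\<lambda>s. norm (f s - f a) - e * (s - a)) \<longlongrightarrow> norm (f m - f a) - e * (m - a)) (at m within {a..m})"
        by (rule tendsto_within_subset) (use m in auto)
      moreover have "at m within {a..m} = at_left m"
        using \<open>a < m\<close> by (rule at_within_Icc_at_left)
      ultimately have "((\<lambda>s. norm (f s - f a) - e * (s - a)) \<longlongrightarrow> norm (f m - f a) - e * (m - a)) (at_left m)"
        by simp
      moreover have "\<forall>\<^sub>F s in at_left m. norm (f s - f a) - e * (s - a) \<le> 0"
        using eventually_at_left_real[OF \<open>a < m\<close>] by eventually_elim (use below in force)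
      ultimately have "norm (f m - f a) - e * (m - a) \<le> 0"
        by (intro tendsto_upperbound) auto
      then show ?thesis by simp
    qed auto
    have "m = b"
    proof (rule ccontr)
      assume "m \<noteq> b"
      then have "m < b" using m by simp
      from deriv[OF m(1) this] have "((\<lambda>s. (f s - f m) /\<^sub>R (s - m)) \<longlongrightarrow> 0) (at m within {m..b})"
        unfolding has_vector_derivative_iff_quotient .
      from tendstoD[OF this e] obtain d where d: "0 < d"
        "\<And>s. s \<in> {m..b} \<Longrightarrow> s \<noteq> m \<Longrightarrow> dist s m < d \<Longrightarrow> norm ((f s - f m) /\<^sub>R (s - m)) < e"
        unfolding eventually_at by auto
      define t where "t = min b (m + d / 2)"
      have t: "m < t" "t \<le> b" "t - m < d" using \<open>m < b\<close> d(1) by (auto simp: t_def)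
      have "norm (f s - f a) \<le> e * (s - a)" if "a \<le> s" "s \<le> t" for s
      proof (cases "m < s")
        case True
        then have "norm ((f s - f m) /\<^sub>R (s - m)) < e"
          using that t m by (intro d) (auto simp: dist_real_def)
        moreover have "norm ((f s - f m) /\<^sub>R (s - m)) = norm (f s - f m) / (s - m)"
          using True by (simp add: divide_inverse mult.commute)
        ultimately have "norm (f s - f m) \<le> e * (s - m)"
          using True by (simp add: pos_divide_less_eq)
        then have "norm ((f s - f m) + (f m - f a)) \<le> e * (s - m) + e * (m - a)"
          using at_m by (intro norm_triangle_le) simp
        then show ?thesis by (simp add: algebra_simps)
      next
        case False
        then show ?thesis using below at_m that by (cases "s = m") auto
      qed
      then have "t \<in> S" using t m by (auto simp: S_def)
      then have "t \<le> m" unfolding m_def using bdd by (rule cSup_upper)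
      then show False using t by simp
    qed
    then show ?thesis using at_m by simp
  qed
  have "norm (f b - f a) \<le> 0"
  proof (rule field_le_epsilon)
    fix e :: real assume "0 < e"
    \<comment> \<open>The summand 1 keeps the slope defined in the case
      \<open>a = b\<close>.\<close>
    have "e / (b - a + 1) * (b - a) \<le> e"
      using \<open>0 < e\<close> ab by (simp add: field_simps)
    then show "norm (f b - f a) \<le> 0 + e"
      using le[of "e / (b - a + 1)"] \<open>0 < e\<close> ab by simp
  qed
  then show ?thesis by simp
qed

lemma C0_semigroup_simps:
  assumes "C0_semigroup S"
  shows "0 \<le> t \<Longrightarrow> continuous_clinear (S t)" "0 \<le> t \<Longrightarrow> clinear (S t)" "S 0 x = x"
    "0 \<le> s \<Longrightarrow> 0 \<le> t \<Longrightarrow> S (s + t) x = S s (S t x)" "continuous_on {0..} (\<lambda>t. S t x)"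
  using assms by (auto simp: C0_semigroup_def continuous_clinear_def)

lemma generator_limit:
  assumes "has_generator S domA A" "x \<in> domA"
  shows "((\<lambda>h. (S h x - x) /\<^sub>R h) \<longlongrightarrow> A x) (at_right 0)"
  using assms by (auto simp: has_generator_def)

lemma generator_invariant:
  assumes S: "C0_semigroup S" and gen: "has_generator S domA A" and x: "x \<in> domA" and t: "0 \<le> t"
  shows "S t x \<in> domA" and "A (S t x) = S t (A x)"
proof -
  note sg = C0_semigroup_simps[OF S]
  have "bounded_linear (S t)" by (rule continuous_clinear_bounded_linear[OF sg(1)[OF t]])
  from bounded_linear.tendsto[OF this generator_limit[OF gen x]]
  have "((\<lambda>h. S t ((S h x - x) /\<^sub>R h)) \<longlongrightarrow> S t (A x)) (at_right 0)" .
  moreover have "\<forall>\<^sub>F h in at_right 0. S t ((S h x - x) /\<^sub>R h) = (S h (S t x) - S t x) /\<^sub>R h"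
  proof -
    have "S t ((S h x - x) /\<^sub>R h) = (S h (S t x) - S t x) /\<^sub>R h" if "0 < h" for h
      using that t sg(4)[of t h x] sg(4)[of h t x] by (simp add: clinear_simps[OF sg(2)[OF t]] add.commute)
    then show ?thesis by (simp add: eventually_at_filter)
  qed
  ultimately have lim: "((\<lambda>h. (S h (S t x) - S t x) /\<^sub>R h) \<longlongrightarrow> S t (A x)) (at_right 0)"
    by (rule Lim_transform_eventually)
  then show "S t x \<in> domA" using gen unfolding has_generator_def by blast
  from tendsto_unique[OF _ generator_limit[OF gen this] lim] show "A (S t x) = S t (A x)" by simp
qed

lemma semigroup_right_derivative:
  assumes S: "C0_semigroup S" and gen: "has_generator S domA A" and x: "x \<in> domA" and t: "0 \<le> t"
  shows "((\<lambda>t. S t x) has_vector_derivative S t (A x)) (at t within {t..b})"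
  unfolding has_vector_derivative_iff_quotient
proof -
  have inv: "S t x \<in> domA" "A (S t x) = S t (A x)" by (fact generator_invariant[OF assms])+
  have "filterlim (\<lambda>s. s - t) (at_right 0) (at t within {t..b})"
    by (auto simp: filterlim_at eventually_at_filter intro!: tendsto_eq_intros)
  from filterlim_compose[OF generator_limit[OF gen inv(1)] this]
  have "((\<lambda>s. (S (s - t) (S t x) - S t x) /\<^sub>R (s - t)) \<longlongrightarrow> S t (A x)) (at t within {t..b})"
    by (simp add: inv(2))
  moreover have "\<forall>\<^sub>F s in at t within {t..b}. (S (s - t) (S t x) - S t x) /\<^sub>R (s - t) = (S s x - S t x) /\<^sub>R (s - t)"
    using t by (auto simp: eventually_at_filter simp flip: C0_semigroup_simps(4)[OF S])
  ultimately show "((\<lambda>s. (S s x - S t x) /\<^sub>R (s - t)) \<longlongrightarrow> S t (A x)) (at t within {t..b})"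
    by (rule Lim_transform_eventually)
qed

text \<open>Both one-sided derivatives are treated at once: the quotient between \<open>s\<close>
  and \<open>t\<close> is \<open>S (min s t)\<close> applied to the quotient at 0 with increment
  \<open>|s - t|\<close>. For \<open>s < t\<close> the operator moves, and the local bound controls
  it.\<close>

lemma semigroup_derivative:
  assumes S: "C0_semigroup S" and gen: "has_generator S domA A" and lb: "locally_bounded S"
    and x: "x \<in> domA" and t: "0 \<le> t"
  shows "((\<lambda>t. S t x) has_vector_derivative S t (A x)) (at t within {0..})"
  unfolding has_vector_derivative_iff_quotient
proof -
  note sg = C0_semigroup_simps[OF S]
  define q where "q h = (S h x - x) /\<^sub>R h" for h
  obtain M where M: "0 < M" "\<And>s v. 0 \<le> s \<Longrightarrow> s \<le> t \<Longrightarrow> norm (S s v) \<le> M * norm v"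
    using lb unfolding locally_bounded_def by (metis atLeastAtMost_iff)
  have "filterlim (\<lambda>s. \<bar>s - t\<bar>) (at_right 0) (at t within {0..})"
    by (auto simp: filterlim_at eventually_at_filter intro!: tendsto_eq_intros)
  from filterlim_compose[OF generator_limit[OF gen x] this]
  have "((\<lambda>s. q \<bar>s - t\<bar>) \<longlongrightarrow> A x) (at t within {0..})" by (simp add: q_def)
  then have "((\<lambda>s. norm (q \<bar>s - t\<bar> - A x)) \<longlongrightarrow> 0) (at t within {0..})"
    by (intro tendsto_norm_zero LIM_zero)
  from tendsto_mult_right_zero[OF this, of M]
  have 1: "((\<lambda>s. S (min s t) (q \<bar>s - t\<bar> - A x)) \<longlongrightarrow> 0) (at t within {0..})"
    by (rule Lim_null_comparison[rotated]) (use t M(2) in \<open>auto simp: eventually_at_filter\<close>)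
  have 2: "((\<lambda>s. S (min s t) (A x)) \<longlongrightarrow> S t (A x)) (at t within {0..})"
  proof -
    have "continuous_on {0..} (\<lambda>s. S (min s t) (A x))"
      by (rule continuous_on_compose2[OF sg(5)[of "A x"]]) (use t in \<open>auto intro!: continuous_intros\<close>)
    from this[unfolded continuous_on_def, rule_format, of t] show ?thesis using t by simp
  qed
  have "((\<lambda>s. S (min s t) (q \<bar>s - t\<bar> - A x) + S (min s t) (A x)) \<longlongrightarrow> 0 + S t (A x)) (at t within {0..})"
    by (intro tendsto_add 1 2)
  moreover have "S (min s t) (q \<bar>s - t\<bar> - A x) + S (min s t) (A x) = (S s x - S t x) /\<^sub>R (s - t)"
    if s: "0 \<le> s" "s \<noteq> t" for s
  proof -
    have m: "0 \<le> min s t" using s t by simp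
    have "S (min s t) (q \<bar>s - t\<bar> - A x) + S (min s t) (A x) = S (min s t) (q \<bar>s - t\<bar>)"
      by (simp add: clinear_simps[OF sg(2)[OF m]])
    also have "\<dots> = (S (min s t + \<bar>s - t\<bar>) x - S (min s t) x) /\<^sub>R \<bar>s - t\<bar>"
      using m by (simp add: q_def clinear_simps[OF sg(2)[OF m]] sg(4))
    also have "\<dots> = (S s x - S t x) /\<^sub>R (s - t)"
    proof (cases "s < t")
      case True
      then have "(S (min s t + \<bar>s - t\<bar>) x - S (min s t) x) /\<^sub>R \<bar>s - t\<bar> = (S t x - S s x) /\<^sub>R (t - s)"
        by simp
      also have "\<dots> = (- (S t x - S s x)) /\<^sub>R (- (t - s))" by (simp only: inverse_minus_eq scaleR_minus_left scaleR_minus_right minus_minus)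
      finally show ?thesis by simp
    qed (use s in auto)
    finally show ?thesis .
  qed
  then have "\<forall>\<^sub>F s in at t within {0..}. S (min s t) (q \<bar>s - t\<bar> - A x) + S (min s t) (A x) = (S s x - S t x) /\<^sub>R (s - t)"
    by (simp add: eventually_at_filter)
  ultimately show "((\<lambda>s. (S s x - S t x) /\<^sub>R (s - t)) \<longlongrightarrow> S t (A x)) (at t within {0..})"
    using Lim_transform_eventually by fastforce
qed

text \<open>No local bound is assumed for \<open>T\<close>; hence only right derivatives of its orbits are available.\<close>

lemma semigroup_unique:
  fixes S T :: "real \<Rightarrow> 'x::complex_banach \<Rightarrow> 'x"
  assumes S: "C0_semigroup S" "has_generator S domA A" "locally_bounded S"
    and T: "C0_semigroup T" "has_generator T domA A"
    and dense: "closure domA = UNIV" and t: "0 \<le> t"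
  shows "T t x = S t x"
proof -
  note sS = C0_semigroup_simps[OF S(1)] and sT = C0_semigroup_simps[OF T(1)]
  obtain M where M: "0 < M" "\<And>s v. 0 \<le> s \<Longrightarrow> s \<le> t \<Longrightarrow> norm (S s v) \<le> M * norm v"
    using S(3) unfolding locally_bounded_def by (metis atLeastAtMost_iff)
  have on_dom: "T t x = S t x" if x: "x \<in> domA" for x
  proof -
    \<comment> \<open>The ends of \<open>r \<mapsto> S (t - r) (T r x)\<close> are the two sides of
      the claim, so it suffices that this function is constant.\<close>
    have "S (t - t) (T t x) = S (t - 0) (T 0 x)"
    proof (rule right_derivative_zero_constant[OF t, of "\<lambda>r. S (t - r) (T r x)"])
      show "continuous_on {0..t} (\<lambda>r. S (t - r) (T r x))"
      proof (rule continuous_on_operator_family[where M = M and S = "\<lambda>r. S (t - r)" and x = "\<lambda>r. T r x"])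
        show "continuous_on {0..t} (\<lambda>r. S (t - r) y)" for y
          by (rule continuous_on_compose2[OF sS(5)[of y]]) (auto intro!: continuous_intros)
        show "continuous_on {0..t} (\<lambda>r. T r x)"
          by (rule continuous_on_subset[OF sT(5)]) auto
      qed (use M sS(2) in auto)
      fix s assume s: "0 \<le> s" "s < t"
      have inv: "T s x \<in> domA" "A (T s x) = T s (A x)" by (fact generator_invariant[OF T x s(1)])+
      have D: "((\<lambda>r. S (t - r) y) has_vector_derivative - S (t - s) (A y)) (at s within {s..t})"
        if y: "y \<in> domA" for y
        by (rule has_vector_derivative_reflect[OF semigroup_derivative[OF S y]]) (use s in auto)
      have "((\<lambda>r. S (t - r) (T r x)) has_vector_derivative (- S (t - s) (A (T s x)) + S (t - s) (T s (A x))))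
          (at s within {s..t})"
      proof (rule has_vector_derivative_operator_family
          [where M = M and S = "\<lambda>r. S (t - r)" and x = "\<lambda>r. T r x" and x' = "T s (A x)"])
        show "((\<lambda>r. T r x) has_vector_derivative T s (A x)) (at s within {s..t})"
          by (rule semigroup_right_derivative[OF T x s(1)])
        show "((\<lambda>r. S (t - r) (T s x)) has_vector_derivative - S (t - s) (A (T s x))) (at s within {s..t})"
          by (rule D[OF inv(1)])
        have "continuous_on {s..t} (\<lambda>r. S (t - r) (T s (A x)))"
          by (rule continuous_on_compose2[OF sS(5)]) (auto intro!: continuous_intros)
        then show "((\<lambda>r. S (t - r) (T s (A x))) \<longlongrightarrow> S (t - s) (T s (A x))) (at s within {s..t})"
          using s by (auto simp: continuous_on_def)
      qed (use s M sS(2) in auto)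
      then show "((\<lambda>r. S (t - r) (T r x)) has_vector_derivative 0) (at s within {s..t})"
        by (simp add: inv)
    qed
    then show ?thesis by (simp add: sS sT)
  qed
  have "continuous_on UNIV (T t)" "continuous_on UNIV (S t)"
    using sS(1)[OF t] sT(1)[OF t] by (auto simp: continuous_clinear_def)
  then have "closed {x. T t x = S t x}" by (intro closed_Collect_eq)
  then have "closure domA \<subseteq> {x. T t x = S t x}" using on_dom by (intro closure_minimal) auto
  then show ?thesis using dense by auto
qed

text \<open>Existence justifies the choice behind \<open>exp_semigroup\<close>, and uniqueness hands
  over the properties of the constructed semigroup.\<close>

lemma exp_semigroup:
  assumes "sectorial domA A"
  shows "C0_semigroup (exp_semigroup domA A)" "has_generator (exp_semigroup domA A) domA A"
    "locally_bounded (exp_semigroup domA A)" "exp_semigroup domA A 1 x \<in> domA"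
    "\<exists>L. \<forall>x. norm (A (exp_semigroup domA A 1 x)) \<le> L * norm x"
proof -
  let ?T = "exp_semigroup domA A"
  obtain S L where S: "C0_semigroup S" "has_generator S domA A" "locally_bounded S"
    and S1: "\<And>x. S 1 x \<in> domA" "\<And>x. norm (A (S 1 x)) \<le> L * norm x"
    using sectorial_semigroup_exists[OF assms] by blast
  have "C0_semigroup ?T \<and> has_generator ?T domA A"
    unfolding exp_semigroup_def by (rule someI[of _ S]) (use S in blast)
  then show T: "C0_semigroup ?T" "has_generator ?T domA A" by auto
  have "closure domA = UNIV" using assms by (auto simp: sectorial_def)
  then have eq: "?T t x = S t x" if "0 \<le> t" for t x
    using semigroup_unique[OF S T] that by blast
  show "locally_bounded ?T"
    using S(3) unfolding locally_bounded_def by (auto simp: eq)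
  show "?T 1 x \<in> domA" "\<exists>L. \<forall>x. norm (A (?T 1 x)) \<le> L * norm x"
    using S1 by (auto simp: eq)
qed

section \<open>Compactness at time 1\<close>

lemma sectorial_resolvent_set_nonempty:
  assumes "sectorial domA A"
  obtains \<mu> where "\<mu> \<in> resolvent_set domA A"
proof -
  from assms obtain \<theta> \<omega> where \<theta>: "pi / 2 < \<theta>"
    and res: "\<And>\<mu>. \<mu> - complex_of_real \<omega> \<in> sector \<theta> \<Longrightarrow> \<mu> \<in> resolvent_set domA A"
    unfolding sectorial_def by blast
  have "0 < \<theta>" using \<theta> pi_gt_zero by linarith
  then have "1 \<in> sector \<theta>"
    unfolding sector_def by (intro CollectI exI[of _ 1] exI[of _ 0]) auto
  then show thesis using res[of "of_real \<omega> + 1"] that by simp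
qed

lemma resolvent_inverse:
  assumes "\<mu> \<in> resolvent_set domA A"
  shows "resolvent domA A \<mu> x \<in> domA"
    and "\<mu> *\<^sub>C resolvent domA A \<mu> x - A (resolvent domA A \<mu> x) = x"
    and "y \<in> domA \<Longrightarrow> resolvent domA A \<mu> (\<mu> *\<^sub>C y - A y) = y"
    and "continuous_clinear (resolvent domA A \<mu>)"
proof -
  have b: "bij_betw (\<lambda>x. \<mu> *\<^sub>C x - A x) domA UNIV" and c: "continuous_clinear (resolvent domA A \<mu>)"
    using assms by (auto simp: resolvent_set_def)
  show "resolvent domA A \<mu> x \<in> domA"
    unfolding resolvent_def using bij_betw_imp_surj_on[OF b] by (intro inv_into_into) auto
  show "\<mu> *\<^sub>C resolvent domA A \<mu> x - A (resolvent domA A \<mu> x) = x"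
    unfolding resolvent_def using bij_betw_inv_into_right[OF b, of x] by simp
  show "resolvent domA A \<mu> (\<mu> *\<^sub>C y - A y) = y" if "y \<in> domA"
    unfolding resolvent_def using bij_betw_inv_into_left[OF b that] by simp
qed (use assms in \<open>simp add: resolvent_set_def\<close>)

lemma exp_semigroup_compact:
  assumes sec: "sectorial domA A" and comp: "compact_resolvent domA A"
  shows "compact_operator (exp_semigroup domA A 1)"
proof -
  let ?T = "exp_semigroup domA A"
  note T = exp_semigroup[OF sec]
  obtain \<mu> where \<mu>: "\<mu> \<in> resolvent_set domA A" using sectorial_resolvent_set_nonempty[OF sec] .
  define R where "R = resolvent domA A \<mu>"
  note R = resolvent_inverse[OF \<mu>, folded R_def]
  have Rcomp: "compact (closure (R ` cball 0 1))"
    using comp \<mu> by (auto simp: compact_resolvent_def compact_operator_def R_def)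
  obtain L where L: "\<And>x. norm (A (?T 1 x)) \<le> L * norm x" using T(5) by blast
  have T1: "continuous_clinear (?T 1)" by (rule C0_semigroup_simps(1)[OF T(1)]) simp
  obtain M where M: "M > 0" "\<And>x. norm (?T 1 x) \<le> M * norm x"
    using continuous_clinear_bound[OF T1] by blast
  \<comment> \<open>This is \<open>(\<mu> - A)\<close> after the semigroup at time 1; it is bounded,
    and applying the compact resolvent to it recovers the semigroup.\<close>
  define V where "V x = \<mu> *\<^sub>C ?T 1 x - A (?T 1 x)" for x
  \<comment> \<open>The summand 1 makes \<open>B\<close> positive, so that \<open>V x\<close> can be
    scaled into the unit ball.\<close>
  define B where "B = cmod \<mu> * M + \<bar>L\<bar> + 1"
  have "0 \<le> cmod \<mu> * M" using M(1) by simp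
  then have "0 < B" by (simp add: B_def)
  have V: "norm (V x) \<le> B" if "norm x \<le> 1" for x
  proof -
    have "cmod \<mu> * norm (?T 1 x) \<le> cmod \<mu> * M"
      using order_trans[OF M(2) mult_left_mono[OF that less_imp_le[OF M(1)]]] by (intro mult_left_mono) auto
    moreover have "norm (A (?T 1 x)) \<le> \<bar>L\<bar>"
      using L[of x] mult_right_mono[OF abs_ge_self[of L], of "norm x"] mult_left_mono[OF that, of "\<bar>L\<bar>"]
      by simp
    ultimately show ?thesis
      using norm_triangle_ineq4[of "\<mu> *\<^sub>C ?T 1 x" "A (?T 1 x)"] by (simp add: V_def B_def norm_scaleC)
  qed
  let ?K = "(\<lambda>y. B *\<^sub>R y) ` closure (R ` cball 0 1)"
  have "compact ?K" using Rcomp by (rule compact_scaling)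
  have "?T 1 ` cball 0 1 \<subseteq> ?K"
  proof
    fix y assume "y \<in> ?T 1 ` cball 0 1"
    then obtain x where x: "norm x \<le> 1" "y = ?T 1 x" by auto
    have "R (V x) = y" using R(3)[OF T(4)] by (simp add: V_def x(2))
    moreover have "R (V x) = B *\<^sub>R R (V x /\<^sub>R B)"
      using R(4) \<open>0 < B\<close> by (simp add: clinear_simps continuous_clinear_def)
    moreover have "R (V x /\<^sub>R B) \<in> closure (R ` cball 0 1)"
      using V[OF x(1)] \<open>0 < B\<close> by (intro set_mp[OF closure_subset] imageI) (simp add: field_simps)
    ultimately show "y \<in> ?K" by (metis imageI)
  qed
  then have "closure (?T 1 ` cball 0 1) \<subseteq> ?K"
    using \<open>compact ?K\<close> by (intro closure_minimal compact_imp_closed)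
  then have "compact (closure (?T 1 ` cball 0 1))"
    using closed_Int_compact[OF closed_closure \<open>compact ?K\<close>, of "?T 1 ` cball 0 1"]
    by (simp add: inf.absorb1)
  with T1 show ?thesis by (simp add: compact_operator_def)
qed

section \<open>Generalized eigenvectors of the semigroup and of its generator\<close>

lemma linear_operator_on_simps:
  assumes "linear_operator_on domA A"
  shows "csubspace domA" "x \<in> domA \<Longrightarrow> y \<in> domA \<Longrightarrow> A (x + y) = A x + A y"
    "x \<in> domA \<Longrightarrow> A (a *\<^sub>C x) = a *\<^sub>C A x" "A 0 = 0"
    "x \<in> domA \<Longrightarrow> y \<in> domA \<Longrightarrow> A (x - y) = A x - A y"
proof -
  show *: "csubspace domA" "\<And>x y. x \<in> domA \<Longrightarrow> y \<in> domA \<Longrightarrow> A (x + y) = A x + A y"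
    "\<And>x a. x \<in> domA \<Longrightarrow> A (a *\<^sub>C x) = a *\<^sub>C A x"
    using assms by (auto simp: linear_operator_on_def)
  show "A 0 = 0" using *(3)[OF csubspace_simps(1)[OF *(1)], of 0] by simp
  show "A (x - y) = A x - A y" if "x \<in> domA" "y \<in> domA"
    using *(2)[of x "- 1 *\<^sub>C y"] *(3)[of y "- 1"] csubspace_simps(3)[OF *(1), of y "- 1"] that
    by (simp add: scaleC_one)
qed

locale compact_semigroup =
  fixes domA :: "'x::complex_banach set" and A :: "'x \<Rightarrow> 'x" and T :: "real \<Rightarrow> 'x \<Rightarrow> 'x"
  assumes semigroup: "C0_semigroup T" and generator: "has_generator T domA A"
    and bounded: "locally_bounded T" and A_lin: "linear_operator_on domA A"
    and T1_dom: "\<And>x. T 1 x \<in> domA" and T1_compact: "compact_operator (T 1)"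
begin

lemmas T_simps = C0_semigroup_simps[OF semigroup]
lemmas A_simps = linear_operator_on_simps[OF A_lin]
lemmas T_deriv = semigroup_derivative[OF semigroup generator bounded]
lemmas T_invariant = generator_invariant[OF semigroup generator]
lemmas T1_lin = T_simps(2)[OF zero_le_one]

text \<open>The derivative only involves \<open>A u - \<mu> u\<close>. It vanishes for an
  eigenvector, and it stays in an invariant subspace if \<open>u\<close> is an eigenvector modulo
  that subspace.\<close>

lemma rescaled_orbit_derivative:
  assumes "u \<in> domA" "0 \<le> t"
  shows "((\<lambda>t. exp (- (of_real t * \<mu>)) *\<^sub>C T t u) has_vector_derivative
    exp (- (of_real t * \<mu>)) *\<^sub>C T t (A u - \<mu> *\<^sub>C u)) (at t within {0..})"
proof -
  have "((\<lambda>t. exp (- (of_real t * \<mu>))) has_vector_derivative - \<mu> * exp (- (of_real t * \<mu>))) (at t within {0..})"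
    by (rule has_vector_derivative_real_field) (auto intro!: derivative_eq_intros)
  from scaleC.has_vector_derivative[OF this T_deriv[OF assms]]
  show ?thesis
    by (simp add: clinear_simps[OF T_simps(2)[OF assms(2)]] scaleC.diff_right scaleC_scaleC mult.commute)
qed

lemma T_eigenvector:
  assumes u: "u \<in> domA" "A u = \<mu> *\<^sub>C u" and t: "0 \<le> t"
  shows "T t u = exp (of_real t * \<mu>) *\<^sub>C u"
proof -
  have "((\<lambda>t. exp (- (of_real t * \<mu>)) *\<^sub>C T t u) has_vector_derivative 0) (at s within {0..})" if "s \<in> {0..}" for s
    using rescaled_orbit_derivative[OF u(1), of s \<mu>] that by (simp add: u(2) clinear_simps[OF T_simps(2)])
  then obtain c where "\<And>s. s \<in> {0..} \<Longrightarrow> exp (- (of_real s * \<mu>)) *\<^sub>C T s u = c"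
    using has_vector_derivative_zero_constant[of "{0..}" "\<lambda>t. exp (- (of_real t * \<mu>)) *\<^sub>C T t u"] by auto
  from this[of t] this[of 0] t have "exp (- (of_real t * \<mu>)) *\<^sub>C T t u = u"
    by (simp add: T_simps scaleC_one)
  then have "exp (of_real t * \<mu>) *\<^sub>C exp (- (of_real t * \<mu>)) *\<^sub>C T t u = exp (of_real t * \<mu>) *\<^sub>C u" by simp
  then show ?thesis by (simp add: scaleC_scaleC scaleC_one flip: exp_add)
qed

context
  fixes c :: complex and m :: nat
  assumes c: "c \<noteq> 0"
begin

private definition S where "S x = c *\<^sub>C x - T 1 x"

private lemma S_lin: "clinear S"
  by (rule clinearI)
    (simp_all add: S_def clinear_simps[OF T1_lin] scaleC_add_right scaleC_scaleC mult.commute scaleC.diff_right)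

private lemma Sn_lin: "clinear (S ^^ n)"
proof (induction n)
  case 0
  show ?case by (rule clinearI) auto
next
  case (Suc n)
  show ?case by (rule clinearI) (simp_all add: clinear_simps[OF S_lin] clinear_simps[OF Suc])
qed

text \<open>The generalized eigenspace of \<open>T 1\<close> at \<open>c\<close>, of order at most
  \<open>m\<close>.\<close>

private definition G where "G = {v. (S ^^ m) v = 0}"

private lemma G_csubspace: "csubspace G"
  unfolding complex_vector.subspace_def G_def by (auto simp: clinear_simps[OF Sn_lin])

text \<open>In \<open>c v = S v + T 1 v\<close>, the last term lies in the domain by smoothing and
  \<open>S v\<close> by induction on the order.\<close>

private lemma G_dom: "v \<in> domA" if "v \<in> G"
proof -
  have "v \<in> domA" if "(S ^^ n) v = 0" for n v
    using that
  proof (induction n arbitrary: v)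
    case 0
    then show ?case using csubspace_simps(1)[OF A_simps(1)] by simp
  next
    case (Suc n)
    then have "S v \<in> domA" by (metis funpow_Suc_right o_apply)
    then have "inverse c *\<^sub>C (S v + T 1 v) \<in> domA"
      using T1_dom by (intro csubspace_simps[OF A_simps(1)])
    then show ?case using c by (simp add: S_def scaleC_scaleC scaleC_one)
  qed
  with that show ?thesis by (auto simp: G_def)
qed

text \<open>The operator \<open>T 1\<close>, hence every power of \<open>S\<close>, commutes with
  \<open>A\<close> on the domain.\<close>

private lemma A_G: "A v \<in> G" if "v \<in> G"
proof -
  have S_dom: "S x \<in> domA" if "x \<in> domA" for x
    unfolding S_def using that T1_dom by (intro csubspace_simps[OF A_simps(1)])
  have S_A: "S (A x) = A (S x)" if "x \<in> domA" for x
    using that T_invariant[OF that, of 1] by (simp add: S_def A_simps csubspace_simps[OF A_simps(1)])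
  have "(S ^^ n) x \<in> domA \<and> (S ^^ n) (A x) = A ((S ^^ n) x)" if "x \<in> domA" for n x
    by (induction n) (use that S_dom S_A in auto)
  from this[OF G_dom[OF that], of m] that show ?thesis by (simp add: G_def A_simps)
qed

private lemma An_G: "(A ^^ n) v \<in> G" if "v \<in> G"
  by (induction n) (use that A_G in auto)

private lemma An_linear:
  assumes "v \<in> G" "w \<in> G"
  shows "(A ^^ n) (v - w) = (A ^^ n) v - (A ^^ n) w" "(A ^^ n) (a *\<^sub>C v) = a *\<^sub>C (A ^^ n) v"
  by (induction n) (simp_all add: A_simps G_dom[OF An_G] assms)

text \<open>Such a \<open>u\<close> is an eigenvector of \<open>T 1\<close> for
  \<open>exp z\<close>, so \<open>S ^^ m\<close> multiplies it by the nonzero number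
  \<open>(c - exp z) ^ m\<close>.\<close>

private lemma G_eigenvector:
  assumes u: "u \<in> G" "A u = z *\<^sub>C u" "exp z \<noteq> c"
  shows "u = 0"
proof -
  have "S u = (c - exp z) *\<^sub>C u"
    using T_eigenvector[OF G_dom[OF u(1)] u(2), of 1] by (simp add: S_def scaleC.diff_left)
  then have "(S ^^ n) u = (c - exp z) ^ n *\<^sub>C u" for n
    by (induction n) (simp_all add: clinear_simps[OF S_lin] scaleC_scaleC scaleC_one mult.commute)
  then have "(c - exp z) ^ m *\<^sub>C u = 0" using u(1) by (simp add: G_def)
  then have "inverse ((c - exp z) ^ m) *\<^sub>C (c - exp z) ^ m *\<^sub>C u = 0" by simp
  then show ?thesis using u(3) by (simp add: scaleC_scaleC scaleC_one)
qed

section \<open>Polynomials in the generator on a generalized eigenspace\<close>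

text \<open>This is \<open>p(A) v\<close>, meaningful on \<open>G\<close> because \<open>A\<close>
  maps \<open>G\<close> into itself.\<close>

private definition P where "P p v = (\<Sum>i\<le>degree p. coeff p i *\<^sub>C (A ^^ i) v)"

private lemma P_G: "P p v \<in> G" if "v \<in> G"
  unfolding P_def using that G_csubspace An_G
  by (intro complex_vector.subspace_sum) (auto intro: csubspace_simps)

private lemma A_sum:
  assumes "\<And>i. i \<in> I \<Longrightarrow> f i \<in> domA"
  shows "A (sum f I) = (\<Sum>i\<in>I. A (f i))"
  using assms
proof (induction I rule: infinite_finite_induct)
  case (insert i I)
  moreover have "sum f I \<in> domA" using insert.prems A_simps(1) by (intro complex_vector.subspace_sum) auto
  ultimately show ?case by (simp add: A_simps)
qed (simp_all add: A_simps)

text \<open>A linear factor is split off on either side. Acting before \<open>q(A)\<close> it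
  becomes the head of the list; acting after \<open>q(A)\<close> it makes \<open>P q v\<close> an
  eigenvector of \<open>A\<close> as soon as \<open>P p v = 0\<close>.\<close>

private lemma P_factor:
  assumes v: "v \<in> G" and p: "p = [:- z, 1:] * q" "q \<noteq> 0"
  shows "P p v = P q (A v - z *\<^sub>C v)" "P p v = A (P q v) - z *\<^sub>C P q v"
proof -
  let ?d = "degree q"
  have deg: "degree p = Suc ?d" unfolding p(1) using p(2) by (subst degree_mult_eq) auto
  have co: "coeff p i = coeff (pCons 0 q) i - z * coeff q i" for i by (simp add: p(1))
  have "P p v = (\<Sum>i\<le>Suc ?d. (coeff (pCons 0 q) i - z * coeff q i) *\<^sub>C (A ^^ i) v)"
    unfolding P_def deg co ..
  also have "\<dots> = (\<Sum>i\<le>Suc ?d. coeff (pCons 0 q) i *\<^sub>C (A ^^ i) v)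
      - z *\<^sub>C (\<Sum>i\<le>Suc ?d. coeff q i *\<^sub>C (A ^^ i) v)"
    by (simp only: scaleC.diff_left sum_subtractf scaleC.sum_right scaleC_scaleC)
  also have "(\<Sum>i\<le>Suc ?d. coeff (pCons 0 q) i *\<^sub>C (A ^^ i) v) = (\<Sum>i\<le>?d. coeff q i *\<^sub>C (A ^^ Suc i) v)"
    unfolding sum.atMost_Suc_shift by simp
  also have "(\<Sum>i\<le>Suc ?d. coeff q i *\<^sub>C (A ^^ i) v) = P q v"
    by (simp add: P_def coeff_eq_0)
  finally have eq: "P p v = (\<Sum>i\<le>?d. coeff q i *\<^sub>C (A ^^ Suc i) v) - z *\<^sub>C P q v" .
  have An: "(A ^^ Suc i) v = (A ^^ i) (A v)" for i by (simp only: funpow_Suc_right o_apply)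
  have "P q (A v - z *\<^sub>C v) = (\<Sum>i\<le>?d. coeff q i *\<^sub>C (A ^^ Suc i) v - z *\<^sub>C coeff q i *\<^sub>C (A ^^ i) v)"
    unfolding P_def An
    by (rule sum.cong)
      (simp_all add: An_linear(1) An_linear(2)[OF v v] v A_G csubspace_simps[OF G_csubspace]
        scaleC.diff_right scaleC_scaleC mult.commute)
  then show "P p v = P q (A v - z *\<^sub>C v)"
    unfolding eq by (simp add: sum_subtractf P_def scaleC.sum_right)
  have "A (P q v) = (\<Sum>i\<le>?d. A (coeff q i *\<^sub>C (A ^^ i) v))"
    unfolding P_def by (rule A_sum) (auto intro: csubspace_simps[OF A_simps(1)] G_dom An_G v)
  also have "\<dots> = (\<Sum>i\<le>?d. coeff q i *\<^sub>C (A ^^ Suc i) v)"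
    by (rule sum.cong) (simp_all add: A_simps G_dom An_G v)
  finally show "P p v = A (P q v) - z *\<^sub>C P q v" unfolding eq by simp
qed

text \<open>Factors \<open>z - A\<close> with \<open>exp z \<noteq> c\<close> are injective on \<open>G\<close> and can be dropped.\<close>

private lemma annihilating_product:
  assumes "p \<noteq> 0" "v \<in> G" "P p v = 0"
  shows "\<exists>ms. set ms \<subseteq> log_set c \<and> in_prod_dom domA A ms v \<and> prod_apply A ms v = 0"
  using assms
proof (induction "degree p" arbitrary: p v)
  case 0
  then obtain a where "p = [:a:]" "a \<noteq> 0" by (metis degree_eq_zeroE pCons_0_0)
  then have "inverse a *\<^sub>C a *\<^sub>C v = 0" using 0 by (simp add: P_def)
  then have "v = 0" using \<open>a \<noteq> 0\<close> by (simp add: scaleC_scaleC scaleC_one)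
  then show ?case by (intro exI[of _ "[]"]) auto
next
  case (Suc d)
  have "degree p \<in> {1..degree p} \<and> coeff p (degree p) \<noteq> 0"
    using Suc.hyps(2) Suc.prems(1) by auto
  then obtain z where "(\<Sum>i\<le>degree p. coeff p i * z ^ i) = 0"
    using fundamental_theorem_of_algebra[of "coeff p" "degree p"] by blast
  then have "poly p z = 0" by (simp add: poly_altdef)
  then obtain q where p: "p = [:- z, 1:] * q" by (auto simp: poly_eq_0_iff_dvd elim: dvdE)
  then have q: "q \<noteq> 0" using Suc.prems(1) by auto
  then have "d = degree q"
    using Suc.hyps(2) unfolding p by (subst (asm) degree_mult_eq) auto
  note IH = Suc.hyps(1)[OF this q]
  show ?case
  proof (cases "exp z = c")
    case True
    let ?w = "z *\<^sub>C v - A v"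
    have w: "?w \<in> G" "A v - z *\<^sub>C v \<in> G" using Suc.prems(2) A_G by (auto intro!: csubspace_simps[OF G_csubspace])
    \<comment> \<open>The factor theorem speaks of \<open>A - z\<close>, the product in (b) of
      \<open>z - A\<close>; the sign is harmless by linearity.\<close>
    have "?w = (- 1) *\<^sub>C (A v - z *\<^sub>C v)" by (simp add: scaleC_one)
    then have "P q ?w = (- 1) *\<^sub>C P q (A v - z *\<^sub>C v)"
      unfolding P_def scaleC.sum_right using An_linear(2)[OF w(2) w(2)]
      by (simp only: scaleC_scaleC mult.commute)
    then have "P q ?w = 0" using P_factor(1)[OF Suc.prems(2) p q] Suc.prems(3) by simp
    then obtain ms where "set ms \<subseteq> log_set c" "in_prod_dom domA A ms ?w" "prod_apply A ms ?w = 0"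
      using IH[OF w(1)] by blast
    then show ?thesis
      using True G_dom[OF Suc.prems(2)] by (intro exI[of _ "z # ms"]) (auto simp: log_set_def)
  next
    case False
    have "A (P q v) = z *\<^sub>C P q v" using P_factor(2)[OF Suc.prems(2) p q] Suc.prems(3) by simp
    then have "P q v = 0" using G_eigenvector[OF P_G[OF Suc.prems(2)]] False by blast
    then show ?thesis by (rule IH[OF Suc.prems(2)])
  qed
qed

text \<open>The iterates \<open>A ^^ n\<close> of \<open>v\<close> stay in the locally compact space
  \<open>G\<close>, so one depends linearly on its predecessors. The coefficients form a monic
  polynomial \<open>p\<close> with \<open>p(A) v = 0\<close>.\<close>

lemma gen_eigenvector_annihilated:
  assumes "((\<lambda>x. c *\<^sub>C x - T 1 x) ^^ m) v = 0"
  shows "\<exists>ms. set ms \<subseteq> log_set c \<and> in_prod_dom domA A ms v \<and> prod_apply A ms v = 0"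
proof -
  have Seq: "(\<lambda>x. c *\<^sub>C x - T 1 x) = S" by (simp add: S_def fun_eq_iff)
  have v: "v \<in> G" using assms by (simp add: G_def Seq)
  obtain n a where a: "(A ^^ n) v = (\<Sum>i<n. a i *\<^sub>C (A ^^ i) v)"
  proof (rule linearly_dependent_if_locally_compact[OF G_csubspace An_G[OF v]])
    fix x :: "nat \<Rightarrow> 'x" and M
    assume "\<And>n. x n \<in> G" "\<And>n. norm (x n) \<le> M"
    then show "\<exists>r l. strict_mono r \<and> (\<lambda>n. x (r n)) \<longlonglongrightarrow> l"
      using gen_eigenspace_subseq[OF T1_compact c, of m x M] unfolding Seq G_def by blast
  qed
  define p where "p = monom 1 n - (\<Sum>i<n. monom (a i) i)"
  have co: "coeff p i = (if i = n then 1 else if i < n then - a i else 0)" for i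
    by (simp add: p_def coeff_sum sum.delta)
  have "degree p = n"
    using co by (intro antisym degree_le le_degree) auto
  moreover have "p \<noteq> 0" using co[of n] by auto
  moreover have "P p v = 0"
    unfolding P_def \<open>degree p = n\<close> lessThan_Suc_atMost[symmetric]
    by (simp add: co a scaleC_one sum_negf)
  ultimately show ?thesis using annihilating_product v by blast
qed

end

text \<open>The power of \<open>T 1\<close> furnished by the lower bound is \<open>T\<close> at an
  integer time \<open>L\<close>. Halving the distance once suffices, since the step can be
  repeated.\<close>

lemma semigroup_decay_modulo:
  assumes N: "csubspace N" "closed N" "T 1 ` N \<subseteq> N"
    and gev: "\<And>v z ms. cmod z \<ge> 1 \<Longrightarrow> set ms \<subseteq> log_set z \<Longrightarrow> in_prod_dom domA A ms v \<Longrightarrow>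
      prod_apply A ms v = 0 \<Longrightarrow> v \<in> N"
  obtains L where "0 < L" "\<And>v. infdist (T L v) N \<le> infdist v N / 2"
proof -
  have inj: "y \<in> N" if cy: "cmod c \<ge> 1" "c *\<^sub>C y - T 1 y \<in> N" for c y
  proof (rule ccontr)
    assume "y \<notin> N"
    have "c \<noteq> 0" using cy(1) by auto
    then obtain m v where "v \<notin> N" "((\<lambda>x. c *\<^sub>C x - T 1 x) ^^ m) v = 0"
      using lift_eigenvector[OF T1_compact _ N cy(2) \<open>y \<notin> N\<close>] by metis
    then show False using gen_eigenvector_annihilated[OF \<open>c \<noteq> 0\<close>] gev[OF cy(1)] by metis
  qed
  have "\<exists>M>0. \<forall>w v. cmod w \<le> 1 \<longrightarrow> infdist v N \<le> M * infdist (v - w *\<^sub>C T 1 v) N"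
    by (rule compact_operator_lower_bound[OF T1_compact N inj]) blast+
  then obtain M where M: "M > 0" "\<And>w v. cmod w \<le> 1 \<Longrightarrow> infdist v N \<le> M * infdist (v - w *\<^sub>C T 1 v) N"
    by blast
  obtain M0 where M0: "M0 > 0" "\<And>x. norm (T 1 x) \<le> M0 * norm x"
    using continuous_clinear_bound[OF T_simps(1)[OF zero_le_one]] by blast
  have sn: "cseminorm (\<lambda>x. infdist x N)"
    unfolding cseminorm_def
  proof (intro conjI allI)
    fix a x
    \<comment> \<open>Equality results from the inequality for \<open>a\<close> and the one for
      \<open>inverse a\<close>.\<close>
    show "infdist (a *\<^sub>C x) N = cmod a * infdist x N"
    proof (cases "a = 0")
      case False
      have "infdist (inverse a *\<^sub>C a *\<^sub>C x) N \<le> cmod (inverse a) * infdist (a *\<^sub>C x) N"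
        by (rule infdist_scaleC_le[OF N(1)])
      then have "cmod a * infdist x N \<le> infdist (a *\<^sub>C x) N"
        using False by (simp add: scaleC_scaleC scaleC_one norm_divide field_simps)
      then show ?thesis using infdist_scaleC_le[OF N(1), of a x] by simp
    qed (use csubspace_simps(1)[OF N(1)] in simp)
  qed (auto simp: infdist_nonneg infdist_add_csubspace[OF N(1)])
  obtain n where n: "n > 0" "\<And>v. infdist ((T 1 ^^ n) v) N \<le> infdist v N / 2"
    using decay_of_lower_bound[OF sn T1_lin infdist_operator_le[OF N(1,3) T1_lin M0(2) less_imp_le[OF M0(1)]] M0(1) M(2) M(1)]
    by blast
  have "(T 1 ^^ k) v = T (real k) v" for k v
    by (induction k) (simp_all add: T_simps)
  then show thesis using that[of "real n"] n by simp
qed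

end


section \<open>Decay of solutions\<close>

text \<open>Each time is an integer number of steps \<open>L\<close> away from a compact initial
  window, on which \<open>f\<close> is bounded.\<close>

lemma contraction_tends_to_0:
  fixes f :: "real \<Rightarrow> real"
  assumes L: "0 < L" and nonneg: "\<And>t. 0 \<le> f t"
    and step: "\<And>e. 0 < e \<Longrightarrow> \<exists>t0\<ge>0. \<forall>t\<ge>t0. f (t + L) \<le> f t / 2 + e"
    and bdd: "\<And>t. 0 \<le> t \<Longrightarrow> \<exists>B. \<forall>s\<in>{t..t + L}. f s \<le> B"
  shows "(f \<longlongrightarrow> 0) at_top"
proof (rule tendstoI)
  fix e :: real assume "0 < e"
  \<comment> \<open>With error \<open>e / 4\<close> the recursion
    \<open>a \<mapsto> a / 2 + e / 4\<close> has the fixed point \<open>e / 2\<close>, which is the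
    offset in \<open>iter\<close>.\<close>
  then obtain t0 where t0: "0 \<le> t0" "\<And>t. t \<ge> t0 \<Longrightarrow> f (t + L) \<le> f t / 2 + e / 4"
    using step[of "e / 4"] by auto
  obtain B where B: "\<And>s. t0 \<le> s \<Longrightarrow> s \<le> t0 + L \<Longrightarrow> f s \<le> B"
    using bdd[OF t0(1)] by (metis atLeastAtMost_iff)
  have iter: "f (r + real k * L) \<le> B * (1 / 2) ^ k + e / 2" if r: "t0 \<le> r" "r \<le> t0 + L" for r k
  proof (induction k)
    case 0
    show ?case using B[OF r] \<open>0 < e\<close> by simp
  next
    case (Suc k)
    have "t0 \<le> r + real k * L" using r L by (intro add_increasing2) auto
    from t0(2)[OF this] Suc show ?case by (simp add: algebra_simps)
  qed
  have "(\<lambda>k. B * (1 / 2) ^ k) \<longlonglongrightarrow> B * 0"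
    by (intro tendsto_mult tendsto_const LIMSEQ_realpow_zero) auto
  then obtain k0 where k0: "\<And>k. k \<ge> k0 \<Longrightarrow> B * (1 / 2) ^ k < e / 2"
    using order_tendstoD(2)[of _ 0 sequentially "e / 2"] \<open>0 < e\<close> by (auto simp: eventually_sequentially)
  have "dist (f t) 0 < e" if t: "t \<ge> t0 + real k0 * L" for t
  proof -
    \<comment> \<open>The number of whole steps since \<open>t0\<close>; removing them brings
      \<open>t\<close> into the window from \<open>t0\<close> to \<open>t0 + L\<close>.\<close>
    define k where "k = nat \<lfloor>(t - t0) / L\<rfloor>"
    have "real k0 \<le> (t - t0) / L" using t L by (simp add: pos_le_divide_eq)
    then have "k \<ge> k0" unfolding k_def by (simp add: le_nat_floor)
    have "0 \<le> (t - t0) / L" using \<open>real k0 \<le> (t - t0) / L\<close> by linarith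
    then have "real k \<le> (t - t0) / L" "(t - t0) / L < real k + 1"
      unfolding k_def by (auto simp: of_nat_nat floor_less_iff)
    then have "t0 \<le> t - real k * L" "t - real k * L \<le> t0 + L"
      using L by (auto simp: field_simps)
    from iter[OF this, of k] have "f t \<le> B * (1 / 2) ^ k + e / 2" by simp
    also have "\<dots> < e" using k0[OF \<open>k \<ge> k0\<close>] by simp
    finally show ?thesis using nonneg[of t] by simp
  qed
  then show "\<forall>\<^sub>F t in at_top. dist (f t) 0 < e"
    by (auto simp: eventually_at_top_linorder)
qed

context compact_semigroup
begin

text \<open>In place of the integral formula, the mean value estimate is applied to
  \<open>s \<mapsto> T (t + L - s) (x s)\<close>: the terms with \<open>A\<close> cancel and the
  derivative is \<open>T (t + L - s) (g s)\<close>.\<close>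

lemma variation_of_constants_bound:
  assumes t: "0 \<le> t" and L: "0 < L"
    and x: "\<And>s. 0 \<le> s \<Longrightarrow> x s \<in> domA"
      "\<And>s. 0 \<le> s \<Longrightarrow> (x has_vector_derivative A (x s) + g s) (at s within {0..})"
    and M: "0 < M" "\<And>s v. s \<in> {0..L} \<Longrightarrow> norm (T s v) \<le> M * norm v"
    and g: "\<And>s. t \<le> s \<Longrightarrow> s \<le> t + L \<Longrightarrow> norm (g s) \<le> e"
  shows "norm (x (t + L) - T L (x t)) \<le> M * e * L"
proof -
  let ?\<phi> = "\<lambda>s. T (t + L - s) (x s)"
  have D: "(?\<phi> has_vector_derivative T (t + L - s) (g s)) (at s within {t..t + L})"
    if s: "t \<le> s" "s \<le> t + L" for s
  proof -
    have s0: "0 \<le> s" "0 \<le> t + L - s" using s t by auto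
    have "(?\<phi> has_vector_derivative (- T (t + L - s) (A (x s)) + T (t + L - s) (A (x s) + g s)))
        (at s within {t..t + L})"
    proof (rule has_vector_derivative_operator_family
        [where M = M and S = "\<lambda>r. T (t + L - r)" and x = x and x' = "A (x s) + g s"])
      show "(x has_vector_derivative A (x s) + g s) (at s within {t..t + L})"
        by (rule has_vector_derivative_within_subset[OF x(2)[OF s0(1)]]) (use t in auto)
      show "((\<lambda>r. T (t + L - r) (x s)) has_vector_derivative - T (t + L - s) (A (x s)))
          (at s within {t..t + L})"
        by (rule has_vector_derivative_reflect[OF T_deriv[OF x(1)[OF s0(1)] s0(2)]]) auto
      have "continuous_on {t..t + L} (\<lambda>r. T (t + L - r) (A (x s) + g s))"
        by (rule continuous_on_compose2[OF T_simps(5)]) (auto intro!: continuous_intros)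
      then show "((\<lambda>r. T (t + L - r) (A (x s) + g s)) \<longlongrightarrow> T (t + L - s) (A (x s) + g s)) (at s within {t..t + L})"
        using s by (auto simp: continuous_on_def)
      fix r v assume r: "r \<in> {t..t + L}"
      then show "clinear (T (t + L - r))" by (intro T_simps) auto
      show "norm (T (t + L - r) v) \<le> M * norm v" using r t by (intro M) auto
    qed (use s in auto)
    then show ?thesis by (simp add: clinear_simps[OF T_simps(2)[OF s0(2)]])
  qed
  have "norm (?\<phi> (t + L) - ?\<phi> t) \<le> M * e * (t + L - t)"
  proof (rule vector_mean_value_bound)
    show "continuous_on {t..t + L} ?\<phi>"
      unfolding continuous_on_eq_continuous_within
      using has_vector_derivative_continuous[OF D] by auto
    fix s assume s: "t < s" "s < t + L"
    then show "(?\<phi> has_vector_derivative T (t + L - s) (g s)) (at s)"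
      using D[of s] by (simp add: at_within_Icc_at)
    have "norm (T (t + L - s) (g s)) \<le> M * norm (g s)" using s t by (intro M) auto
    also have "\<dots> \<le> M * e" using g[of s] s M(1) by (intro mult_left_mono) auto
    finally show "norm (T (t + L - s) (g s)) \<le> M * e" .
  qed (use L in auto)
  then show ?thesis by (simp add: T_simps(3))
qed

text \<open>Over a time span \<open>L\<close> the state is \<open>T L\<close> of the earlier state
  plus an error of the size of the forcing, so its distance to \<open>N\<close> is halved up to a
  vanishing term.\<close>

lemma solution_decay_modulo:
  assumes N: "csubspace N" and L: "0 < L" "\<And>v. infdist (T L v) N \<le> infdist v N / 2"
    and x: "\<And>s. 0 \<le> s \<Longrightarrow> x s \<in> domA"
      "\<And>s. 0 \<le> s \<Longrightarrow> (x has_vector_derivative A (x s) + g s) (at s within {0..})"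
    and g: "(g \<longlongrightarrow> 0) at_top"
  shows "((\<lambda>t. infdist (x t) N) \<longlongrightarrow> 0) at_top"
proof (rule contraction_tends_to_0[OF L(1) infdist_nonneg])
  obtain M where M: "0 < M" "\<And>s v. s \<in> {0..L} \<Longrightarrow> norm (T s v) \<le> M * norm v"
    using bounded unfolding locally_bounded_def by blast
  fix e :: real assume e: "0 < e"
  \<comment> \<open>Chosen such that a forcing of size \<open>d\<close> changes the state by at most
    \<open>M * d * L = e\<close> during one step.\<close>
  define d where "d = e / (M * L)"
  have d: "0 < d" "M * d * L = e" using e M(1) L(1) by (auto simp: d_def)
  from tendstoD[OF g d(1)] obtain t0 where t0: "\<And>t. t \<ge> t0 \<Longrightarrow> norm (g t) < d"
    by (auto simp: eventually_at_top_linorder)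
  show "\<exists>t0\<ge>0. \<forall>t\<ge>t0. infdist (x (t + L)) N \<le> infdist (x t) N / 2 + e"
  proof (intro exI[of _ "max 0 t0"] conjI allI impI)
    fix t assume t: "max 0 t0 \<le> t"
    have "norm (x (t + L) - T L (x t)) \<le> M * d * L"
      using t t0 by (intro variation_of_constants_bound[OF _ L(1) x M]) (auto intro: less_imp_le)
    moreover have "infdist (x (t + L) - T L (x t)) N \<le> norm (x (t + L) - T L (x t))"
      using infdist_le[OF csubspace_simps(1)[OF N], of "x (t + L) - T L (x t)"] by simp
    ultimately show "infdist (x (t + L)) N \<le> infdist (x t) N / 2 + e"
      using infdist_add_csubspace[OF N, of "T L (x t)" "x (t + L) - T L (x t)"] L(2)[of "x t"] d(2) by simp
  qed simp
next
  fix t :: real assume t: "0 \<le> t"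
  have "continuous_on {0..} x"
    unfolding continuous_on_eq_continuous_within
    using has_vector_derivative_continuous[OF x(2)] by auto
  then have "continuous_on {t..t + L} x"
    by (rule continuous_on_subset) (use t in auto)
  then have "continuous_on {t..t + L} (\<lambda>s. infdist (x s) N)"
    by (rule continuous_on_infdist)
  then have "compact ((\<lambda>s. infdist (x s) N) ` {t..t + L})"
    by (intro compact_continuous_image) auto
  then have "bounded ((\<lambda>s. infdist (x s) N) ` {t..t + L})" by (rule compact_imp_bounded)
  then show "\<exists>B. \<forall>s\<in>{t..t + L}. infdist (x s) N \<le> B"
    by (auto simp: bounded_iff infdist_nonneg)
qed

end

section \<open>Frechet spaces and smooth functions\<close>

lemma continuous_clinear_tendsto:
  fixes F :: "'a::frechet_space \<Rightarrow> 'b::frechet_space"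
  assumes "continuous_clinear F" "(f \<longlongrightarrow> l) G"
  shows "((\<lambda>x. F (f x)) \<longlongrightarrow> F l) G"
  using assms isCont_tendsto_compose[of l F f G]
  by (auto simp: continuous_clinear_def continuous_on_eq_continuous_at)

lemma has_halfline_derivative_operator:
  fixes f :: "real \<Rightarrow> 'a::frechet_space" and F :: "'a \<Rightarrow> 'b::frechet_space"
  assumes F: "continuous_clinear F" and f: "has_halfline_derivative f d t"
  shows "has_halfline_derivative (\<lambda>t. F (f t)) (F d) t"
proof -
  have lin: "clinear F" using F by (simp add: continuous_clinear_def)
  show ?thesis
    using continuous_clinear_tendsto[OF F f[unfolded has_halfline_derivative_def]]
    by (simp add: has_halfline_derivative_def clinear_simps[OF lin])
qed

lemma smooth_halfline_operator:
  fixes f :: "real \<Rightarrow> 'a::frechet_space" and F :: "'a \<Rightarrow> 'b::frechet_space"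
  assumes F: "continuous_clinear F" and f: "f \<in> smooth_halfline"
  shows "(\<lambda>t. F (f t)) \<in> smooth_halfline"
proof (rule smooth_halfline_coinduct[where Q = "\<lambda>h. \<exists>f\<in>smooth_halfline. h = (\<lambda>t. F (f t))"])
  show "\<exists>g\<in>smooth_halfline. (\<lambda>t. F (f t)) = (\<lambda>t. F (g t))" using f by blast
  have lin: "clinear F" using F by (simp add: continuous_clinear_def)
  fix h assume "\<exists>f\<in>smooth_halfline. h = (\<lambda>t. F (f t))"
  then obtain g where g: "g \<in> smooth_halfline" and h: "h = (\<lambda>t. F (g t))" by blast
  note step = smooth_halfline_step[OF g]
  have d: "has_halfline_derivative h (F (halfline_deriv g t)) t" if "0 \<le> t" for t
    unfolding h by (rule has_halfline_derivative_operator[OF F step(2)[OF that]])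
  have "halfline_deriv h = (\<lambda>t. F (halfline_deriv g t))"
    using d by (rule halfline_deriv_ext) (simp_all add: halfline_deriv_def clinear_simps[OF lin])
  with d step h show "(\<forall>t<0. h t = 0) \<and> (\<forall>t\<ge>0. \<exists>d. has_halfline_derivative h d t) \<and>
      (\<exists>f\<in>smooth_halfline. halfline_deriv h = (\<lambda>t. F (f t)))"
    by (auto simp: clinear_simps[OF lin])
qed

text \<open>Subtracting a nearly nearest point of \<open>N\<close> does not change the output and
  makes the state tend to 0. The slack \<open>exp (- t)\<close> is there because the distance need
  not be attained.\<close>

lemma observation_tendsto_0:
  fixes C :: "'x::complex_banach \<Rightarrow> 'y::frechet_space"
  assumes C: "continuous_clinear C" and N: "csubspace N" "\<And>n. n \<in> N \<Longrightarrow> C n = 0"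
    and x: "((\<lambda>t. infdist (x t) N) \<longlongrightarrow> 0) at_top"
  shows "((\<lambda>t::real. C (x t)) \<longlongrightarrow> 0) at_top"
proof -
  have lin: "clinear C" using C by (simp add: continuous_clinear_def)
  have ne: "N \<noteq> {}" using csubspace_simps(1)[OF N(1)] by blast
  have "\<exists>n\<in>N. dist (x t) n < infdist (x t) N + exp (- t)" for t
    by (rule infdist_lessE[OF ne, of "x t" "infdist (x t) N + exp (- t)"]) auto
  then obtain n where n: "\<And>t. n t \<in> N" "\<And>t. dist (x t) (n t) < infdist (x t) N + exp (- t)"
    by metis
  have "((\<lambda>t::real. exp (- t)) \<longlongrightarrow> 0) at_top" by real_asymp
  from tendsto_add[OF x this] have lim: "((\<lambda>t. infdist (x t) N + exp (- t)) \<longlongrightarrow> 0) at_top" by simp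
  have "((\<lambda>t. x t - n t) \<longlongrightarrow> 0) at_top"
    by (rule Lim_null_comparison[OF _ lim], intro always_eventually allI)
      (use n(2) in \<open>auto simp: dist_norm intro: less_imp_le\<close>)
  from continuous_clinear_tendsto[OF C this] show ?thesis
    by (simp add: clinear_simps[OF lin] N(2)[OF n(1)])
qed

text \<open>Modulo \<open>N\<close> the derivative is 0. To see this without a quotient space, the
  scalar function \<open>h\<close>, the distance of the increment to \<open>N\<close>, is shown to
  have derivative 0.\<close>

lemma increment_in_closed_csubspace:
  fixes \<phi> :: "real \<Rightarrow> 'x::complex_banach"
  assumes N: "csubspace N" "closed N"
    and deriv: "\<And>s. 0 \<le> s \<Longrightarrow> (\<phi> has_vector_derivative d s) (at s within {0..})"
    and d: "\<And>s. 0 \<le> s \<Longrightarrow> d s \<in> N" and t: "0 \<le> t"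
  shows "\<phi> t - \<phi> 0 \<in> N"
proof -
  define h where "h s = infdist (\<phi> s - \<phi> 0) N" for s
  have "(h has_vector_derivative 0) (at s within {0..})" if s: "s \<in> {0..}" for s
    unfolding has_vector_derivative_iff_quotient
  proof (rule Lim_null_comparison)
    have s0: "0 \<le> s" using s by simp
    have "((\<lambda>r. (\<phi> r - \<phi> s) /\<^sub>R (r - s) - d s) \<longlongrightarrow> 0) (at s within {0..})"
      using deriv[OF s0] unfolding has_vector_derivative_iff_quotient by (rule LIM_zero)
    then show "((\<lambda>r. norm ((\<phi> r - \<phi> s) /\<^sub>R (r - s) - d s)) \<longlongrightarrow> 0) (at s within {0..})"
      by (rule tendsto_norm_zero)
    have le: "h r \<le> h s' + infdist (\<phi> r - \<phi> s') N" for r s'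
      using infdist_add_csubspace[OF N(1), of "\<phi> s' - \<phi> 0" "\<phi> r - \<phi> s'"] by (simp add: h_def)
    have "infdist (- v) N \<le> infdist v N" for v
      using infdist_scaleC_le[OF N(1), of "- 1" v] by (simp add: scaleC_one)
    then have sym: "infdist (\<phi> s - \<phi> r) N \<le> infdist (\<phi> r - \<phi> s) N" for r
      by (metis minus_diff_eq)
    have "norm ((h r - h s) /\<^sub>R (r - s)) \<le> norm ((\<phi> r - \<phi> s) /\<^sub>R (r - s) - d s)" if r: "r \<noteq> s" for r
    proof -
      have "\<bar>h r - h s\<bar> \<le> infdist (\<phi> r - \<phi> s) N" using le[of r s] le[of s r] sym[of r] by linarith
      also have "\<dots> \<le> dist (\<phi> r - \<phi> s) ((r - s) *\<^sub>R d s)"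
        using d[OF s0] by (intro infdist_le csubspace_simps[OF N(1)])
      also have "\<dots> = norm ((r - s) *\<^sub>R ((\<phi> r - \<phi> s) /\<^sub>R (r - s) - d s))"
        using r by (simp add: dist_norm scaleR_right_diff_distrib)
      also have "\<dots> = \<bar>r - s\<bar> * norm ((\<phi> r - \<phi> s) /\<^sub>R (r - s) - d s)" by simp
      finally show ?thesis using r by (simp add: abs_mult field_simps)
    qed
    then show "\<forall>\<^sub>F r in at s within {0..}. norm ((h r - h s) /\<^sub>R (r - s)) \<le> norm ((\<phi> r - \<phi> s) /\<^sub>R (r - s) - d s)"
      by (auto simp: eventually_at_filter)
  qed
  then obtain c where "\<And>s. s \<in> {0..} \<Longrightarrow> h s = c"
    using has_vector_derivative_zero_constant[of "{0..}" h] by auto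
  from this[of t] this[of 0] t have "h t = h 0" by simp
  then have "infdist (\<phi> t - \<phi> 0) N = 0"
    using csubspace_simps(1)[OF N(1)] by (simp add: h_def)
  moreover have "N \<noteq> {}" using csubspace_simps(1)[OF N(1)] by blast
  ultimately show ?thesis using N(2) by (simp add: in_closed_iff_infdist_zero)
qed


section \<open>Stability\<close>

lemma state_space_relation_mem:
  "(u, y) \<in> state_space_relation domA A B C D \<longleftrightarrow> u \<in> smooth_halfline \<and> y \<in> smooth_halfline \<and>
    (\<exists>x\<in>smooth_halfline. \<forall>t\<ge>0. x t \<in> domA \<and>
      has_halfline_derivative x (A (x t) + B (u t)) t \<and> y t = C (x t) + D (u t))"
  by (simp add: state_space_relation_def)

definition gen_kernel :: "'x::complex_vector set \<Rightarrow> ('x \<Rightarrow> 'x) \<Rightarrow> complex list \<Rightarrow> 'x set"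
  where "gen_kernel domA A ms = {v. in_prod_dom domA A ms v \<and> prod_apply A ms v = 0}"

lemma gen_kernel_Nil: "gen_kernel domA A [] = {0}"
  by (auto simp: gen_kernel_def)

lemma gen_kernel_Cons:
  "gen_kernel domA A (\<mu> # ms) = {v \<in> domA. \<mu> *\<^sub>C v - A v \<in> gen_kernel domA A ms}"
  by (auto simp: gen_kernel_def)

text \<open>The kernel grows when a factor is added at the head, and
  \<open>A v = \<mu> v - (\<mu> v - A v)\<close> with the bracket in the smaller kernel. The
  invariance makes orbits starting in the kernel smooth.\<close>

lemma gen_kernel_invariant:
  fixes domA :: "'x::complex_banach set"
  assumes A: "linear_operator_on domA A"
  shows "csubspace (gen_kernel domA A ms) \<and> gen_kernel domA A ms \<subseteq> domA \<and>
    A ` gen_kernel domA A ms \<subseteq> gen_kernel domA A ms"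
proof (induction ms)
  case Nil
  then show ?case
    using linear_operator_on_simps[OF A] csubspace_simps(1)[of domA]
    by (auto simp: gen_kernel_Nil complex_vector.subspace_def)
next
  case (Cons \<mu> ms)
  note A_simps = linear_operator_on_simps[OF A]
  let ?G = "gen_kernel domA A ms"
  have G: "csubspace ?G" "?G \<subseteq> domA" "A ` ?G \<subseteq> ?G" using Cons by auto
  have sub: "csubspace (gen_kernel domA A (\<mu> # ms))"
    unfolding complex_vector.subspace_def gen_kernel_Cons
  proof (intro conjI ballI allI)
    show "0 \<in> {v \<in> domA. \<mu> *\<^sub>C v - A v \<in> ?G}"
      using csubspace_simps(1)[OF A_simps(1)] csubspace_simps(1)[OF G(1)] by (simp add: A_simps)
    fix v w a assume v: "v \<in> {v \<in> domA. \<mu> *\<^sub>C v - A v \<in> ?G}"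
    show "a *\<^sub>C v \<in> {v \<in> domA. \<mu> *\<^sub>C v - A v \<in> ?G}"
    proof -
      have "\<mu> *\<^sub>C a *\<^sub>C v - A (a *\<^sub>C v) = a *\<^sub>C (\<mu> *\<^sub>C v - A v)"
        using v by (simp add: A_simps scaleC.diff_right scaleC_scaleC mult.commute)
      then show ?thesis
        using v csubspace_simps(3)[OF A_simps(1)] csubspace_simps(3)[OF G(1)] by simp
    qed
    assume w: "w \<in> {v \<in> domA. \<mu> *\<^sub>C v - A v \<in> ?G}"
    have "\<mu> *\<^sub>C (v + w) - A (v + w) = (\<mu> *\<^sub>C v - A v) + (\<mu> *\<^sub>C w - A w)"
      using v w by (simp add: A_simps scaleC_add_right)
    then show "v + w \<in> {v \<in> domA. \<mu> *\<^sub>C v - A v \<in> ?G}"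
      using v w csubspace_simps(2)[OF A_simps(1)] csubspace_simps(2)[OF G(1)] by simp
  qed
  have le: "?G \<subseteq> gen_kernel domA A (\<mu> # ms)"
    unfolding gen_kernel_Cons using G by (auto intro!: csubspace_simps)
  have "A v \<in> gen_kernel domA A (\<mu> # ms)" if v: "v \<in> gen_kernel domA A (\<mu> # ms)" for v
  proof -
    have "\<mu> *\<^sub>C v - A v \<in> gen_kernel domA A (\<mu> # ms)" using v le by (auto simp: gen_kernel_Cons)
    then have "\<mu> *\<^sub>C v - (\<mu> *\<^sub>C v - A v) \<in> gen_kernel domA A (\<mu> # ms)"
      by (rule csubspace_simps(5)[OF sub csubspace_simps(3)[OF sub v]])
    then show ?thesis by simp
  qed
  with sub show ?case by (auto simp: gen_kernel_Cons)
qed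

text \<open>Differentiating \<open>x = (\<mu> - A)\<^sup>-\<^sup>1 (\<mu> x - A x)\<close> shows that \<open>x'\<close> is again a trajectory.\<close>

lemma state_space_relation_deriv:
  fixes domA :: "'x::complex_banach set" and B :: "'u::frechet_space \<Rightarrow> 'x" and C :: "'x \<Rightarrow> 'y::frechet_space"
  assumes sec: "sectorial domA A"
    and B: "continuous_clinear B" and C: "continuous_clinear C" and D: "continuous_clinear D"
    and uy: "(u, y) \<in> state_space_relation domA A B C D"
  shows "(halfline_deriv u, halfline_deriv y) \<in> state_space_relation domA A B C D"
proof -
  from uy obtain x where u: "u \<in> smooth_halfline" and y: "y \<in> smooth_halfline" and x: "x \<in> smooth_halfline"
    and xd: "\<And>t. 0 \<le> t \<Longrightarrow> x t \<in> domA"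
      "\<And>t. 0 \<le> t \<Longrightarrow> has_halfline_derivative x (A (x t) + B (u t)) t"
      "\<And>t. 0 \<le> t \<Longrightarrow> y t = C (x t) + D (u t)"
    unfolding state_space_relation_mem by blast
  let ?x' = "halfline_deriv x" and ?u' = "halfline_deriv u"
  note sx = smooth_halfline_step[OF x] and su = smooth_halfline_step[OF u]
  obtain \<mu> where \<mu>: "\<mu> \<in> resolvent_set domA A" using sectorial_resolvent_set_nonempty[OF sec] .
  define R where "R = resolvent domA A \<mu>"
  note R = resolvent_inverse[OF \<mu>, folded R_def]
  have Rlin: "clinear R" using R(4) by (simp add: continuous_clinear_def)
  have x'_eq: "?x' t = A (x t) + B (u t)" if "0 \<le> t" for t
    using halfline_deriv_eq[OF xd(2)[OF that] that] .
  have key: "?x' t \<in> domA \<and> halfline_deriv ?x' t = A (?x' t) + B (?u' t)" if t: "0 \<le> t" for t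
  proof -
    \<comment> \<open>On the half-line this equals \<open>\<mu> x - A x\<close>, written in terms of
      functions known to be differentiable; the bounded resolvent maps it back to
      \<open>x\<close>.\<close>
    let ?w = "\<lambda>s. (\<mu> *\<^sub>C x s + (- 1) *\<^sub>C ?x' s) + B (u s)"
    let ?d = "(\<mu> *\<^sub>C ?x' t + (- 1) *\<^sub>C halfline_deriv ?x' t) + B (?u' t)"
    have "has_halfline_derivative ?w ?d t"
      using smooth_halfline_step(2)[OF sx(3) t] sx(2)[OF t] su(2)[OF t]
      by (intro has_halfline_derivative_add has_halfline_derivative_scaleC has_halfline_derivative_operator[OF B])
    then have "has_halfline_derivative (\<lambda>s. R (?w s)) (R ?d) t"
      by (rule has_halfline_derivative_operator[OF R(4)])
    moreover have "R (?w s) = x s" if "0 \<le> s" for s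
    proof -
      have eq: "?w s = \<mu> *\<^sub>C x s - A (x s)" by (simp add: x'_eq[OF that] scaleC_one)
      show ?thesis unfolding eq by (rule R(3)[OF xd(1)[OF that]])
    qed
    ultimately have "has_halfline_derivative x (R ?d) t"
      using t unfolding has_halfline_derivative_def
      by (auto simp: eventually_at_filter elim!: Lim_transform_eventually)
    then have "?x' t = R ?d" using halfline_deriv_eq t by blast
    then have "?x' t \<in> domA" "\<mu> *\<^sub>C ?x' t - A (?x' t) = ?d" using R(1,2)[of ?d] by auto
    then show ?thesis by (simp add: scaleC_one algebra_simps)
  qed
  have "halfline_deriv y t = C (?x' t) + D (?u' t)" if t: "0 \<le> t" for t
  proof -
    have "has_halfline_derivative (\<lambda>t. C (x t) + D (u t)) (C (?x' t) + D (?u' t)) t"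
      using sx(2)[OF t] su(2)[OF t]
      by (intro has_halfline_derivative_add has_halfline_derivative_operator[OF C] has_halfline_derivative_operator[OF D])
    then have "has_halfline_derivative y (C (?x' t) + D (?u' t)) t"
      using t xd(3) unfolding has_halfline_derivative_def
      by (auto simp: eventually_at_filter elim!: Lim_transform_eventually)
    then show ?thesis using halfline_deriv_eq t by blast
  qed
  moreover have "has_halfline_derivative ?x' (A (?x' t) + B (?u' t)) t" if "0 \<le> t" for t
    using smooth_halfline_step(2)[OF sx(3) that] key[OF that] by simp
  ultimately show ?thesis
    unfolding state_space_relation_mem
    using su(3) smooth_halfline_step(3)[OF y] sx(3) key by blast
qed

locale state_space_system = compact_semigroup domA A T
  for domA :: "'x::complex_banach set" and A T +
  fixes B :: "'u::frechet_space \<Rightarrow> 'x" and C :: "'x \<Rightarrow> 'y::frechet_space" and D :: "'u \<Rightarrow> 'y"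
  assumes B: "continuous_clinear B" and C: "continuous_clinear C" and D: "continuous_clinear D"
begin

abbreviation io :: "((real \<Rightarrow> 'u) \<times> (real \<Rightarrow> 'y)) set"
  where "io \<equiv> state_space_relation domA A B C D"

definition N where "N = {v. \<forall>t\<ge>0. C (T t v) = 0}"

lemma C_lin: "clinear C" and B_lin: "clinear B" and D_lin: "clinear D"
  using B C D by (auto simp: continuous_clinear_def)

lemma N_eq: "unobservable_subspace T C = N"
  unfolding N_def by (rule unobservable_subspace_eq[OF semigroup C_lin])

lemma N_csubspace: "csubspace N"
  unfolding complex_vector.subspace_def N_def
  by (auto simp: clinear_simps[OF T_simps(2)] clinear_simps[OF C_lin])

lemma N_closed: "closed N"
proof -
  have "closed {v. C (T t v) = 0}" if "0 \<le> t" for t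
  proof -
    have "continuous_on UNIV (\<lambda>v. C (T t v))"
      using C T_simps(1)[OF that] unfolding continuous_clinear_def
      by (auto intro: continuous_on_compose2[of UNIV C])
    then have "closed ((\<lambda>v. C (T t v)) -` {0})"
      by (intro continuous_closed_vimage closed_singleton) (auto simp: continuous_on_eq_continuous_at)
    then show ?thesis by (simp add: vimage_def)
  qed
  then have "closed (\<Inter>t\<in>{0..}. {v. C (T t v) = 0})" by (intro closed_INT) auto
  moreover have "N = (\<Inter>t\<in>{0..}. {v. C (T t v) = 0})" by (auto simp: N_def)
  ultimately show ?thesis by simp
qed

lemma N_invariant: "0 \<le> s \<Longrightarrow> v \<in> N \<Longrightarrow> T s v \<in> N"
  by (auto simp: N_def simp flip: T_simps(4))

lemma N_kernel: "v \<in> N \<Longrightarrow> C v = 0"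
  using T_simps(3)[of v] by (force simp: N_def)

section \<open>Stability forces generalized eigenvectors to be unobservable\<close>

text \<open>The orbit of \<open>w\<close>, extended by 0, is a trajectory for the input 0. It is
  smooth because differentiation replaces the initial value \<open>v\<close> by \<open>A v\<close>,
  which stays in the kernel.\<close>

lemma gen_kernel_output_vanishing:
  assumes stable: "stable io" and w: "w \<in> gen_kernel domA A ms"
  shows "((\<lambda>t. C (T t w)) \<longlongrightarrow> 0) at_top"
proof -
  let ?G = "gen_kernel domA A ms"
  define X where "X w t = (if 0 \<le> t then T t w else 0)" for w t
  have G: "?G \<subseteq> domA" "A ` ?G \<subseteq> ?G" using gen_kernel_invariant[OF A_lin] by auto
  have deriv: "has_halfline_derivative (X v) (T t (A v)) t" if "v \<in> ?G" "0 \<le> t" for v t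
  proof -
    have "has_halfline_derivative (\<lambda>t. T t v) (T t (A v)) t"
      unfolding has_halfline_derivative_normed using that G by (intro T_deriv) auto
    then show ?thesis
      using that(2) unfolding has_halfline_derivative_def
      by (rule_tac Lim_transform_eventually) (auto simp: eventually_at_filter X_def)
  qed
  have smooth: "X w \<in> smooth_halfline"
  proof (rule smooth_halfline_coinduct[where Q = "\<lambda>f. \<exists>v\<in>?G. f = X v"])
    show "\<exists>v\<in>?G. X w = X v" using w by blast
    fix f assume "\<exists>v\<in>?G. f = X v"
    then obtain v where v: "v \<in> ?G" "f = X v" by blast
    have "halfline_deriv f = X (A v)"
      by (rule halfline_deriv_ext) (use deriv[OF v(1)] v(2) in \<open>auto simp: X_def[of "A v"]\<close>)
    then show "(\<forall>t<0. f t = 0) \<and> (\<forall>t\<ge>0. \<exists>d. has_halfline_derivative f d t) \<and> (\<exists>v\<in>?G. halfline_deriv f = X v)"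
      using v deriv[OF v(1)] G(2) by (auto simp: X_def)
  qed
  have "((\<lambda>_. 0), (\<lambda>t. C (X w t))) \<in> io"
    unfolding state_space_relation_mem
  proof (intro conjI bexI[OF _ smooth] allI impI)
    show "(\<lambda>t. C (X w t)) \<in> smooth_halfline" by (rule smooth_halfline_operator[OF C smooth])
    fix t :: real assume t: "0 \<le> t"
    show "X w t \<in> domA" using t w G T_invariant(1) by (auto simp: X_def)
    have "T t (A w) = A (X w t)" using t w G T_invariant(2) by (auto simp: X_def)
    then show "has_halfline_derivative (X w) (A (X w t) + B 0) t"
      using deriv[OF w t] by (simp add: clinear_simps[OF B_lin])
  qed (simp_all add: smooth_halfline_zero clinear_simps[OF D_lin])
  then have "((\<lambda>t. C (X w t)) \<longlongrightarrow> 0) at_top" using stable by (auto simp: stable_def vanishing_def)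
  then show ?thesis
    by (rule Lim_transform_eventually) (auto simp: X_def eventually_at_top_linorder intro!: exI[of _ 0])
qed

text \<open>Induction on the list keeps polynomial factors out: once \<open>\<mu> w - A w\<close> is
  known to lie in \<open>N\<close>, the vector \<open>w\<close> is an eigenvector modulo
  \<open>N\<close>, and its output is the pure exponential \<open>exp (t \<mu>) C w\<close> with
  \<open>Re \<mu> \<ge> 0\<close>.\<close>

lemma gen_kernel_unobservable:
  assumes stable: "stable io" and z: "cmod z \<ge> 1" and ms: "set ms \<subseteq> log_set z"
  shows "gen_kernel domA A ms \<subseteq> N"
  using ms
proof (induction ms)
  case Nil
  then show ?case using csubspace_simps(1)[OF N_csubspace] by (simp add: gen_kernel_Nil)
next
  case (Cons \<mu> ms)
  show ?case
  proof
    fix w assume w: "w \<in> gen_kernel domA A (\<mu> # ms)"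
    then have wd: "w \<in> domA" and g: "\<mu> *\<^sub>C w - A w \<in> N" using Cons by (auto simp: gen_kernel_Cons)
    have "exp \<mu> = z" using Cons.prems by (simp add: log_set_def)
    then have "exp (Re \<mu>) \<ge> 1" using z by (simp flip: norm_exp_eq_Re)
    then have re: "0 \<le> Re \<mu>" by simp
    have "A w - \<mu> *\<^sub>C w \<in> N" using csubspace_simps(4)[OF N_csubspace g] by simp
    then have "exp (- (of_real t * \<mu>)) *\<^sub>C T t w - exp (- (of_real 0 * \<mu>)) *\<^sub>C T 0 w \<in> N" if "0 \<le> t" for t
      using N_invariant that
      by (intro increment_in_closed_csubspace[OF N_csubspace N_closed rescaled_orbit_derivative[OF wd]]
          csubspace_simps(3)[OF N_csubspace]) auto
    then have "C (exp (- (of_real t * \<mu>)) *\<^sub>C T t w - w) = 0" if "0 \<le> t" for t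
      using that N_kernel by (force simp: T_simps(3) scaleC_one)
    then have "exp (- (of_real t * \<mu>)) *\<^sub>C C (T t w) = C w" if "0 \<le> t" for t
      using that by (simp add: clinear_simps[OF C_lin])
    then have "exp (of_real t * \<mu>) *\<^sub>C exp (- (of_real t * \<mu>)) *\<^sub>C C (T t w) = exp (of_real t * \<mu>) *\<^sub>C C w"
      if "0 \<le> t" for t using that by simp
    then have eq: "C (T t w) = exp (of_real t * \<mu>) *\<^sub>C C w" if "0 \<le> t" for t
      using that by (simp add: scaleC_scaleC scaleC_one flip: exp_add)
    \<comment> \<open>The output lives in a Frechet space, so its failure to decay is measured in
      each seminorm separately.\<close>
    obtain p :: "nat \<Rightarrow> 'y \<Rightarrow> real" where sn: "\<And>n. cseminorm (p n)"
      and lim: "\<And>(f :: real \<Rightarrow> 'y) L F. (f \<longlongrightarrow> L) F \<longleftrightarrow> (\<forall>n. ((\<lambda>x. p n (f x - L)) \<longlongrightarrow> 0) F)"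
      by (fact frechet_space_tendsto)
    have "p n (C w) = 0" for n
    proof -
      have "((\<lambda>t. p n (C (T t w) - 0)) \<longlongrightarrow> 0) at_top"
        using gen_kernel_output_vanishing[OF stable w] unfolding lim by blast
      then have 1: "((\<lambda>t. p n (C (T t w))) \<longlongrightarrow> 0) at_top" by simp
      have "\<forall>\<^sub>F t in at_top. p n (C w) \<le> p n (C (T t w))"
        unfolding eventually_at_top_linorder
      proof (intro exI[of _ 0] allI impI)
        fix t :: real assume t: "0 \<le> t"
        have "1 * p n (C w) \<le> exp (t * Re \<mu>) * p n (C w)"
          using t re by (intro mult_right_mono) (auto simp: cseminorm_simps[OF sn])
        then show "p n (C w) \<le> p n (C (T t w))"
          by (simp add: eq[OF t] cseminorm_simps(3)[OF sn] norm_exp_eq_Re)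
      qed
      with 1 have "p n (C w) \<le> 0" by (intro tendsto_lowerbound) auto
      then show ?thesis using cseminorm_simps(1)[OF sn, of n "C w"] by simp
    qed
    then have "((\<lambda>_::real. C w) \<longlongrightarrow> 0) at_top" unfolding lim by simp
    then have "C w = 0" by (simp add: tendsto_const_iff)
    then show "w \<in> N" by (simp add: N_def eq)
  qed
qed

section \<open>Unobservability of generalized eigenvectors yields VIVO\<close>

text \<open>A vanishing input acts on the state as the vanishing forcing \<open>B (u t)\<close>. The
  state then approaches \<open>N\<close>, which \<open>C\<close> cannot see, and the feedthrough
  \<open>D (u t)\<close> vanishes on its own.\<close>

lemma VIVO_of_unobservable:
  assumes "\<And>v z ms. cmod z \<ge> 1 \<Longrightarrow> set ms \<subseteq> log_set z \<Longrightarrow> in_prod_dom domA A ms v \<Longrightarrow>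
    prod_apply A ms v = 0 \<Longrightarrow> v \<in> N"
  shows "VIVO io"
proof -
  have "T 1 ` N \<subseteq> N" using N_invariant by auto
  then have "\<exists>L>0. \<forall>v. infdist (T L v) N \<le> infdist v N / 2"
    by (rule semigroup_decay_modulo[OF N_csubspace N_closed _ assms]) blast+
  then obtain L where L: "0 < L" "\<And>v. infdist (T L v) N \<le> infdist v N / 2" by blast
  have "vanishing y" if uy: "(u, y) \<in> io" "vanishing u" for u y
  proof -
    from uy(1) obtain x where x: "\<And>t. 0 \<le> t \<Longrightarrow> x t \<in> domA"
      "\<And>t. 0 \<le> t \<Longrightarrow> has_halfline_derivative x (A (x t) + B (u t)) t"
      "\<And>t. 0 \<le> t \<Longrightarrow> y t = C (x t) + D (u t)"
      unfolding state_space_relation_mem by blast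
    have u: "(u \<longlongrightarrow> 0) at_top" using uy(2) by (simp add: vanishing_def)
    have Bu: "((\<lambda>t. B (u t)) \<longlongrightarrow> 0) at_top" and Du: "((\<lambda>t. D (u t)) \<longlongrightarrow> 0) at_top"
      using continuous_clinear_tendsto[OF B u] continuous_clinear_tendsto[OF D u]
      by (simp_all add: clinear_simps[OF B_lin] clinear_simps[OF D_lin])
    have "((\<lambda>t. infdist (x t) N) \<longlongrightarrow> 0) at_top"
      by (rule solution_decay_modulo[OF N_csubspace L x(1) x(2)[unfolded has_halfline_derivative_normed] Bu])
    then have "((\<lambda>t. C (x t)) \<longlongrightarrow> 0) at_top"
      using observation_tendsto_0[OF C N_csubspace, of x] N_kernel by blast
    from frechet_tendsto_add[OF this Du] have "((\<lambda>t. C (x t) + D (u t)) \<longlongrightarrow> 0) at_top" by simp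
    then show ?thesis
      unfolding vanishing_def
      by (rule Lim_transform_eventually) (auto simp: x(3) eventually_at_top_linorder intro!: exI[of _ 0])
  qed
  then show ?thesis by (auto simp: VIVO_def)
qed

end

theorem theorem4p13:
  fixes domA :: "'x::complex_banach set" and A :: "'x \<Rightarrow> 'x"
    and B :: "'u::frechet_space \<Rightarrow> 'x"
    and C :: "'x \<Rightarrow> 'y::frechet_space"
    and D :: "'u \<Rightarrow> 'y"
    and P :: "((real \<Rightarrow> 'u) \<times> (real \<Rightarrow> 'y)) set"
  assumes "sectorial domA A" and "compact_resolvent domA A"
    and "continuous_clinear B" and "continuous_clinear C" and "continuous_clinear D"
    and "P = state_space_relation domA A B C D"
  shows "compact_operator (exp_semigroup domA A 1) \<and>
    (stable P \<longleftrightarrow>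
      (\<forall>v0 z ms. cmod z \<ge> 1 \<and> set ms \<subseteq> log_set z \<and>
          in_prod_dom domA A ms v0 \<and> prod_apply A ms v0 = 0 \<longrightarrow>
        v0 \<in> unobservable_subspace (exp_semigroup domA A) C)) \<and>
    (stable P \<longleftrightarrow> VIVO P) \<and>
    (stable P \<longleftrightarrow> smoothly_VIVO P)"
proof -
  let ?T = "exp_semigroup domA A"
  note T = exp_semigroup[OF assms(1)]
  have compact: "compact_operator (?T 1)" by (rule exp_semigroup_compact[OF assms(1,2)])
  interpret state_space_system domA A ?T B C D
    by unfold_locales (use T compact assms in \<open>auto simp: sectorial_def\<close>)
  let ?b = "\<forall>v0 z ms. cmod z \<ge> 1 \<and> set ms \<subseteq> log_set z \<and>
      in_prod_dom domA A ms v0 \<and> prod_apply A ms v0 = 0 \<longrightarrow> v0 \<in> unobservable_subspace ?T C"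
  have zero: "vanishing (\<lambda>_. 0 :: 'u)" by (simp add: vanishing_def)
  have deriv_zero: "(halfline_deriv ^^ k) (\<lambda>_. 0 :: 'u) = (\<lambda>_. 0)" for k
  proof (induction k)
    case (Suc k)
    moreover have "halfline_deriv (\<lambda>_. 0 :: 'u) = (\<lambda>_. 0)"
      by (rule halfline_deriv_ext) (simp_all add: has_halfline_derivative_def)
    ultimately show ?case by simp
  qed simp
  \<comment> \<open>The implications are closed to a cycle; the return from smooth VIVO to stability
    uses that the zero input vanishes with all derivatives.\<close>
  have ab: ?b if "stable P"
    using gen_kernel_unobservable that unfolding assms(6) N_eq by (auto simp: gen_kernel_def)
  have bc: "VIVO P" if ?b
    unfolding assms(6) by (rule VIVO_of_unobservable) (use that N_eq in blast)
  have cd: "smoothly_VIVO P" if "VIVO P"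
    unfolding smoothly_VIVO_def
  proof (clarify)
    fix u y assume uy: "(u, y) \<in> P" "smoothly_vanishing u"
    have "((halfline_deriv ^^ k) u, (halfline_deriv ^^ k) y) \<in> P" for k
      using uy(1) state_space_relation_deriv[OF assms(1,3-5)] unfolding assms(6) by (induction k) auto
    then show "smoothly_vanishing y"
      using that uy(2) unfolding smoothly_vanishing_def VIVO_def by blast
  qed
  have da: "stable P" if "smoothly_VIVO P"
    unfolding stable_def
  proof (intro allI impI)
    fix y assume "((\<lambda>_. 0), y) \<in> P"
    moreover have "smoothly_vanishing (\<lambda>_. 0 :: 'u)" by (simp add: smoothly_vanishing_def deriv_zero zero)
    ultimately have "smoothly_vanishing y" using that by (auto simp: smoothly_VIVO_def)
    then have "vanishing ((halfline_deriv ^^ 0) y)" unfolding smoothly_vanishing_def by blast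
    then show "vanishing y" by simp
  qed
  show ?thesis using compact ab bc cd da by blast
qed

end
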